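(* Let $A\in\mathbb{R}^{N\times N}$, $B\in\mathbb{R}^{N\times N_{\rm in}}$, $C\in\mathbb{R}^{N_{\rm out}\times N}$, $D\in\mathbb{R}^{N_{\rm out}\times N_{\rm in}}$ be partitioned into blocks $A_{ij}\in\mathbb{R}^{k_i\times k_j}$, $B_{il}\in\mathbb{R}^{k_i\times m_l}$, $C_{kj}\in\mathbb{R}^{p_k\times k_j}$, $D_{kl}\in\mathbb{R}^{p_k\times m_l}$, with $i,j=1,\dots,n$, $l=1,\dots,n_{\rm in}$, $k=1,\dots,n_{\rm out}$, $\sum_i k_i=N$, $\sum_l m_l=N_{\rm in}$, $\sum_k p_k=N_{\rm out}$, and suppose every diagonal block $A_{ii}$ is Hurwitz. Define $F\in\mathbb{R}^{n\times n}$, $G\in\mathbb{R}^{n\times n_{\rm in}}$, $H\in\mathbb{R}^{n_{\rm out}\times n}$, $J\in\mathbb{R}^{n_{\rm out}\times n_{\rm in}}$ by $$F_{ii}=-1,\qquad F_{ij}=\|(sI-A_{ii})^{-1}A_{ij}\|_{\mathcal{H}_\infty}\ (i\neq j),\qquad G_{il}=\|(sI-A_{ii})^{-1}B_{il}\|_{\mathcal{H}_\infty},\qquad H_{kj}=\|C_{kj}\|_2,\qquad J_{kl}=\|D_{kl}\|_2 .$$ If $F$ is Hurwitz and $\|H(sI-F)^{-1}G+J\|_{\mathcal{H}_\infty}<\delta$, then $\|C(sI-A)^{-1}B+D\|_{\mathcal{H}_\infty}<\delta$ and there exist positive definite matrices $P_i\in\mathbb{R}^{k_i\times k_i}$, $i=1,\dots,n$,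 such that $P=\mathrm{diag}\{P_1,\dots,P_n\}$ satisfies $$PA+A^{\mathsf T}P+C^{\mathsf T}C-(PB+C^{\mathsf T}D)(D^{\mathsf T}D-\delta^2 I)^{-1}(D^{\mathsf T}C+B^{\mathsf T}P)\prec 0 .$$
   Context: A real square matrix is Hurwitz if all its eigenvalues have negative real part. $\|X\|_2=\overline{\sigma}(X)$ is the largest singular value. For an asymptotically stable rational transfer function $T(s)$, $\|T\|_{\mathcal{H}_\infty}=\sup_{\omega\in\mathbb{R}}\|T(\imath\omega)\|_2$. $X\succ0$ ($X\prec0$) means $X$ is symmetric positive (negative) definite. $\mathrm{diag}\{P_1,\dots,P_n\}$ is the block-diagonal matrix with diagonal blocks $P_i$. The system under consideration is $\dot x=Ax+Bu$, $y=Cx+Du$; the positive system $(F,G,H,J)$ is called its comparison system. *)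

theory Defs
  imports
    "Jordan_Normal_Form.Schur_Decomposition"
    "Jordan_Normal_Form.Gauss_Jordan_Elimination"
    "Jordan_Normal_Form.DL_Submatrix"
begin

abbreviation complex_mat :: "real mat \<Rightarrow> complex mat" where
  "complex_mat \<equiv> map_mat complex_of_real"

(* Meaningful for nonsingular square matrices only: otherwise it is the unspecified value "the None". *)
definition mat_inv :: "'a::field mat \<Rightarrow> 'a mat" where
  "mat_inv X = the (mat_inverse X)"

definition hurwitz :: "real mat \<Rightarrow> bool" where
  "hurwitz X \<longleftrightarrow> square_mat X \<and> (\<forall>\<mu>. eigenvalue (complex_mat X) \<mu> \<longrightarrow> Re \<mu> < 0)"

definition singular_value :: "complex mat \<Rightarrow> real \<Rightarrow> bool" where
  "singular_value X \<sigma> \<longleftrightarrow>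
     \<sigma> \<ge> 0 \<and> eigenvalue (mat_adjoint X * X) (complex_of_real (\<sigma>\<^sup>2))"

(* For a matrix with at least one column the set is finite and nonempty. If X has more columns
   than rows it also contains the extra value 0, which does not affect the maximum. *)
definition spectral_norm :: "complex mat \<Rightarrow> real" where
  "spectral_norm X = Max {\<sigma>. singular_value X \<sigma>}"

(* As usual, this is meant for asymptotically stable rational T, for which the supremum is finite;
   stability is stated separately, via hurwitz, wherever the norm is used. *)
definition hinf_norm :: "(complex \<Rightarrow> complex mat) \<Rightarrow> real" where
  "hinf_norm T = (SUP \<omega>::real. spectral_norm (T (\<i> * complex_of_real \<omega>)))"

definition resolvent :: "real mat \<Rightarrow> complex \<Rightarrow> complex mat" where
  "resolvent X s = mat_inv (s \<cdot>\<^sub>m 1\<^sub>m (dim_row X) - complex_mat X)"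

definition transfer_function ::
    "real mat \<Rightarrow> real mat \<Rightarrow> real mat \<Rightarrow> real mat \<Rightarrow> complex \<Rightarrow> complex mat" where
  "transfer_function A B C D s =
     complex_mat C * resolvent A s * complex_mat B + complex_mat D"

definition positive_definite :: "real mat \<Rightarrow> bool" where
  "positive_definite X \<longleftrightarrow> square_mat X \<and> transpose_mat X = X \<and>
     (\<forall>v \<in> carrier_vec (dim_row X). v \<noteq> 0\<^sub>v (dim_row X) \<longrightarrow> v \<bullet> (X *\<^sub>v v) > 0)"

definition negative_definite :: "real mat \<Rightarrow> bool" where
  "negative_definite X \<longleftrightarrow> square_mat X \<and> transpose_mat X = X \<and>
     (\<forall>v \<in> carrier_vec (dim_row X). v \<noteq> 0\<^sub>v (dim_row X) \<longrightarrow> v \<bullet> (X *\<^sub>v v) < 0)"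

(* A partition of N indices into n blocks is given by the block sizes k 0, ..., k (n - 1), with sum N;
   blocks and entries are numbered from 0. *)
definition block_indices :: "(nat \<Rightarrow> nat) \<Rightarrow> nat \<Rightarrow> nat set" where
  "block_indices k i = {(\<Sum>r<i. k r) ..< (\<Sum>r<Suc i. k r)}"

definition block :: "(nat \<Rightarrow> nat) \<Rightarrow> (nat \<Rightarrow> nat) \<Rightarrow> 'a mat \<Rightarrow> nat \<Rightarrow> nat \<Rightarrow> 'a mat" where
  "block k m X i j = submatrix X (block_indices k i) (block_indices m j)"

definition comparison_F :: "nat \<Rightarrow> (nat \<Rightarrow> nat) \<Rightarrow> real mat \<Rightarrow> real mat" where
  "comparison_F n k A = mat n n (\<lambda>(i, j).
     if i = j then -1
     else hinf_norm (\<lambda>s. resolvent (block k k A i i) s * complex_mat (block k k A i j)))"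

definition comparison_G ::
    "nat \<Rightarrow> nat \<Rightarrow> (nat \<Rightarrow> nat) \<Rightarrow> (nat \<Rightarrow> nat) \<Rightarrow> real mat \<Rightarrow> real mat \<Rightarrow> real mat" where
  "comparison_G n n_in k m A B = mat n n_in (\<lambda>(i, l).
     hinf_norm (\<lambda>s. resolvent (block k k A i i) s * complex_mat (block k m B i l)))"

definition comparison_H ::
    "nat \<Rightarrow> nat \<Rightarrow> (nat \<Rightarrow> nat) \<Rightarrow> (nat \<Rightarrow> nat) \<Rightarrow> real mat \<Rightarrow> real mat" where
  "comparison_H n_out n p k C = mat n_out n (\<lambda>(q, j). spectral_norm (complex_mat (block p k C q j)))"

definition comparison_J ::
    "nat \<Rightarrow> nat \<Rightarrow> (nat \<Rightarrow> nat) \<Rightarrow> (nat \<Rightarrow> nat) \<Rightarrow> real mat \<Rightarrow> real mat" where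
  "comparison_J n_out n_in p m D =
     mat n_out n_in (\<lambda>(q, l). spectral_norm (complex_mat (block p m D q l)))"

end

theory Submission
  imports Defs
begin

text \<open>
The proof is a small-gain argument carried by one quadratic storage function. Write \<open>x\<^sub>i\<close>, \<open>u\<^sub>l\<close> for the
blocks of state and input, and suppose that positive vectors \<open>\<xi>\<close>, \<open>\<eta>\<close>, \<open>v\<close> satisfy, with
\<open>y = H \<xi> + J v\<close>,
\<open>F \<xi> + G v < 0\<close>, \<open>F\<^sup>T \<eta> + H\<^sup>T y < 0\<close>, \<open>G\<^sup>T \<eta> + J\<^sup>T y < \<delta>\<^sup>2 v\<close>.

The first inequality says that block \<open>i\<close>, driven by the other blocks and the external inputs, has gain
below one when these inputs are weighted by \<open>F\<^sub>i\<^sub>j \<xi>\<^sub>i / \<xi>\<^sub>j\<close> and \<open>G\<^sub>i\<^sub>l \<xi>\<^sub>i / v\<^sub>l\<close>. The bounded real lemma turns this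
into a positive definite storage matrix for the block (\<open>subsystem_dissipation\<close>). Summed over \<open>i\<close> with
weights \<open>\<eta>\<^sub>i / \<xi>\<^sub>i\<close>, and combined with the same kind of estimate for the output, these storage matrices form a
block-diagonal \<open>P\<close>; the other two inequalities say precisely that all remaining coefficients of \<open>\<bar>x\<^sub>j\<bar>\<^sup>2\<close> and
\<open>\<bar>u\<^sub>l\<bar>\<^sup>2\<close> are negative (\<open>block_diagonal_dissipation\<close>). The resulting strict dissipation inequality contains
all conclusions: evaluated at eigenvectors it gives stability, at harmonic inputs the bound on the
H-infinity norm (\<open>dissipation_stability_and_gain\<close>), and at the worst input the Riccati inequality
(\<open>dissipation_riccati\<close>).

The vectors exist because the comparison system is positive (\<open>comparison_vectors\<close>). A Hurwitz Metzler
matrix has a positive vector on which it is negative (\<open>metzler_hurwitz_subsolution\<close>) and a nonnegative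
negative inverse. The gain condition at frequency zero makes \<open>T\<^sup>T T - \<delta>\<^sup>2 I\<close> such a matrix, where \<open>T\<close> is the
static gain; this provides \<open>v\<close>, and \<open>\<xi>\<close>, \<open>\<eta>\<close> are slightly enlarged static responses of the system and of its
dual.

The bounded real lemma is proved by solving its Riccati equation (\<open>riccati_solution\<close>): the frequency
condition keeps the eigenvalues of a Hamiltonian matrix off the imaginary axis, and a basis of its stable
subspace, obtained from a Schur decomposition with the stable eigenvalues first, yields the solution. One
elementary Lyapunov lemma (\<open>lyapunov_positive\<close>) gives definiteness throughout; it also takes the place of
the spectral theorem in showing that spectral norms are gains.
\<close>

section \<open>Adjoints and the Lyapunov inequality\<close>

lemma mat_adjoint_carrier:
  "M \<in> carrier_mat a b \<Longrightarrow> mat_adjoint M \<in> carrier_mat b a"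
  unfolding mat_adjoint_def by auto

lemma mat_adjoint_index [simp]:
  fixes M :: "complex mat"
  assumes "i < dim_col M" "j < dim_row M"
  shows "mat_adjoint M $$ (i, j) = cnj (M $$ (j, i))"
  using assms unfolding mat_adjoint_def by (auto simp: mat_of_rows_def)

lemma mat_adjoint_complex_mat: "mat_adjoint (complex_mat M) = complex_mat (transpose_mat M)"
  by (rule eq_matI) (auto simp: mat_adjoint_def mat_of_rows_def)

text \<open>The unspecified value in \<open>mat_inv\<close> is avoided as soon as the kernel is trivial.\<close>

lemma mat_inv_inverse:
  fixes X :: "'a :: field mat"
  assumes X: "X \<in> carrier_mat n n"
    and inj: "\<And>c. c \<in> carrier_vec n \<Longrightarrow> X *\<^sub>v c = 0\<^sub>v n \<Longrightarrow> c = 0\<^sub>v n"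
  shows "mat_inv X \<in> carrier_mat n n" "X * mat_inv X = 1\<^sub>m n" "mat_inv X * X = 1\<^sub>m n"
proof -
  have "det X \<noteq> 0" using det_0_iff_vec_prod_zero_field[OF X] inj by auto
  then have "X \<in> Units (ring_mat TYPE('a) n ())" by (rule det_non_zero_imp_unit[OF X])
  then obtain Y where Y: "mat_inverse X = Some Y"
    using mat_inverse(1)[OF X, of "()"] by (cases "mat_inverse X") auto
  from mat_inverse(2)[OF X Y] Y
  show "mat_inv X \<in> carrier_mat n n" "X * mat_inv X = 1\<^sub>m n" "mat_inv X * X = 1\<^sub>m n"
    by (auto simp: mat_inv_def)
qed

lemma mult_mat_vec_index:
  assumes "M \<in> carrier_mat a b" "v \<in> carrier_vec b" "i < a"
  shows "(M *\<^sub>v v) $ i = (\<Sum>j<b. M $$ (i, j) * v $ j)"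
  using assms by (auto simp: scalar_prod_def lessThan_atLeast0)

lemma cscalar_prod_sum:
  fixes v w :: "complex vec"
  assumes "w \<in> carrier_vec n"
  shows "v \<bullet>c w = (\<Sum>i<n. v $ i * cnj (w $ i))"
  using assms by (auto simp: scalar_prod_def lessThan_atLeast0)

lemma adjoint_swap:
  fixes M :: "complex mat"
  assumes M: "M \<in> carrier_mat a b" and x: "x \<in> carrier_vec b" and y: "y \<in> carrier_vec a"
  shows "(M *\<^sub>v x) \<bullet>c y = x \<bullet>c (mat_adjoint M *\<^sub>v y)"
proof -
  have aM: "mat_adjoint M \<in> carrier_mat b a" using M by (rule mat_adjoint_carrier)
  have "(M *\<^sub>v x) \<bullet>c y = (\<Sum>i<a. \<Sum>j<b. M $$ (i, j) * x $ j * cnj (y $ i))"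
    using y by (simp add: cscalar_prod_sum mult_mat_vec_index[OF M x] sum_distrib_right)
  also have "\<dots> = (\<Sum>j<b. \<Sum>i<a. M $$ (i, j) * x $ j * cnj (y $ i))"
    by (rule sum.swap)
  also have "\<dots> = (\<Sum>j<b. x $ j * cnj (\<Sum>i<a. mat_adjoint M $$ (j, i) * y $ i))"
    using M by (auto simp: sum_distrib_left algebra_simps intro!: sum.cong)
  also have "\<dots> = x \<bullet>c (mat_adjoint M *\<^sub>v y)"
    using cscalar_prod_sum[of "mat_adjoint M *\<^sub>v y" b x] aM y
    by (simp add: mult_mat_vec_index[OF aM y] del: index_mult_mat_vec)
  finally show ?thesis .
qed

text \<open>Induction on the dimension. The first unit vector is an eigenvector of the triangular \<open>t\<close>, which
gives \<open>p 0 0 > 0\<close>; on the complement that is \<open>p\<close>-orthogonal to it, the Schur complement of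
\<open>p 0 0\<close> and the trailing part of \<open>t\<close> satisfy the same hypotheses. Functions on indices are used because the dimension changes in the induction.\<close>

lemma lyapunov_triangular:
  fixes p t :: "nat \<Rightarrow> nat \<Rightarrow> complex"
  assumes "\<And>i j. i < n \<Longrightarrow> j < n \<Longrightarrow> p i j = cnj (p j i)"
    and "\<And>i j. i < n \<Longrightarrow> j < i \<Longrightarrow> t i j = 0"
    and "\<And>i. i < n \<Longrightarrow> Re (t i i) < 0"
    and "\<And>c. \<exists>i<n. c i \<noteq> 0 \<Longrightarrow>
      Re (\<Sum>j<n. cnj (\<Sum>i<n. p j i * c i) * (\<Sum>l<n. t j l * c l)) < 0"
    and "\<exists>i<n. c i \<noteq> 0"
  shows "Re (\<Sum>j<n. cnj (\<Sum>i<n. p j i * c i) * c j) > 0"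
  using assms
proof (induction n arbitrary: p t c)
  case 0
  from 0(5) show ?case by simp
next
  case (Suc n)
  \<comment> \<open>the Schur complement of \<open>p 0 0\<close>\<close>
  define s where "s i j = p (Suc i) (Suc j) - p (Suc i) 0 * p 0 (Suc j) / p 0 0" for i j
  define t' where "t' i j = t (Suc i) (Suc j)" for i j
  have herm: "p i j = cnj (p j i)" if "i \<le> n" "j \<le> n" for i j
    by (rule Suc.prems(1)) (use that in simp_all)
  have im: "Im (p 0 0) = 0" using arg_cong[OF herm[of 0 0], of Im] by simp
  have tri: "t (Suc i) 0 = 0" if "i < n" for i using Suc.prems(2)[of "Suc i" 0] that by simp
  have pos: "Re (p 0 0) > 0"
  proof -
    have "Re (\<Sum>j<Suc n. cnj (\<Sum>i<Suc n. p j i * (if i = 0 then 1 else 0)) *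
        (\<Sum>l<Suc n. t j l * (if l = 0 then 1 else 0))) < 0"
      by (rule Suc.prems(4)) auto
    moreover have "(\<Sum>j<Suc n. cnj (\<Sum>i<Suc n. p j i * (if i = 0 then 1 else 0)) *
        (\<Sum>l<Suc n. t j l * (if l = 0 then 1 else 0))) = cnj (p 0 0) * t 0 0"
      by (simp add: sum.lessThan_Suc_shift tri del: sum.lessThan_Suc)
    ultimately have "Re (p 0 0) * Re (t 0 0) < 0" using im by (simp only:) simp
    then show ?thesis using Suc.prems(3)[of 0] by (simp add: mult_less_0_iff)
  qed
  then have nz: "p 0 0 \<noteq> 0" by auto
  \<comment> \<open>the first coordinate of \<open>c\<close> after completing the square; it vanishes on the \<open>p\<close>-orthogonal complement\<close>
  define e where "e c = c 0 + (\<Sum>j<n. p 0 (Suc j) * c (Suc j)) / p 0 0" for c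
  have pc0: "(\<Sum>i<Suc n. p 0 i * c i) = p 0 0 * e c" for c
    using nz by (simp add: sum.lessThan_Suc_shift e_def distrib_left del: sum.lessThan_Suc)
  have pcS: "(\<Sum>i<Suc n. p (Suc j) i * c i) = (\<Sum>i<n. s j i * c (Suc i)) + p (Suc j) 0 * e c" for c j
  proof -
    have "(\<Sum>i<n. s j i * c (Suc i)) = (\<Sum>i<n. p (Suc j) (Suc i) * c (Suc i) -
        p (Suc j) 0 / p 0 0 * (p 0 (Suc i) * c (Suc i)))"
      by (simp add: s_def left_diff_distrib mult.assoc)
    also have "\<dots> = (\<Sum>i<n. p (Suc j) (Suc i) * c (Suc i)) -
        p (Suc j) 0 / p 0 0 * (\<Sum>i<n. p 0 (Suc i) * c (Suc i))"
      by (simp only: sum_subtractf sum_distrib_left)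
    finally show ?thesis
      by (simp add: sum.lessThan_Suc_shift e_def distrib_left del: sum.lessThan_Suc)
  qed
  have tcS: "(\<Sum>l<Suc n. t (Suc j) l * c l) = (\<Sum>l<n. t' j l * c (Suc l))" if "j < n" for c j
    using that by (simp add: sum.lessThan_Suc_shift t'_def tri del: sum.lessThan_Suc)
  have IH: "Re (\<Sum>j<n. cnj (\<Sum>i<n. s j i * c i) * c j) > 0" if c: "\<exists>i<n. c i \<noteq> 0" for c
  proof (rule Suc.IH[of s t' c])
    show "s i j = cnj (s j i)" if "i < n" "j < n" for i j
    proof -
      have "cnj (p 0 0) = p 0 0" using im by (simp add: complex_eq_iff)
      moreover have "cnj (p (Suc j) (Suc i)) = p (Suc i) (Suc j)" "cnj (p (Suc j) 0) = p 0 (Suc j)"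
        "cnj (p 0 (Suc i)) = p (Suc i) 0"
        by (rule herm[symmetric], use that in simp, use that in simp)+
      ultimately show ?thesis by (simp add: s_def)
    qed
    show "t' i j = 0" if "i < n" "j < i" for i j
      using that Suc.prems(2)[of "Suc i" "Suc j"] by (simp add: t'_def)
    show "Re (t' i i) < 0" if "i < n" for i
      using that Suc.prems(3)[of "Suc i"] by (simp add: t'_def)
    show "\<exists>i<n. c i \<noteq> 0" by (rule c)
    fix d :: "nat \<Rightarrow> complex" assume d: "\<exists>i<n. d i \<noteq> 0"
    define c where "c i = (case i of 0 \<Rightarrow> - (\<Sum>j<n. p 0 (Suc j) * d j) / p 0 0 | Suc i \<Rightarrow> d i)" for i
    have cS [simp]: "c (Suc i) = d i" for i by (simp add: c_def)
    have e0: "e c = 0" by (simp add: e_def) (simp add: c_def)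
    have "\<exists>i<Suc n. c i \<noteq> 0" using d cS by (metis Suc_less_eq)
    from Suc.prems(4)[OF this]
    show "Re (\<Sum>j<n. cnj (\<Sum>i<n. s j i * d i) * (\<Sum>l<n. t' j l * d l)) < 0"
      by (subst (asm) sum.lessThan_Suc_shift) (simp add: pc0 pcS e0 tcS del: sum.lessThan_Suc cnj_sum)
  qed
  have "(\<Sum>j<Suc n. cnj (\<Sum>i<Suc n. p j i * c i) * c j) =
      cnj (p 0 0 * e c) * c 0 + (\<Sum>j<n. cnj ((\<Sum>i<n. s j i * c (Suc i)) + p (Suc j) 0 * e c) * c (Suc j))"
    by (subst sum.lessThan_Suc_shift) (simp only: pc0 pcS)
  also have "\<dots> = cnj (p 0 0 * e c) * c 0 + (\<Sum>j<n. cnj (\<Sum>i<n. s j i * c (Suc i)) * c (Suc j))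
      + cnj (e c) * (\<Sum>j<n. p 0 (Suc j) * c (Suc j))"
  proof -
    have "cnj (p (Suc j) 0) = p 0 (Suc j)" if "j < n" for j
      by (rule herm[symmetric]) (use that in simp_all)
    then show ?thesis by (simp add: algebra_simps sum.distrib sum_distrib_left del: cnj_sum)
  qed
  also have "\<dots> = p 0 0 * (e c * cnj (e c)) + (\<Sum>j<n. cnj (\<Sum>i<n. s j i * c (Suc i)) * c (Suc j))"
  proof -
    have h: "(\<Sum>j<n. p 0 (Suc j) * c (Suc j)) = p 0 0 * (e c - c 0)" using nz by (simp add: e_def)
    have h': "cnj (p 0 0) = p 0 0" using im by (simp add: complex_eq_iff)
    show ?thesis by (simp only: h h' complex_cnj_mult) (simp add: algebra_simps del: cnj_sum)
  qed
  finally have *: "Re (\<Sum>j<Suc n. cnj (\<Sum>i<Suc n. p j i * c i) * c j) =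
      Re (p 0 0) * (cmod (e c))\<^sup>2 + Re (\<Sum>j<n. cnj (\<Sum>i<n. s j i * c (Suc i)) * c (Suc j))"
    by (simp add: im del: cnj_sum flip: complex_norm_square)
  show ?case
  proof (cases "\<exists>i<n. c (Suc i) \<noteq> 0")
    case True
    from IH[of "\<lambda>i. c (Suc i)", OF True] pos show ?thesis unfolding * by (simp add: add_nonneg_pos)
  next
    case False
    then have "c 0 \<noteq> 0" using Suc.prems(5) by (metis less_Suc_eq_0_disj)
    moreover have "e c = c 0" using False by (simp add: e_def)
    ultimately have "Re (p 0 0) * (cmod (e c))\<^sup>2 > 0" using pos by simp
    moreover have "(\<Sum>j<n. cnj (\<Sum>i<n. s j i * c (Suc i)) * c (Suc j)) = 0"
      using False by (intro sum.neutral) auto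
    ultimately show ?thesis unfolding * by simp
  qed
qed

lemma mat_adjoint_mult:
  fixes M K :: "complex mat"
  assumes M: "M \<in> carrier_mat a b" and K: "K \<in> carrier_mat b c"
  shows "mat_adjoint (M * K) = mat_adjoint K * mat_adjoint M"
proof (rule eq_matI)
  have aM: "mat_adjoint M \<in> carrier_mat b a" and aK: "mat_adjoint K \<in> carrier_mat c b"
    using M K by (simp_all add: mat_adjoint_carrier)
  show "dim_row (mat_adjoint (M * K)) = dim_row (mat_adjoint K * mat_adjoint M)"
    "dim_col (mat_adjoint (M * K)) = dim_col (mat_adjoint K * mat_adjoint M)"
    using M K by (simp_all add: mat_adjoint_def)
  fix i j assume "i < dim_row (mat_adjoint K * mat_adjoint M)" "j < dim_col (mat_adjoint K * mat_adjoint M)"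
  then have "i < c" "j < a" using aM aK by auto
  then show "mat_adjoint (M * K) $$ (i, j) = (mat_adjoint K * mat_adjoint M) $$ (i, j)"
    using M K aM aK by (auto simp: scalar_prod_def mult.commute intro!: sum.cong)
qed

lemma mat_adjoint_adjoint [simp]: "mat_adjoint (mat_adjoint M) = (M :: complex mat)"
  by (rule eq_matI) (auto simp: mat_adjoint_def mat_of_rows_def)

definition norm_sq :: "complex vec \<Rightarrow> real" where
  "norm_sq v = (\<Sum>i<dim_vec v. (cmod (v $ i))\<^sup>2)"

lemma norm_sq_nonneg [simp]: "0 \<le> norm_sq v"
  by (simp add: norm_sq_def sum_nonneg)

lemma cscalar_prod_self: "v \<bullet>c v = of_real (norm_sq v)"
  by (simp add: cscalar_prod_sum[OF carrier_vecI[OF refl]] norm_sq_def flip: complex_norm_square)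

lemma norm_sq_eq_0_iff:
  assumes "v \<in> carrier_vec n"
  shows "norm_sq v = 0 \<longleftrightarrow> v = 0\<^sub>v n"
proof -
  have "norm_sq v = 0 \<longleftrightarrow> (\<forall>i<dim_vec v. v $ i = 0)"
    unfolding norm_sq_def by (subst sum_nonneg_eq_0_iff) auto
  then show ?thesis using assms by (auto intro!: eq_vecI)
qed

lemma norm_sq_pos:
  assumes "v \<in> carrier_vec n" "v \<noteq> 0\<^sub>v n"
  shows "0 < norm_sq v"
  using norm_sq_eq_0_iff[OF assms(1)] assms(2) norm_sq_nonneg[of v] by linarith

lemma norm_sq_zero [simp]: "norm_sq (0\<^sub>v n) = 0"
  by (simp add: norm_sq_def)

text \<open>A Lyapunov function that decreases strictly along a stable system is positive definite. A Schur
triangularisation \<open>A = S T S'\<close> reduces this to the triangular case, with the Hermitian form carried along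
as \<open>S\<^sup>* P S\<close>.\<close>

lemma lyapunov_positive:
  fixes A P :: "complex mat"
  assumes A: "A \<in> carrier_mat n n" and P: "P \<in> carrier_mat n n"
    and stable: "\<And>\<mu>. eigenvalue A \<mu> \<Longrightarrow> Re \<mu> < 0"
    and herm: "mat_adjoint P = P"
    and neg: "\<And>c. c \<in> carrier_vec n \<Longrightarrow> c \<noteq> 0\<^sub>v n \<Longrightarrow> Re ((A *\<^sub>v c) \<bullet>c (P *\<^sub>v c)) < 0"
    and c: "c \<in> carrier_vec n" "c \<noteq> 0\<^sub>v n"
  shows "Re (c \<bullet>c (P *\<^sub>v c)) > 0"
proof -
  obtain es where es: "char_poly A = (\<Prod>e\<leftarrow>es. [:- e, 1:])"
    using char_poly_factorized[OF A] by blast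
  obtain T S S' where sd: "schur_decomposition A es = (T, S, S')" by (metis surj_pair)
  have wit: "similar_mat_wit A T S S'" and ut: "upper_triangular T" and dg: "diag_mat T = es"
    using schur_decomposition[OF A es sd] by auto
  note w = similar_mat_witD2[OF A wit]
  have T: "T \<in> carrier_mat n n" and S: "S \<in> carrier_mat n n" and S': "S' \<in> carrier_mat n n"
    using w by auto
  define M where "M = mat_adjoint S * P * S"
  have aS: "mat_adjoint S \<in> carrier_mat n n" using S by (rule mat_adjoint_carrier)
  have M: "M \<in> carrier_mat n n" using S P aS by (auto simp: M_def)
  have hM: "mat_adjoint M = M"
    unfolding M_def using S P aS
    by (simp add: mat_adjoint_mult[of _ n n _ n] herm assoc_mult_mat[of _ n n _ n _ n])
  have key: "Re ((\<Sum>j<n. cnj (\<Sum>i<n. M $$ (j, i) * d $ i) * f $ j)) = Re ((S *\<^sub>v f) \<bullet>c (P *\<^sub>v (S *\<^sub>v d)))"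
    if d: "d \<in> carrier_vec n" and f: "f \<in> carrier_vec n" for d f
  proof -
    have "(S *\<^sub>v f) \<bullet>c (P *\<^sub>v (S *\<^sub>v d)) = f \<bullet>c (mat_adjoint S *\<^sub>v (P *\<^sub>v (S *\<^sub>v d)))"
      by (rule adjoint_swap[OF S f]) (use P S d in auto)
    also have "mat_adjoint S *\<^sub>v (P *\<^sub>v (S *\<^sub>v d)) = M *\<^sub>v d"
      unfolding M_def using S P aS d by (simp add: assoc_mult_mat_vec[of _ n n _ n])
    also have "f \<bullet>c (M *\<^sub>v d) = (\<Sum>j<n. f $ j * cnj (\<Sum>i<n. M $$ (j, i) * d $ i))"
      using M d by (subst cscalar_prod_sum[of _ n]) (auto simp: mult_mat_vec_index[OF M d] simp del: index_mult_mat_vec)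
    finally show ?thesis by (simp add: mult.commute)
  qed
  have SS: "S * S' = 1\<^sub>m n" "S' * S = 1\<^sub>m n" and AT: "A = S * T * S'" using w by auto
  have AS: "A *\<^sub>v (S *\<^sub>v d) = S *\<^sub>v (T *\<^sub>v d)" if d: "d \<in> carrier_vec n" for d
  proof -
    have "A *\<^sub>v (S *\<^sub>v d) = S *\<^sub>v (T *\<^sub>v (S' *\<^sub>v (S *\<^sub>v d)))"
      using S T S' d by (simp add: AT assoc_mult_mat_vec[of _ n n _ n])
    also have "S' *\<^sub>v (S *\<^sub>v d) = d"
      using S S' d by (simp add: SS flip: assoc_mult_mat_vec[of _ n n _ n])
    finally show ?thesis .
  qed
  have nzS: "S *\<^sub>v d \<noteq> 0\<^sub>v n" if d: "d \<in> carrier_vec n" "d \<noteq> 0\<^sub>v n" for d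
  proof
    assume "S *\<^sub>v d = 0\<^sub>v n"
    then have "S' *\<^sub>v (S *\<^sub>v d) = 0\<^sub>v n" using S' by auto
    then show False using S S' d by (simp add: SS flip: assoc_mult_mat_vec[of _ n n _ n])
  qed
  have vnz: "vec n f \<noteq> 0\<^sub>v n" if "\<exists>i<n. f i \<noteq> 0" for f :: "nat \<Rightarrow> complex"
    using that by (metis index_vec index_zero_vec(1))
  define d where "d = S' *\<^sub>v c"
  have d: "d \<in> carrier_vec n" using S' c by (simp add: d_def)
  have Sd: "S *\<^sub>v d = c" using S S' c by (simp add: d_def SS flip: assoc_mult_mat_vec[of _ n n _ n])
  have "Re (\<Sum>j<n. cnj (\<Sum>i<n. M $$ (j, i) * d $ i) * d $ j) > 0"
  proof (rule lyapunov_triangular[where t = "\<lambda>i j. T $$ (i, j)"])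
    show "M $$ (i, j) = cnj (M $$ (j, i))" if "i < n" "j < n" for i j
      using that M by (subst hM[symmetric]) auto
    show "T $$ (i, j) = 0" if "i < n" "j < i" for i j
      using ut that T by auto
    show "Re (T $$ (i, i)) < 0" if "i < n" for i
    proof (rule stable)
      have "T $$ (i, i) \<in> set es" using dg that T by (auto simp: diag_mat_def)
      then show "eigenvalue A (T $$ (i, i))"
        unfolding eigenvalue_root_char_poly[OF A] es by (auto simp: poly_prod_list prod_list_zero_iff)
    qed
    show "Re (\<Sum>j<n. cnj (\<Sum>i<n. M $$ (j, i) * f i) * (\<Sum>l<n. T $$ (j, l) * f l)) < 0"
      if "\<exists>i<n. f i \<noteq> 0" for f
    proof -
      define g where "g = vec n f"
      have g: "g \<in> carrier_vec n" by (simp add: g_def)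
      have Tg: "T *\<^sub>v g \<in> carrier_vec n" using T g by simp
      have "(\<Sum>j<n. cnj (\<Sum>i<n. M $$ (j, i) * f i) * (\<Sum>l<n. T $$ (j, l) * f l)) =
        (\<Sum>j<n. cnj (\<Sum>i<n. M $$ (j, i) * g $ i) * (T *\<^sub>v g) $ j)"
      proof (rule sum.cong[OF refl])
        fix j assume "j \<in> {..<n}"
        then have "(T *\<^sub>v g) $ j = (\<Sum>l<n. T $$ (j, l) * f l)"
          by (subst mult_mat_vec_index[OF T g]) (simp_all add: g_def)
        then show "cnj (\<Sum>i<n. M $$ (j, i) * f i) * (\<Sum>l<n. T $$ (j, l) * f l) =
          cnj (\<Sum>i<n. M $$ (j, i) * g $ i) * (T *\<^sub>v g) $ j"
          by (simp add: g_def)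
      qed
      moreover have "Re ((S *\<^sub>v (T *\<^sub>v g)) \<bullet>c (P *\<^sub>v (S *\<^sub>v g))) < 0"
        unfolding AS[OF g, symmetric] using neg[of "S *\<^sub>v g"] nzS[OF g] vnz[OF that] S g by (auto simp: g_def)
      ultimately show ?thesis using key[OF g Tg] by (simp only:)
    qed
    show "\<exists>i<n. d $ i \<noteq> 0"
    proof (rule ccontr)
      assume "\<not> ?thesis"
      then have "d = 0\<^sub>v n" using d by (intro eq_vecI) auto
      then show False using Sd c S by auto
    qed
  qed
  then show ?thesis unfolding key[OF d d] Sd .
qed

text \<open>This instance of the Lyapunov lemma replaces the spectral theorem: \<open>-N\<close> is stable, and \<open>N\<close> is itself
a Lyapunov function for it, because the inner product of \<open>-N d\<close> and \<open>N d\<close> is \<open>-\<bar>N d\<bar>\<^sup>2\<close>.\<close>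

lemma hermitian_positive:
  fixes N :: "complex mat"
  assumes N: "N \<in> carrier_mat n n" and herm: "mat_adjoint N = N"
    and pos: "\<And>\<mu>. eigenvalue N \<mu> \<Longrightarrow> Re \<mu> > 0"
    and c: "c \<in> carrier_vec n" "c \<noteq> 0\<^sub>v n"
  shows "Re (c \<bullet>c (N *\<^sub>v c)) > 0"
proof (rule lyapunov_positive[of "- N" n N])
  show "- N \<in> carrier_mat n n" using N by simp
  show "N \<in> carrier_mat n n" by (rule N)
  show "Re \<mu> < 0" if ev: "eigenvalue (- N) \<mu>" for \<mu>
  proof -
    from ev obtain v where v: "v \<in> carrier_vec n" "v \<noteq> 0\<^sub>v n" "- N *\<^sub>v v = \<mu> \<cdot>\<^sub>v v"
      using N unfolding eigenvalue_def eigenvector_def by auto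
    have "N *\<^sub>v v = - (- N *\<^sub>v v)" using N v(1) by (simp add: uminus_mult_mat_vec)
    also have "\<dots> = (- \<mu>) \<cdot>\<^sub>v v" by (subst v(3)) (auto intro!: eq_vecI)
    finally have "eigenvalue N (- \<mu>)" using v N unfolding eigenvalue_def eigenvector_def by auto
    from pos[OF this] show ?thesis by simp
  qed
  show "mat_adjoint N = N" by (rule herm)
  show "c \<in> carrier_vec n" "c \<noteq> 0\<^sub>v n" by fact+
  fix d :: "complex vec" assume d: "d \<in> carrier_vec n" "d \<noteq> 0\<^sub>v n"
  have Nd: "N *\<^sub>v d \<in> carrier_vec n" using N d by simp
  have "N *\<^sub>v d \<noteq> 0\<^sub>v n"
  proof
    assume "N *\<^sub>v d = 0\<^sub>v n"
    then have "N *\<^sub>v d = 0 \<cdot>\<^sub>v d" using d by (auto intro!: eq_vecI)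
    then have "eigenvalue N 0" using d N unfolding eigenvalue_def eigenvector_def by auto
    from pos[OF this] show False by simp
  qed
  then have "norm_sq (N *\<^sub>v d) > 0" using norm_sq_pos[OF Nd] by simp
  moreover have "(- N *\<^sub>v d) \<bullet>c (N *\<^sub>v d) = - of_real (norm_sq (N *\<^sub>v d))"
    using N d Nd by (simp add: uminus_mult_mat_vec flip: cscalar_prod_self)
  ultimately show "Re ((- N *\<^sub>v d) \<bullet>c (N *\<^sub>v d)) < 0" by simp
qed

section \<open>Spectral and H-infinity norms as best gain constants\<close>

lemma scalar_mat_mult_vec:
  fixes w :: "'a :: comm_ring_1 vec"
  assumes w: "w \<in> carrier_vec n"
  shows "(a \<cdot>\<^sub>m 1\<^sub>m n) *\<^sub>v w = a \<cdot>\<^sub>v w"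
proof (rule eq_vecI)
  fix i assume "i < dim_vec (a \<cdot>\<^sub>v w)"
  then have i: "i < n" using w by simp
  have "((a \<cdot>\<^sub>m 1\<^sub>m n) *\<^sub>v w) $ i = (\<Sum>j<n. (if j = i then a * w $ j else 0))"
    by (subst mult_mat_vec_index[OF _ w i], simp, rule sum.cong[OF refl]) (use i in auto)
  then show "((a \<cdot>\<^sub>m 1\<^sub>m n) *\<^sub>v w) $ i = (a \<cdot>\<^sub>v w) $ i" using i w by simp
qed (use w in simp)

lemma gram_form:
  fixes X :: "complex mat"
  assumes X: "X \<in> carrier_mat a b" and v: "v \<in> carrier_vec b"
  shows "v \<bullet>c ((mat_adjoint X * X) *\<^sub>v v) = of_real (norm_sq (X *\<^sub>v v))"
proof -
  have aX: "mat_adjoint X \<in> carrier_mat b a" using X by (rule mat_adjoint_carrier)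
  have "v \<bullet>c ((mat_adjoint X * X) *\<^sub>v v) = v \<bullet>c (mat_adjoint X *\<^sub>v (X *\<^sub>v v))"
    using aX X v by (simp add: assoc_mult_mat_vec[of _ b a _ b])
  also have "\<dots> = (X *\<^sub>v v) \<bullet>c (X *\<^sub>v v)"
    by (rule adjoint_swap[symmetric, OF X v]) (use X v in simp)
  finally show ?thesis by (simp add: cscalar_prod_self)
qed

text \<open>Eigenvalues of \<open>X\<^sup>* X\<close> are Rayleigh quotients, hence real and nonnegative; this makes the set of
singular values nonempty and links its maximum to gains.\<close>

lemma eigenvalue_gram:
  fixes X :: "complex mat"
  assumes X: "X \<in> carrier_mat a b" and ev: "eigenvalue (mat_adjoint X * X) \<mu>"
  obtains v where "v \<in> carrier_vec b" "v \<noteq> 0\<^sub>v b" "\<mu> = of_real (norm_sq (X *\<^sub>v v) / norm_sq v)"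
proof -
  have aX: "mat_adjoint X \<in> carrier_mat b a" using X by (rule mat_adjoint_carrier)
  have dim: "dim_row (mat_adjoint X) = b" using aX by simp
  from ev obtain v where v: "v \<in> carrier_vec b" "v \<noteq> 0\<^sub>v b"
      and e: "(mat_adjoint X * X) *\<^sub>v v = \<mu> \<cdot>\<^sub>v v"
    unfolding eigenvalue_def eigenvector_def using dim by auto
  have "of_real (norm_sq (X *\<^sub>v v)) = v \<bullet>c (\<mu> \<cdot>\<^sub>v v)"
    using gram_form[OF X v(1)] e by simp
  also have "\<dots> = cnj \<mu> * of_real (norm_sq v)"
    using v by (simp add: conjugate_smult_vec flip: cscalar_prod_self)
  finally have "cnj \<mu> = of_real (norm_sq (X *\<^sub>v v) / norm_sq v)"
    using norm_sq_pos[OF v] by (simp add: field_simps)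
  then have "\<mu> = of_real (norm_sq (X *\<^sub>v v) / norm_sq v)"
    by (metis complex_cnj_cnj complex_cnj_complex_of_real)
  with v show ?thesis by (rule that)
qed

lemma finite_singular_values:
  fixes X :: "complex mat"
  assumes X: "X \<in> carrier_mat a b"
  shows "finite {\<sigma>. singular_value X \<sigma>}"
proof -
  have aX: "mat_adjoint X \<in> carrier_mat b a" using X by (rule mat_adjoint_carrier)
  have M: "mat_adjoint X * X \<in> carrier_mat b b" using aX X by simp
  have "char_poly (mat_adjoint X * X) \<noteq> 0"
    using degree_monic_char_poly[OF M] by auto
  then have "finite {\<mu>. eigenvalue (mat_adjoint X * X) \<mu>}"
    unfolding eigenvalue_root_char_poly[OF M] by (rule poly_roots_finite)
  moreover have "inj_on (\<lambda>\<sigma>::real. complex_of_real (\<sigma>\<^sup>2)) {\<sigma>. singular_value X \<sigma>}"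
  proof (rule inj_onI)
    fix x y assume "x \<in> {\<sigma>. singular_value X \<sigma>}" "y \<in> {\<sigma>. singular_value X \<sigma>}"
      and "complex_of_real (x\<^sup>2) = complex_of_real (y\<^sup>2)"
    then have "x \<ge> 0" "y \<ge> 0" "x\<^sup>2 = y\<^sup>2" unfolding of_real_eq_iff by (auto simp: singular_value_def)
    then show "x = y" by simp
  qed
  moreover have "(\<lambda>\<sigma>::real. complex_of_real (\<sigma>\<^sup>2)) ` {\<sigma>. singular_value X \<sigma>} \<subseteq> {\<mu>. eigenvalue (mat_adjoint X * X) \<mu>}"
    by (auto simp: singular_value_def)
  ultimately show ?thesis by (meson finite_imageD finite_subset)
qed

lemma singular_value_of_eigenvalue:
  fixes X :: "complex mat"
  assumes X: "X \<in> carrier_mat a b" and ev: "eigenvalue (mat_adjoint X * X) \<mu>"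
  shows "0 \<le> Re \<mu>" "Im \<mu> = 0" "singular_value X (sqrt (Re \<mu>))"
proof -
  obtain v where "\<mu> = of_real (norm_sq (X *\<^sub>v v) / norm_sq v)"
    using eigenvalue_gram[OF X ev] by blast
  then show *: "0 \<le> Re \<mu>" "Im \<mu> = 0" by (simp_all only: Re_complex_of_real Im_complex_of_real) simp
  then have "complex_of_real ((sqrt (Re \<mu>))\<^sup>2) = \<mu>" by (simp add: complex_eq_iff)
  with * ev show "singular_value X (sqrt (Re \<mu>))" by (simp only: singular_value_def) simp
qed

lemma singular_value_exists:
  fixes X :: "complex mat"
  assumes X: "X \<in> carrier_mat a b" and b: "b > 0"
  shows "\<exists>\<sigma>. singular_value X \<sigma>"
proof -
  have aX: "mat_adjoint X \<in> carrier_mat b a" using X by (rule mat_adjoint_carrier)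
  have M: "mat_adjoint X * X \<in> carrier_mat b b" using aX X by simp
  obtain es where es: "char_poly (mat_adjoint X * X) = (\<Prod>e\<leftarrow>es. [:- e, 1:])" "length es = b"
    using char_poly_factorized[OF M] by blast
  then have "es ! 0 \<in> set es" using b by simp
  then have "eigenvalue (mat_adjoint X * X) (es ! 0)"
    unfolding eigenvalue_root_char_poly[OF M] es by (auto simp: poly_prod_list prod_list_zero_iff)
  from singular_value_of_eigenvalue[OF X this] show ?thesis by blast
qed

lemma singular_value_le_spectral_norm:
  fixes X :: "complex mat"
  assumes X: "X \<in> carrier_mat a b" and "singular_value X \<sigma>"
  shows "\<sigma> \<le> spectral_norm X"
  unfolding spectral_norm_def using finite_singular_values[OF X] assms(2) by (intro Max_ge) auto

lemma spectral_norm_singular_value: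
  fixes X :: "complex mat"
  assumes X: "X \<in> carrier_mat a b" and b: "b > 0"
  shows "singular_value X (spectral_norm X)"
  using Max_in[OF finite_singular_values[OF X]] singular_value_exists[OF X b]
  unfolding spectral_norm_def by auto

lemma spectral_norm_nonneg:
  fixes X :: "complex mat"
  assumes "X \<in> carrier_mat a b" "b > 0"
  shows "0 \<le> spectral_norm X"
  using spectral_norm_singular_value[OF assms] by (simp add: singular_value_def)

text \<open>If the gain of \<open>X\<close> at \<open>v\<close> exceeded the spectral norm, then for \<open>t = \<bar>X v\<bar>\<^sup>2 / \<bar>v\<bar>\<^sup>2\<close> all eigenvalues of
\<open>t I - X\<^sup>* X\<close> would be positive, so this matrix would be positive definite, although its form vanishes
at \<open>v\<close>.\<close>

lemma norm_sq_mult_le_spectral_norm: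
  fixes X :: "complex mat"
  assumes X: "X \<in> carrier_mat a b" and b: "b > 0" and v: "v \<in> carrier_vec b"
  shows "norm_sq (X *\<^sub>v v) \<le> (spectral_norm X)\<^sup>2 * norm_sq v"
proof (cases "v = 0\<^sub>v b")
  case True
  then have "X *\<^sub>v v = 0\<^sub>v a" using X by auto
  then show ?thesis using True by simp
next
  case False
  then have vp: "norm_sq v > 0" using norm_sq_pos[OF v] by simp
  show ?thesis
  proof (rule ccontr)
    assume gt: "\<not> ?thesis"
    define t where "t = norm_sq (X *\<^sub>v v) / norm_sq v"
    have t: "t > (spectral_norm X)\<^sup>2" using gt vp by (simp add: t_def field_simps)
    have aX: "mat_adjoint X \<in> carrier_mat b a" using X by (rule mat_adjoint_carrier)
    define M where "M = mat_adjoint X * X"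
    have M: "M \<in> carrier_mat b b" using aX X by (simp add: M_def)
    have hM: "mat_adjoint M = M" using aX X by (simp add: M_def mat_adjoint_mult[OF aX X])
    define N where "N = complex_of_real t \<cdot>\<^sub>m 1\<^sub>m b - M"
    have N: "N \<in> carrier_mat b b" using M unfolding N_def by auto
    have Nv: "N *\<^sub>v w = complex_of_real t \<cdot>\<^sub>v w - M *\<^sub>v w" if w: "w \<in> carrier_vec b" for w
    proof -
      have "N *\<^sub>v w = (complex_of_real t \<cdot>\<^sub>m 1\<^sub>m b) *\<^sub>v w - M *\<^sub>v w"
        unfolding N_def using M w by (intro minus_mult_distrib_mat_vec) auto
      then show ?thesis using w by (simp add: scalar_mat_mult_vec)
    qed
    have "Re (v \<bullet>c (N *\<^sub>v v)) > 0"
    proof (rule hermitian_positive[OF N _ _ v False])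
      show "mat_adjoint N = N"
      proof (rule eq_matI)
        fix i j assume ij: "i < dim_row N" "j < dim_col N"
        have "mat_adjoint M $$ (i, j) = cnj (M $$ (j, i))" using ij N M by simp
        then show "mat_adjoint N $$ (i, j) = N $$ (i, j)" using ij N M by (auto simp: N_def hM)
      qed (use N mat_adjoint_carrier[OF N] in auto)
      fix \<mu> assume "eigenvalue N \<mu>"
      then obtain w where w: "w \<in> carrier_vec b" "w \<noteq> 0\<^sub>v b" "N *\<^sub>v w = \<mu> \<cdot>\<^sub>v w"
        using N unfolding eigenvalue_def eigenvector_def by auto
      have "M *\<^sub>v w = (complex_of_real t - \<mu>) \<cdot>\<^sub>v w"
      proof (rule eq_vecI)
        fix i assume i: "i < dim_vec ((complex_of_real t - \<mu>) \<cdot>\<^sub>v w)"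
        have "(N *\<^sub>v w) $ i = (\<mu> \<cdot>\<^sub>v w) $ i" by (simp only: w(3))
        then show "(M *\<^sub>v w) $ i = ((complex_of_real t - \<mu>) \<cdot>\<^sub>v w) $ i"
          using i w(1) M unfolding Nv[OF w(1)] by (simp add: algebra_simps)
      qed (use M w in auto)
      then have ev: "eigenvalue (mat_adjoint X * X) (complex_of_real t - \<mu>)"
        using w M unfolding eigenvalue_def eigenvector_def M_def[symmetric] by auto
      note s = singular_value_of_eigenvalue[OF X ev]
      have "sqrt (Re (complex_of_real t - \<mu>)) \<le> spectral_norm X"
        by (rule singular_value_le_spectral_norm[OF X s(3)])
      then have "Re (complex_of_real t - \<mu>) \<le> (spectral_norm X)\<^sup>2"
        by (rule sqrt_le_D)
      then show "Re \<mu> > 0" using t by simp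
    qed
    moreover have "v \<bullet>c (N *\<^sub>v v) = complex_of_real t * of_real (norm_sq v) - of_real (norm_sq (X *\<^sub>v v))"
    proof -
      have "v \<bullet>c (N *\<^sub>v v) = v \<bullet>c (complex_of_real t \<cdot>\<^sub>v v) - v \<bullet>c (M *\<^sub>v v)"
        unfolding Nv[OF v] using M v
        by (subst (1 2 3) cscalar_prod_sum[of _ b])
          (auto simp: algebra_simps simp flip: sum_subtractf simp del: index_mult_mat_vec intro!: sum.cong)
      then show ?thesis
        using v by (simp add: M_def gram_form[OF X v] conjugate_smult_vec flip: cscalar_prod_self)
    qed
    ultimately have "t * norm_sq v - norm_sq (X *\<^sub>v v) > 0" by simp
    then show False using vp by (simp add: t_def)
  qed
qed

lemma spectral_norm_le:
  fixes X :: "complex mat"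
  assumes X: "X \<in> carrier_mat a b" and b: "b > 0" and c: "0 \<le> c"
    and le: "\<And>v. v \<in> carrier_vec b \<Longrightarrow> norm_sq (X *\<^sub>v v) \<le> c\<^sup>2 * norm_sq v"
  shows "spectral_norm X \<le> c"
proof -
  have "eigenvalue (mat_adjoint X * X) (complex_of_real ((spectral_norm X)\<^sup>2))"
    using spectral_norm_singular_value[OF X b] by (simp add: singular_value_def)
  from eigenvalue_gram[OF X this] obtain v where v: "v \<in> carrier_vec b" "v \<noteq> 0\<^sub>v b"
    and "complex_of_real ((spectral_norm X)\<^sup>2) = of_real (norm_sq (X *\<^sub>v v) / norm_sq v)" .
  then have "(spectral_norm X)\<^sup>2 = norm_sq (X *\<^sub>v v) / norm_sq v" by (simp only: of_real_eq_iff)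
  also have "\<dots> \<le> c\<^sup>2" using le[OF v(1)] norm_sq_pos[OF v] by (simp add: field_simps)
  finally show ?thesis using c by (rule power2_le_imp_le)
qed

text \<open>A common gain bound \<open>c\<close> on the imaginary axis makes the supremum in the H-infinity norm meaningful;
without it, the supremum would be an unspecified real number.\<close>

lemma hinf_norm_bounds:
  assumes T: "\<And>\<omega>. T (\<i> * complex_of_real \<omega>) \<in> carrier_mat a b" and b: "b > 0" and c: "0 \<le> c"
    and le: "\<And>\<omega> v. v \<in> carrier_vec b \<Longrightarrow> norm_sq (T (\<i> * complex_of_real \<omega>) *\<^sub>v v) \<le> c\<^sup>2 * norm_sq v"
  shows hinf_norm_le: "hinf_norm T \<le> c"
    and hinf_norm_nonneg: "0 \<le> hinf_norm T"
    and norm_sq_le_hinf_norm: "v \<in> carrier_vec b \<Longrightarrow>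
      norm_sq (T (\<i> * complex_of_real \<omega>) *\<^sub>v v) \<le> (hinf_norm T)\<^sup>2 * norm_sq v"
proof -
  have le': "spectral_norm (T (\<i> * complex_of_real \<omega>)) \<le> c" for \<omega>
    by (rule spectral_norm_le[OF T b c le])
  then show "hinf_norm T \<le> c" unfolding hinf_norm_def by (intro cSUP_least) auto
  have *: "spectral_norm (T (\<i> * complex_of_real \<omega>)) \<le> hinf_norm T" for \<omega>
    unfolding hinf_norm_def by (intro cSUP_upper) (use le' in \<open>auto intro!: bdd_aboveI2[where M = c]\<close>)
  then show "0 \<le> hinf_norm T" using spectral_norm_nonneg[OF T b] by (rule order_trans[rotated])
  assume v: "v \<in> carrier_vec b"
  have "norm_sq (T (\<i> * complex_of_real \<omega>) *\<^sub>v v) \<le> (spectral_norm (T (\<i> * complex_of_real \<omega>)))\<^sup>2 * norm_sq v"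
    by (rule norm_sq_mult_le_spectral_norm[OF T b v])
  also have "\<dots> \<le> (hinf_norm T)\<^sup>2 * norm_sq v"
    using * spectral_norm_nonneg[OF T b] by (intro mult_right_mono power_mono) auto
  finally show "norm_sq (T (\<i> * complex_of_real \<omega>) *\<^sub>v v) \<le> (hinf_norm T)\<^sup>2 * norm_sq v" .
qed

section \<open>The stable subspace of a Hamiltonian matrix\<close>

lemma linear_factors_unique:
  fixes es fs :: "complex list"
  assumes "(\<Prod>e\<leftarrow>es. [:- e, 1:]) = (\<Prod>e\<leftarrow>fs. [:- e, 1:])"
  shows "mset es = mset fs"
proof -
  have *: "proots (\<Prod>e\<leftarrow>es. [:- e, 1:]) = mset es" for es :: "complex list"
  proof (induction es)
    case (Cons e es)
    have "(\<Prod>e\<leftarrow>es. [:- e, 1:]) \<noteq> 0" by (auto simp: prod_list_zero_iff)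
    then show ?case using Cons.IH by (simp add: proots_mult del: mult_pCons_left)
  qed simp
  show ?thesis using arg_cong[OF assms, of proots] unfolding * .
qed

text \<open>Read off from a triangular form, whose diagonal is negated together with the matrix.\<close>

lemma char_poly_uminus:
  fixes M :: "complex mat"
  assumes M: "M \<in> carrier_mat n n" and es: "char_poly M = (\<Prod>e\<leftarrow>es. [:- e, 1:])"
  shows "char_poly (- M) = (\<Prod>e\<leftarrow>map uminus es. [:- e, 1:])"
proof -
  obtain T S S' where sd: "schur_decomposition M es = (T, S, S')" by (metis surj_pair)
  have wit: "similar_mat_wit M T S S'" and ut: "upper_triangular T" and dg: "diag_mat T = es"
    using schur_decomposition[OF M es sd] by auto
  note w = similar_mat_witD2[OF M wit]
  have T: "T \<in> carrier_mat n n" and S: "S \<in> carrier_mat n n" and S': "S' \<in> carrier_mat n n"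
    using w by auto
  have "- M = S * (- T) * S'"
    using T S S' w by (simp add: uminus_mult_left_mat uminus_mult_right_mat)
  then have "similar_mat (- M) (- T)"
    using T S S' w M by (intro similar_matI[of _ _ S S' n]) auto
  then have "char_poly (- M) = char_poly (- T)" by (rule char_poly_similar)
  also have "\<dots> = (\<Prod>e\<leftarrow>diag_mat (- T). [:- e, 1:])"
  proof (rule char_poly_upper_triangular)
    show "- T \<in> carrier_mat n n" using T by simp
    show "upper_triangular (- T)" using ut T unfolding upper_triangular_def by auto
  qed
  also have "diag_mat (- T) = map uminus es"
    using T by (auto simp: diag_mat_def simp flip: dg)
  finally show ?thesis .
qed

lemma mult_four_block_square:
  assumes "A1 \<in> carrier_mat k k" "B1 \<in> carrier_mat k k" "C1 \<in> carrier_mat k k" "D1 \<in> carrier_mat k k"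
    and "A2 \<in> carrier_mat k k" "B2 \<in> carrier_mat k k" "C2 \<in> carrier_mat k k" "D2 \<in> carrier_mat k k"
  shows "four_block_mat A1 B1 C1 D1 * four_block_mat A2 B2 C2 D2 =
    four_block_mat (A1 * A2 + B1 * C2) (A1 * B2 + B1 * D2) (C1 * A2 + D1 * C2) (C1 * B2 + D1 * D2)"
  by (rule mult_four_block_mat[OF assms])

text \<open>The matrix of the two-point system \<open>x' = A x + B z\<close>, \<open>z' = -x - A\<^sup>T z\<close>. If the columns of \<open>(X\<^sub>1, X\<^sub>2)\<close>
span an invariant subspace, then \<open>P = X\<^sub>2 X\<^sub>1\<^sup>-\<^sup>1\<close> solves the Riccati equation
\<open>P A + A\<^sup>T P + P B P + I = 0\<close>.\<close>

definition hamiltonian :: "complex mat \<Rightarrow> complex mat \<Rightarrow> complex mat" where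
  "hamiltonian A B = four_block_mat A B (- 1\<^sub>m (dim_row A)) (- transpose_mat A)"

lemma hamiltonian_carrier:
  assumes "A \<in> carrier_mat k k" "B \<in> carrier_mat k k"
  shows "hamiltonian A B \<in> carrier_mat (k + k) (k + k)"
  using assms unfolding hamiltonian_def by auto

text \<open>The symplectic matrix \<open>J\<close> conjugates a Hamiltonian matrix to its negative transpose. Transposes are used
instead of adjoints because \<open>char_poly\<close> is invariant under them.\<close>

lemma hamiltonian_similar_uminus_transpose:
  assumes A: "A \<in> carrier_mat k k" and B: "B \<in> carrier_mat k k" and sym: "transpose_mat B = B"
  shows "similar_mat (- transpose_mat (hamiltonian A B)) (hamiltonian A B)"
proof -
  let ?o = "1\<^sub>m k :: complex mat" and ?z = "0\<^sub>m k k :: complex mat"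
  \<comment> \<open>the symplectic matrix and its inverse\<close>
  define J where "J = four_block_mat ?z ?o (- ?o) ?z"
  define J' where "J' = four_block_mat ?z (- ?o) ?o ?z"
  have At: "transpose_mat A \<in> carrier_mat k k" using A by simp
  have H: "hamiltonian A B = four_block_mat A B (- ?o) (- transpose_mat A)"
    using A by (simp add: hamiltonian_def)
  have one: "four_block_mat ?o ?z ?z ?o = 1\<^sub>m (k + k)" by (rule four_block_one_mat)
  have z: "- ?z = ?z" by (intro eq_matI) auto
  have JJ: "J * J' = 1\<^sub>m (k + k)" "J' * J = 1\<^sub>m (k + k)"
    unfolding J_def J'_def one[symmetric]
    by (subst mult_four_block_square[where k = k],
        auto simp: uminus_mult_left_mat z intro!: cong_four_block_mat)+
  have "J * hamiltonian A B = four_block_mat (- ?o) (- transpose_mat A) (- A) (- B)"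
    unfolding J_def H using A B At
    by (subst mult_four_block_square[where k = k])
      (auto intro!: cong_four_block_mat simp: uminus_mult_left_mat)
  then have "J * hamiltonian A B * J' = four_block_mat (- transpose_mat A) ?o (- B) A"
    unfolding J'_def using A B At
    by (simp, subst mult_four_block_square[where k = k])
      (auto intro!: cong_four_block_mat simp: uminus_mult_left_mat)
  also have "\<dots> = - transpose_mat (hamiltonian A B)"
    unfolding H using A B At
    by (subst transpose_four_block_mat) (auto simp: sym intro!: eq_matI)
  finally have "- transpose_mat (hamiltonian A B) = J * hamiltonian A B * J'" ..
  moreover have "J \<in> carrier_mat (k + k) (k + k)" "J' \<in> carrier_mat (k + k) (k + k)"
    unfolding J_def J'_def by auto
  ultimately show ?thesis
    using hamiltonian_carrier[OF A B] JJ by (intro similar_matI[of _ _ J J' "k + k"]) auto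
qed

text \<open>The spectrum is symmetric under negation, with multiplicities. As no eigenvalue lies on the imaginary
axis, exactly half of the eigenvalues are stable.\<close>

lemma hamiltonian_stable_eigenvalues:
  assumes A: "A \<in> carrier_mat k k" and B: "B \<in> carrier_mat k k" and sym: "transpose_mat B = B"
    and axis: "\<And>\<mu>. eigenvalue (hamiltonian A B) \<mu> \<Longrightarrow> Re \<mu> \<noteq> 0"
  obtains es fs where "char_poly (hamiltonian A B) = (\<Prod>e\<leftarrow>es @ fs. [:- e, 1:])"
    "length es = k" "length fs = k" "\<And>e. e \<in> set es \<Longrightarrow> Re e < 0"
proof -
  let ?H = "hamiltonian A B"
  note H = hamiltonian_carrier[OF A B]
  obtain gs where gs: "char_poly ?H = (\<Prod>e\<leftarrow>gs. [:- e, 1:])" "length gs = k + k"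
    using char_poly_factorized[OF H] by blast
  have "char_poly (- transpose_mat ?H) = char_poly ?H"
    by (rule char_poly_similar[OF hamiltonian_similar_uminus_transpose[OF A B sym]])
  moreover have "char_poly (- transpose_mat ?H) = (\<Prod>e\<leftarrow>map uminus gs. [:- e, 1:])"
    by (rule char_poly_uminus) (use H gs in auto)
  ultimately have "mset gs = mset (map uminus gs)"
    by (intro linear_factors_unique) (simp only: gs)
  then have neg: "mset gs = image_mset uminus (mset gs)" by simp
  have nz: "Re e \<noteq> 0" if "e \<in> set gs" for e
    by (rule axis) (use that in \<open>auto simp: eigenvalue_root_char_poly[OF H] gs poly_prod_list prod_list_zero_iff\<close>)
  define es where "es = filter (\<lambda>e. Re e < 0) gs"
  define fs where "fs = filter (\<lambda>e. \<not> Re e < 0) gs"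
  have part: "mset (es @ fs) = mset gs" by (simp add: es_def fs_def)
  have "length es = size (filter_mset (\<lambda>e. Re e < 0) (mset gs))"
    by (simp add: es_def flip: mset_filter)
  also have "\<dots> = size (filter_mset (\<lambda>e. Re e < 0) (image_mset uminus (mset gs)))"
    by (subst neg) (rule refl)
  also have "\<dots> = size (filter_mset (\<lambda>e. Re e > 0) (mset gs))"
    by (simp add: filter_mset_image_mset)
  also have "filter_mset (\<lambda>e. Re e > 0) (mset gs) = filter_mset (\<lambda>e. \<not> Re e < 0) (mset gs)"
    by (rule filter_mset_cong[OF refl]) (use nz in force)
  also have "size \<dots> = length fs" by (simp add: fs_def flip: mset_filter)
  finally have "length es = length fs" .
  moreover have "length es + length fs = k + k"
    using arg_cong[OF part, of size] gs by simp
  ultimately have "length es = k" "length fs = k" by simp_all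
  moreover have "char_poly ?H = (\<Prod>e\<leftarrow>es @ fs. [:- e, 1:])"
  proof -
    have "mset (map (\<lambda>e. [:- e, 1:]) (es @ fs)) = mset (map (\<lambda>e. [:- e, 1:]) gs)"
      using part by (simp only: mset_map)
    then show ?thesis unfolding gs(1) by (metis prod_mset_prod_list)
  qed
  moreover have "Re e < 0" if "e \<in> set es" for e using that by (simp add: es_def)
  ultimately show ?thesis by (intro that[of es fs])
qed

text \<open>The equation \<open>L\<^sup>* D + D L = 0\<close> determines the entries of \<open>D\<close> one after the other, by increasing \<open>i + j\<close>:
the entry \<open>(i, j)\<close> is multiplied by \<open>cnj (L i i) + L j j\<close>, which has negative real part.\<close>

lemma sylvester_triangular:
  fixes D L :: "nat \<Rightarrow> nat \<Rightarrow> complex"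
  assumes tri: "\<And>i j. i < k \<Longrightarrow> j < i \<Longrightarrow> L i j = 0"
    and diag: "\<And>i. i < k \<Longrightarrow> Re (L i i) < 0"
    and eq: "\<And>i j. i < k \<Longrightarrow> j < k \<Longrightarrow> (\<Sum>l<k. cnj (L l i) * D l j) + (\<Sum>l<k. D i l * L l j) = 0"
    and "i < k" "j < k"
  shows "D i j = 0"
  using assms(4,5)
proof (induction "i + j" arbitrary: i j rule: less_induct)
  case less
  have "(\<Sum>l<k. cnj (L l i) * D l j) = (\<Sum>l<k. if l = i then cnj (L i i) * D i j else 0)"
  proof (rule sum.cong[OF refl])
    fix l assume "l \<in> {..<k}"
    then show "cnj (L l i) * D l j = (if l = i then cnj (L i i) * D i j else 0)"
      using tri[of l i] less.hyps[of l j] less.prems by (cases l i rule: linorder_cases) auto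
  qed
  moreover have "(\<Sum>l<k. D i l * L l j) = (\<Sum>l<k. if l = j then D i j * L j j else 0)"
  proof (rule sum.cong[OF refl])
    fix l assume "l \<in> {..<k}"
    then show "D i l * L l j = (if l = j then D i j * L j j else 0)"
      using tri[of l j] less.hyps[of i l] less.prems by (cases l j rule: linorder_cases) auto
  qed
  ultimately have "D i j * (cnj (L i i) + L j j) = 0"
    using eq[OF less.prems] less.prems by (simp add: algebra_simps)
  moreover have "Re (cnj (L i i) + L j j) < 0"
    using diag[of i] diag[of j] less.prems by simp
  ultimately show ?case by (metis less_irrefl mult_eq_0_iff zero_complex.sel(1))
qed

lemma four_block_mat_eqD:
  assumes "A1 \<in> carrier_mat k k" "A2 \<in> carrier_mat k k" "A3 \<in> carrier_mat k k" "A4 \<in> carrier_mat k k"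
    and "B1 \<in> carrier_mat k k" "B2 \<in> carrier_mat k k" "B3 \<in> carrier_mat k k" "B4 \<in> carrier_mat k k"
    and eq: "four_block_mat A1 A2 A3 A4 = four_block_mat B1 B2 B3 B4"
  shows "A1 = B1" "A3 = B3"
proof -
  have e: "four_block_mat A1 A2 A3 A4 $$ (i, j) = four_block_mat B1 B2 B3 B4 $$ (i, j)" for i j
    by (simp only: eq)
  show "A1 = B1"
  proof (rule eq_matI)
    fix i j assume "i < dim_row B1" "j < dim_col B1"
    then show "A1 $$ (i, j) = B1 $$ (i, j)" using e[of i j] assms(1-8) by auto
  qed (use assms(1-8) in auto)
  show "A3 = B3"
  proof (rule eq_matI)
    fix i j assume "i < dim_row B3" "j < dim_col B3"
    then show "A3 $$ (i, j) = B3 $$ (i, j)" using e[of "i + k" j] assms(1-8) by auto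
  qed (use assms(1-8) in auto)
qed

text \<open>The Schur decomposition accepts the eigenvalues in any order. With the stable ones first, the leading
\<open>k\<close> columns span the stable invariant subspace, and \<open>L\<close> is the restriction of the Hamiltonian matrix
to it.\<close>

lemma hamiltonian_stable_subspace:
  assumes A: "A \<in> carrier_mat k k" and B: "B \<in> carrier_mat k k" and sym: "transpose_mat B = B"
    and axis: "\<And>\<mu>. eigenvalue (hamiltonian A B) \<mu> \<Longrightarrow> Re \<mu> \<noteq> 0"
  obtains X1 X2 L where "X1 \<in> carrier_mat k k" "X2 \<in> carrier_mat k k" "L \<in> carrier_mat k k"
    "upper_triangular L" "\<And>i. i < k \<Longrightarrow> Re (L $$ (i, i)) < 0"
    "A * X1 + B * X2 = X1 * L" "- X1 - transpose_mat A * X2 = X2 * L"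
    "\<And>c. c \<in> carrier_vec k \<Longrightarrow> X1 *\<^sub>v c = 0\<^sub>v k \<Longrightarrow> X2 *\<^sub>v c = 0\<^sub>v k \<Longrightarrow> c = 0\<^sub>v k"
proof -
  let ?H = "hamiltonian A B"
  note H = hamiltonian_carrier[OF A B]
  obtain es fs where es: "char_poly ?H = (\<Prod>e\<leftarrow>es @ fs. [:- e, 1:])"
    "length es = k" "length fs = k" "\<And>e. e \<in> set es \<Longrightarrow> Re e < 0"
    using hamiltonian_stable_eigenvalues[OF A B sym axis] by blast
  obtain T S S' where sd: "schur_decomposition ?H (es @ fs) = (T, S, S')" by (metis surj_pair)
  have wit: "similar_mat_wit ?H T S S'" and ut: "upper_triangular T" and dg: "diag_mat T = es @ fs"
    using schur_decomposition[OF H es(1) sd] by auto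
  note w = similar_mat_witD2[OF H wit]
  have T: "T \<in> carrier_mat (k + k) (k + k)" and S: "S \<in> carrier_mat (k + k) (k + k)"
    and S': "S' \<in> carrier_mat (k + k) (k + k)"
    using w by auto
  have HS: "?H * S = S * T"
  proof -
    have "?H * S = S * T * S' * S" by (simp only: w(3)[symmetric])
    also have "\<dots> = S * T * (S' * S)" using S T S' by (intro assoc_mult_mat) auto
    finally show ?thesis using S T by (simp add: w(2))
  qed
  obtain X1 Y1 X2 Y2 where X: "split_block S k k = (X1, Y1, X2, Y2)" by (metis surj_pair)
  obtain L T12 T21 T22 where L: "split_block T k k = (L, T12, T21, T22)" by (metis surj_pair)
  note Xs = split_block[OF X, of k k] and Ls = split_block[OF L, of k k]
  have dims: "dim_row S = k + k" "dim_col S = k + k" "dim_row T = k + k" "dim_col T = k + k"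
    using S T by auto
  note Xs = Xs[OF dims(1,2)] and Ls = Ls[OF dims(3,4)]
  have Tij: "T $$ (i, j) = L $$ (i, j)" "T $$ (i + k, j) = T21 $$ (i, j)" if "i < k" "j < k" for i j
    using that Ls by auto
  have T21: "T21 = 0\<^sub>m k k"
  proof (rule eq_matI)
    fix i j assume ij: "i < dim_row (0\<^sub>m k k :: complex mat)" "j < dim_col (0\<^sub>m k k :: complex mat)"
    then have "T $$ (i + k, j) = 0" using ut T unfolding upper_triangular_def by auto
    then show "T21 $$ (i, j) = 0\<^sub>m k k $$ (i, j)" using Tij ij by auto
  qed (use Ls in auto)
  have At: "transpose_mat A \<in> carrier_mat k k" using A by simp
  have blocks: "four_block_mat (A * X1 + B * X2) (A * Y1 + B * Y2)
      (- 1\<^sub>m k * X1 + - transpose_mat A * X2) (- 1\<^sub>m k * Y1 + - transpose_mat A * Y2) =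
    four_block_mat (X1 * L + Y1 * T21) (X1 * T12 + Y1 * T22) (X2 * L + Y2 * T21) (X2 * T12 + Y2 * T22)"
  proof -
    have "?H * S = four_block_mat (A * X1 + B * X2) (A * Y1 + B * Y2)
      (- 1\<^sub>m k * X1 + - transpose_mat A * X2) (- 1\<^sub>m k * Y1 + - transpose_mat A * Y2)"
      unfolding hamiltonian_def using A B At Xs(1-4)
      by (subst Xs(5), subst mult_four_block_square[where k = k]) auto
    moreover have "S * T = four_block_mat (X1 * L + Y1 * T21) (X1 * T12 + Y1 * T22) (X2 * L + Y2 * T21) (X2 * T12 + Y2 * T22)"
      using Xs(1-4) Ls(1-4)
      by (subst Xs(5), subst Ls(5), subst mult_four_block_square[where k = k]) auto
    ultimately show ?thesis using HS by simp
  qed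
  note e = four_block_mat_eqD[OF _ _ _ _ _ _ _ _ blocks, of k]
  have e1: "A * X1 + B * X2 = X1 * L + Y1 * T21"
    by (rule e(1)) (use A B At Xs(1-4) Ls(1-4) in auto)
  have e2: "- 1\<^sub>m k * X1 + - transpose_mat A * X2 = X2 * L + Y2 * T21"
    by (rule e(2)) (use A B At Xs(1-4) Ls(1-4) in auto)
  show ?thesis
  proof (rule that[of X1 X2 L])
    show "X1 \<in> carrier_mat k k" "X2 \<in> carrier_mat k k" "L \<in> carrier_mat k k" by fact+
    show "upper_triangular L"
      unfolding upper_triangular_def
    proof (intro allI impI)
      fix i j assume ij: "i < dim_row L" "j < i"
      then have ik: "i < k" using Ls(1) by simp
      then have "T $$ (i, j) = 0" using ut T ij unfolding upper_triangular_def by auto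
      then show "L $$ (i, j) = 0" using Tij(1)[of i j] ij ik by simp
    qed
    show "Re (L $$ (i, i)) < 0" if "i < k" for i
    proof -
      have "L $$ (i, i) = diag_mat T ! i" using Tij(1)[OF that that] that T by (simp add: diag_mat_def)
      also have "\<dots> = es ! i" using dg es that by (simp add: nth_append)
      finally show ?thesis using es(4)[of "es ! i"] es(2) that by simp
    qed
    show "A * X1 + B * X2 = X1 * L" using e1 T21 Xs Ls by simp
    show "- X1 - transpose_mat A * X2 = X2 * L"
      using e2 T21 Xs(1-4) Ls(1-4) At by (simp add: uminus_mult_left_mat add_uminus_minus_mat)
    fix c :: "complex vec" assume c: "c \<in> carrier_vec k" and z: "X1 *\<^sub>v c = 0\<^sub>v k" "X2 *\<^sub>v c = 0\<^sub>v k"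
    have cz: "c @\<^sub>v 0\<^sub>v k \<in> carrier_vec (k + k)" using c by simp
    have "Y1 *\<^sub>v 0\<^sub>v k = 0\<^sub>v k" "Y2 *\<^sub>v 0\<^sub>v k = 0\<^sub>v k"
      using Xs(2,4) by (auto intro!: eq_vecI simp: scalar_prod_def)
    then have "S *\<^sub>v (c @\<^sub>v 0\<^sub>v k) = 0\<^sub>v (k + k)"
      unfolding Xs(5) using Xs(1-4) c z
      by (subst four_block_mat_mult_vec[of _ k k _ k _ k]) (auto intro!: eq_vecI simp del: index_mult_mat_vec)
    then have "S' *\<^sub>v (S *\<^sub>v (c @\<^sub>v 0\<^sub>v k)) = 0\<^sub>v (k + k)" using S' by auto
    then have "c @\<^sub>v 0\<^sub>v k = 0\<^sub>v (k + k)"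
      using S S' cz by (simp add: w flip: assoc_mult_mat_vec[of _ "k + k" "k + k" _ "k + k"])
    then have "(c @\<^sub>v 0\<^sub>v k) $ i = 0\<^sub>v (k + k) $ i" for i by simp
    then have "c $ i = 0" if "i < k" for i using that c by (metis carrier_vecD index_append_vec(1) index_zero_vec(1) trans_less_add1 index_zero_vec(2))
    then show "c = 0\<^sub>v k" using c by (intro eq_vecI) auto
  qed
qed

text \<open>The difference of the two sides satisfies a homogeneous Sylvester equation with the stable matrix \<open>L\<close>,
because the right-hand side \<open>X\<^sub>2\<^sup>* B X\<^sub>2 - X\<^sub>1\<^sup>* X\<^sub>1\<close> of the equation for \<open>X\<^sub>1\<^sup>* X\<^sub>2\<close> is Hermitian. This is what
makes the Riccati solution Hermitian.\<close>

lemma hamiltonian_subspace_isotropic: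
  fixes A B X1 X2 L :: "complex mat"
  assumes A: "A \<in> carrier_mat k k" and B: "B \<in> carrier_mat k k"
    and X1: "X1 \<in> carrier_mat k k" and X2: "X2 \<in> carrier_mat k k" and L: "L \<in> carrier_mat k k"
    and hB: "mat_adjoint B = B"
    and tri: "upper_triangular L" and diag: "\<And>i. i < k \<Longrightarrow> Re (L $$ (i, i)) < 0"
    and e1: "A * X1 + B * X2 = X1 * L" and e2: "- X1 - mat_adjoint A * X2 = X2 * L"
  shows "mat_adjoint X1 * X2 = mat_adjoint X2 * X1"
proof -
  define a where "a = mat_adjoint A"
  define l where "l = mat_adjoint L"
  define x1 where "x1 = mat_adjoint X1"
  define x2 where "x2 = mat_adjoint X2"
  have c: "a \<in> carrier_mat k k" "l \<in> carrier_mat k k" "x1 \<in> carrier_mat k k" "x2 \<in> carrier_mat k k"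
    using A L X1 X2 by (simp_all add: a_def l_def x1_def x2_def mat_adjoint_carrier)
  have adj_add: "mat_adjoint (M + K) = mat_adjoint M + mat_adjoint K"
    if "M \<in> carrier_mat k k" "K \<in> carrier_mat k k" for M K :: "complex mat"
    using that by (intro eq_matI) (auto simp: mat_adjoint_def mat_of_rows_def)
  have adj_minus: "mat_adjoint (- M - K) = - mat_adjoint M - mat_adjoint K"
    if "M \<in> carrier_mat k k" "K \<in> carrier_mat k k" for M K :: "complex mat"
    using that by (intro eq_matI) (auto simp: mat_adjoint_def mat_of_rows_def)
  note sq = mult_carrier_mat[of _ k k _ k]
  note all = A B X1 X2 L c
  have f1: "l * x1 = x1 * a + x2 * B"
    using arg_cong[OF e1, of mat_adjoint] all sq[OF A X1] sq[OF B X2]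
    by (simp add: adj_add mat_adjoint_mult[of _ k k _ k] hB flip: a_def l_def x1_def x2_def)
  have f2: "l * x2 = - x1 - x2 * A"
    using arg_cong[OF e2, of mat_adjoint] all sq[OF c(1) X2]
    by (simp add: adj_minus mat_adjoint_mult[of _ k k _ k] a_def flip: l_def x1_def x2_def)
  have t1: "l * (x1 * X2) = x1 * (a * X2) + x2 * (B * X2)"
  proof -
    have "l * (x1 * X2) = l * x1 * X2" using all by (simp add: assoc_mult_mat[of _ k k _ k _ k])
    also have "\<dots> = x1 * a * X2 + x2 * B * X2"
      unfolding f1 using all by (intro add_mult_distrib_mat[of _ k k]) auto
    finally show ?thesis using all by (simp add: assoc_mult_mat[of _ k k _ k _ k])
  qed
  have t2: "l * (x2 * X1) = - (x1 * X1) - x2 * (A * X1)"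
  proof -
    have "l * (x2 * X1) = l * x2 * X1" using all by (simp add: assoc_mult_mat[of _ k k _ k _ k])
    also have "\<dots> = - x1 * X1 - x2 * A * X1"
      unfolding f2 using all by (intro minus_mult_distrib_mat[of _ k k]) auto
    finally show ?thesis using all by (simp add: assoc_mult_mat[of _ k k _ k _ k] uminus_mult_left_mat)
  qed
  have t3: "x1 * X2 * L = - (x1 * X1) - x1 * (a * X2)"
  proof -
    have "x1 * X2 * L = x1 * (- X1 - a * X2)"
      using all by (simp add: assoc_mult_mat[of _ k k _ k _ k] a_def flip: e2)
    also have "\<dots> = x1 * (- X1) - x1 * (a * X2)"
      using all by (intro mult_minus_distrib_mat[of _ k k]) auto
    finally show ?thesis using all by (simp add: uminus_mult_right_mat)
  qed
  have t4: "x2 * X1 * L = x2 * (A * X1) + x2 * (B * X2)"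
  proof -
    have "x2 * X1 * L = x2 * (A * X1 + B * X2)"
      using all by (simp add: assoc_mult_mat[of _ k k _ k _ k] flip: e1)
    also have "\<dots> = x2 * (A * X1) + x2 * (B * X2)"
      using all by (intro mult_add_distrib_mat[of _ k k]) auto
    finally show ?thesis .
  qed
  \<comment> \<open>\<open>x1 * X2\<close> and its adjoint solve the same Sylvester equation\<close>
  define D where "D = x1 * X2 - x2 * X1"
  have D: "D \<in> carrier_mat k k" unfolding D_def using all by auto
  have "l * D + D * L = (l * (x1 * X2) - l * (x2 * X1)) + (x1 * X2 * L - x2 * X1 * L)"
  proof -
    have "l * D = l * (x1 * X2) - l * (x2 * X1)"
      unfolding D_def by (rule mult_minus_distrib_mat) (use all in auto)
    moreover have "D * L = x1 * X2 * L - x2 * X1 * L"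
      unfolding D_def by (rule minus_mult_distrib_mat) (use all in auto)
    ultimately show ?thesis by simp
  qed
  also have "\<dots> = 0\<^sub>m k k"
    unfolding t1 t2 t3 t4 using all
    by (intro eq_matI) (auto simp del: index_mult_mat(1) simp: index_mult_mat(2,3))
  finally have zero: "l * D + D * L = 0\<^sub>m k k" .
  have "D $$ (i, j) = 0" if "i < k" "j < k" for i j
  proof (rule sylvester_triangular[where D = "\<lambda>i j. D $$ (i, j)" and L = "\<lambda>i j. L $$ (i, j)"])
    show "L $$ (i, j) = 0" if "i < k" "j < i" for i j
      using tri L that unfolding upper_triangular_def by auto
    show "Re (L $$ (i, i)) < 0" if "i < k" for i by (rule diag[OF that])
    fix i j assume ij: "i < k" "j < k"
    have "(l * D + D * L) $$ (i, j) = (\<Sum>r<k. cnj (L $$ (r, i)) * D $$ (r, j)) + (\<Sum>r<k. D $$ (i, r) * L $$ (r, j))"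
      using ij c(2) D L by (simp add: scalar_prod_def lessThan_atLeast0 l_def)
    then show "(\<Sum>r<k. cnj (L $$ (r, i)) * D $$ (r, j)) + (\<Sum>r<k. D $$ (i, r) * L $$ (r, j)) = 0"
      using zero ij by simp
  qed (use that in auto)
  then have "(x1 * X2) $$ (i, j) = (x2 * X1) $$ (i, j)" if "i < k" "j < k" for i j
    using that all by (simp add: D_def)
  then show ?thesis
    unfolding x1_def[symmetric] x2_def[symmetric] using all by (intro eq_matI) auto
qed

text \<open>A nonzero kernel that is invariant under a triangular matrix contains an eigenvector. Among the nonzero
kernel vectors, take one whose last nonzero entry, at \<open>s\<close>, comes as early as possible: subtracting
\<open>L s s\<close> times this vector from its image gives a kernel vector that ends earlier, hence zero.\<close>

lemma invariant_kernel_eigenvector: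
  fixes X L :: "complex mat"
  assumes X: "X \<in> carrier_mat k k" and L: "L \<in> carrier_mat k k" and tri: "upper_triangular L"
    and inv: "\<And>c. c \<in> carrier_vec k \<Longrightarrow> X *\<^sub>v c = 0\<^sub>v k \<Longrightarrow> X *\<^sub>v (L *\<^sub>v c) = 0\<^sub>v k"
    and c: "c \<in> carrier_vec k" "c \<noteq> 0\<^sub>v k" "X *\<^sub>v c = 0\<^sub>v k"
  obtains d r where "d \<in> carrier_vec k" "d \<noteq> 0\<^sub>v k" "X *\<^sub>v d = 0\<^sub>v k" "r < k"
    "L *\<^sub>v d = L $$ (r, r) \<cdot>\<^sub>v d"
proof -
  \<comment> \<open>\<open>Q r d\<close>: \<open>d\<close> is a nonzero kernel vector that is supported on the first \<open>r\<close> coordinates\<close>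
  define Q where "Q r d \<longleftrightarrow> d \<in> carrier_vec k \<and> d \<noteq> 0\<^sub>v k \<and> X *\<^sub>v d = 0\<^sub>v k \<and> (\<forall>i<k. r \<le> i \<longrightarrow> d $ i = 0)"
    for r d
  define r where "r = (LEAST r. \<exists>d. Q r d)"
  have "Q k c" using c by (auto simp: Q_def)
  then have "\<exists>d. Q r d" "r \<le> k" unfolding r_def by (auto intro: LeastI Least_le)
  then obtain d where d: "Q r d" by blast
  have least: "\<not> Q s f" if "s < r" for s f
    using not_less_Least[of s "\<lambda>r. \<exists>d. Q r d"] that unfolding r_def by blast
  have dc: "d \<in> carrier_vec k" "d \<noteq> 0\<^sub>v k" "X *\<^sub>v d = 0\<^sub>v k" and d0: "\<And>i. i < k \<Longrightarrow> r \<le> i \<Longrightarrow> d $ i = 0"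
    using d by (auto simp: Q_def)
  have "r \<noteq> 0"
  proof
    assume "r = 0"
    then have "d = 0\<^sub>v k" using d0 dc(1) by (intro eq_vecI) auto
    then show False using dc by simp
  qed
  then obtain s where s: "r = Suc s" by (cases r) auto
  with \<open>r \<le> k\<close> have sk: "s < k" by simp
  define f where "f = L *\<^sub>v d - L $$ (s, s) \<cdot>\<^sub>v d"
  have f: "f \<in> carrier_vec k" unfolding f_def using L dc by simp
  have "X *\<^sub>v f = X *\<^sub>v (L *\<^sub>v d) - X *\<^sub>v (L $$ (s, s) \<cdot>\<^sub>v d)"
    unfolding f_def using X L dc by (intro mult_minus_distrib_mat_vec) auto
  also have "\<dots> = 0\<^sub>v k" using inv[OF dc(1,3)] mult_mat_vec[OF X dc(1)] dc(3) by (auto intro!: eq_vecI)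
  finally have Xf: "X *\<^sub>v f = 0\<^sub>v k" .
  have "f $ i = 0" if i: "i < k" "s \<le> i" for i
  proof -
    have "(L *\<^sub>v d) $ i = (\<Sum>j<k. if j = s then L $$ (i, s) * d $ s else 0)"
    proof (subst mult_mat_vec_index[OF L dc(1) i(1)], rule sum.cong[OF refl])
      fix j assume "j \<in> {..<k}"
      then show "L $$ (i, j) * d $ j = (if j = s then L $$ (i, s) * d $ s else 0)"
        using tri L d0[of j] i s unfolding upper_triangular_def by (cases j s rule: linorder_cases) auto
    qed
    also have "\<dots> = L $$ (i, s) * d $ s" using sk by simp
    also have "\<dots> = L $$ (s, s) * d $ i"
    proof (cases "i = s")
      case False
      then have "L $$ (i, s) = 0" "d $ i = 0"
        using tri L d0[of i] i s unfolding upper_triangular_def by auto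
      then show ?thesis by simp
    qed simp
    finally show ?thesis using i L dc by (simp add: f_def del: index_mult_mat_vec)
  qed
  then have "f = 0\<^sub>v k" using least[of s f] s f Xf by (auto simp: Q_def)
  then have "L *\<^sub>v d = L $$ (s, s) \<cdot>\<^sub>v d"
    unfolding f_def using L dc by (metis carrier_vecD dim_mult_mat_vec carrier_matD(1) minus_add_uminus_vec
      eq_vecI index_minus_vec(1) index_smult_vec(2) index_zero_vec(1) right_minus_eq)
  then show ?thesis using that[OF dc sk] by blast
qed

text \<open>It remains to invert the upper half \<open>X\<^sub>1\<close> of the basis of the stable subspace. Its kernel is invariant
under \<open>L\<close>, so a nonzero kernel would contain an eigenvector \<open>f\<close>, and \<open>X\<^sub>2 f\<close> would be an eigenvector of
\<open>A\<^sup>T\<close> for an eigenvalue with positive real part.\<close>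

lemma riccati_solution:
  fixes A B :: "complex mat"
  assumes A: "A \<in> carrier_mat k k" and B: "B \<in> carrier_mat k k"
    and symB: "transpose_mat B = B" and hB: "mat_adjoint B = B" and real: "mat_adjoint A = transpose_mat A"
    and stable: "\<And>\<mu>. eigenvalue A \<mu> \<Longrightarrow> Re \<mu> < 0"
    and semi: "\<And>z. z \<in> carrier_vec k \<Longrightarrow> z \<bullet>c (B *\<^sub>v z) = 0 \<Longrightarrow> B *\<^sub>v z = 0\<^sub>v k"
    and axis: "\<And>\<mu>. eigenvalue (hamiltonian A B) \<mu> \<Longrightarrow> Re \<mu> \<noteq> 0"
  obtains P where "P \<in> carrier_mat k k" "mat_adjoint P = P"
    "P * (A + B * P) = - 1\<^sub>m k - transpose_mat A * P"
proof -
  obtain X1 X2 L where X1: "X1 \<in> carrier_mat k k" and X2: "X2 \<in> carrier_mat k k"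
    and L: "L \<in> carrier_mat k k" and tri: "upper_triangular L"
    and diag: "\<And>i. i < k \<Longrightarrow> Re (L $$ (i, i)) < 0"
    and e1: "A * X1 + B * X2 = X1 * L" and e2: "- X1 - transpose_mat A * X2 = X2 * L"
    and inj: "\<And>c. c \<in> carrier_vec k \<Longrightarrow> X1 *\<^sub>v c = 0\<^sub>v k \<Longrightarrow> X2 *\<^sub>v c = 0\<^sub>v k \<Longrightarrow> c = 0\<^sub>v k"
    using hamiltonian_stable_subspace[OF A B symB axis] by blast
  define x1 where "x1 = mat_adjoint X1"
  define x2 where "x2 = mat_adjoint X2"
  define a where "a = transpose_mat A"
  have c: "a \<in> carrier_mat k k" "x1 \<in> carrier_mat k k" "x2 \<in> carrier_mat k k"
    using A X1 X2 by (simp_all add: a_def x1_def x2_def mat_adjoint_carrier)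
  note all = A B X1 X2 L c
  note e2 = e2[folded a_def]
  have iso: "x1 * X2 = x2 * X1"
    unfolding x1_def x2_def
    by (rule hamiltonian_subspace_isotropic[OF A B X1 X2 L hB tri diag e1]) (use e2 in \<open>simp_all add: real a_def\<close>)
  have v1: "A *\<^sub>v (X1 *\<^sub>v d) + B *\<^sub>v (X2 *\<^sub>v d) = X1 *\<^sub>v (L *\<^sub>v d)" if d: "d \<in> carrier_vec k" for d
  proof -
    have "X1 *\<^sub>v (L *\<^sub>v d) = (A * X1 + B * X2) *\<^sub>v d"
      using all d by (simp add: e1 assoc_mult_mat_vec[of _ k k _ k])
    also have "\<dots> = (A * X1) *\<^sub>v d + (B * X2) *\<^sub>v d"
      using all d by (intro add_mult_distrib_mat_vec[of _ k k]) auto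
    finally show ?thesis using all d by (simp add: assoc_mult_mat_vec[of _ k k _ k])
  qed
  have v2: "(- X1) *\<^sub>v d - a *\<^sub>v (X2 *\<^sub>v d) = X2 *\<^sub>v (L *\<^sub>v d)" if d: "d \<in> carrier_vec k" for d
  proof -
    have "X2 *\<^sub>v (L *\<^sub>v d) = (- X1 - a * X2) *\<^sub>v d"
      using all d by (simp add: e2 assoc_mult_mat_vec[of _ k k _ k])
    also have "\<dots> = (- X1) *\<^sub>v d - (a * X2) *\<^sub>v d"
      using all d by (intro minus_mult_distrib_mat_vec[of _ k k]) auto
    finally show ?thesis using all d by (simp add: assoc_mult_mat_vec[of _ k k _ k])
  qed
  have inv: "X1 *\<^sub>v (L *\<^sub>v d) = 0\<^sub>v k" if d: "d \<in> carrier_vec k" "X1 *\<^sub>v d = 0\<^sub>v k" for d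
  proof -
    let ?z = "X2 *\<^sub>v d"
    have z: "?z \<in> carrier_vec k" and Ld: "L *\<^sub>v d \<in> carrier_vec k" using all d by auto
    have A0: "A *\<^sub>v 0\<^sub>v k = 0\<^sub>v k" using A by (auto intro!: eq_vecI simp: scalar_prod_def)
    have Bz: "X1 *\<^sub>v (L *\<^sub>v d) = B *\<^sub>v ?z"
      using v1[OF d(1)] d(2) A0 B z by simp
    have "?z \<bullet>c (B *\<^sub>v ?z) = ?z \<bullet>c (mat_adjoint x1 *\<^sub>v (L *\<^sub>v d))"
      by (simp add: x1_def flip: Bz)
    also have "\<dots> = (x1 *\<^sub>v ?z) \<bullet>c (L *\<^sub>v d)"
      by (rule adjoint_swap[symmetric]) (use all z Ld in auto)
    also have "x1 *\<^sub>v ?z = x2 *\<^sub>v (X1 *\<^sub>v d)"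
      using assoc_mult_mat_vec[OF c(2) X2 d(1)] assoc_mult_mat_vec[OF c(3) X1 d(1)] by (simp only: iso)
    also have "\<dots> = 0\<^sub>v k" using d(2) all by (auto intro!: eq_vecI simp: scalar_prod_def)
    also have "0\<^sub>v k \<bullet>c (L *\<^sub>v d) = 0" using Ld by simp
    finally show ?thesis using semi[OF z] Bz by simp
  qed
  have inj1: "d = 0\<^sub>v k" if d: "d \<in> carrier_vec k" "X1 *\<^sub>v d = 0\<^sub>v k" for d
  proof (rule ccontr)
    assume "d \<noteq> 0\<^sub>v k"
    from invariant_kernel_eigenvector[OF X1 L tri inv d(1) this d(2)]
    obtain f r where f: "f \<in> carrier_vec k" "f \<noteq> 0\<^sub>v k" "X1 *\<^sub>v f = 0\<^sub>v k" and r: "r < k"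
      and Lf: "L *\<^sub>v f = L $$ (r, r) \<cdot>\<^sub>v f" by metis
    define z where "z = X2 *\<^sub>v f"
    have z: "z \<in> carrier_vec k" using X2 f by (simp add: z_def)
    have "(- X1) *\<^sub>v f = 0\<^sub>v k" using X1 f by (simp add: uminus_mult_mat_vec)
    moreover have "X2 *\<^sub>v (L *\<^sub>v f) = L $$ (r, r) \<cdot>\<^sub>v z"
      unfolding Lf z_def by (rule mult_mat_vec[OF X2 f(1)])
    ultimately have *: "0\<^sub>v k - a *\<^sub>v z = L $$ (r, r) \<cdot>\<^sub>v z" using v2[OF f(1)] by (simp add: z_def)
    have az: "a *\<^sub>v z = (- L $$ (r, r)) \<cdot>\<^sub>v z"
    proof (rule eq_vecI)
      fix i assume "i < dim_vec ((- L $$ (r, r)) \<cdot>\<^sub>v z)"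
      then have i: "i < k" using z by simp
      have "(0\<^sub>v k - a *\<^sub>v z) $ i = (L $$ (r, r) \<cdot>\<^sub>v z) $ i" by (simp only: *)
      then show "(a *\<^sub>v z) $ i = ((- L $$ (r, r)) \<cdot>\<^sub>v z) $ i"
        using i z c(1) by (simp del: index_mult_mat_vec) (metis minus_minus)
    qed (use c z X2 in auto)
    have "z \<noteq> 0\<^sub>v k" using inj[OF f(1,3)] f(2) by (auto simp: z_def)
    then have "eigenvalue a (- L $$ (r, r))"
      using z az c unfolding eigenvalue_def eigenvector_def by auto
    then have "eigenvalue A (- L $$ (r, r))"
      using A unfolding a_def by (simp add: eigenvalue_root_char_poly[of _ k])
    from stable[OF this] diag[OF r] show False by simp
  qed
  obtain Y where Y: "Y \<in> carrier_mat k k" and XY: "X1 * Y = 1\<^sub>m k" "Y * X1 = 1\<^sub>m k"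
    using mat_inv_inverse[OF X1 inj1] by blast
  define y where "y = mat_adjoint Y"
  have y: "y \<in> carrier_mat k k" using Y by (simp add: y_def mat_adjoint_carrier)
  have yx: "y * x1 = 1\<^sub>m k"
  proof -
    have "y * x1 = mat_adjoint (X1 * Y)" unfolding y_def x1_def by (rule mat_adjoint_mult[OF X1 Y, symmetric])
    also have "\<dots> = 1\<^sub>m k" unfolding XY by (intro eq_matI) (auto simp: mat_adjoint_def mat_of_rows_def)
    finally show ?thesis .
  qed
  note all = all Y y
  note assoc = assoc_mult_mat[of _ k k _ k _ k]
  define P where "P = X2 * Y"
  have P: "P \<in> carrier_mat k k" using all by (auto simp: P_def)
  have PX: "P * X1 = X2" using all by (simp add: P_def assoc XY)
  have hP: "mat_adjoint P = P"
  proof -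
    have "mat_adjoint P = y * x2" unfolding P_def y_def x2_def by (rule mat_adjoint_mult[OF X2 Y])
    also have "\<dots> = y * x2 * (X1 * Y)" using all by (simp add: XY)
    also have "\<dots> = y * (x2 * X1) * Y" using all by (simp add: assoc)
    also have "\<dots> = (y * x1) * (X2 * Y)" using all by (simp add: assoc flip: iso)
    also have "\<dots> = P" using left_mult_one_mat[OF P] by (simp only: yx P_def)
    finally show ?thesis .
  qed
  have "P * (A + B * P) = P * ((A * X1 + B * X2) * Y)"
  proof -
    have "(A * X1 + B * X2) * Y = A * X1 * Y + B * X2 * Y"
      using all by (intro add_mult_distrib_mat[of _ k k]) auto
    also have "\<dots> = A + B * P" using all by (simp add: assoc XY P_def)
    finally show ?thesis by simp
  qed
  also have "\<dots> = P * X1 * L * Y" using all P by (simp add: e1 assoc)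
  also have "\<dots> = (- X1 - a * X2) * Y" using all by (simp add: PX e2)
  also have "\<dots> = - X1 * Y - a * X2 * Y"
    using all by (intro minus_mult_distrib_mat[of _ k k]) auto
  also have "\<dots> = - 1\<^sub>m k - a * P" using all by (simp add: XY P_def assoc uminus_mult_left_mat)
  finally show ?thesis using P hP by (intro that) (auto simp: a_def)
qed

section \<open>The bounded real lemma\<close>

lemma hurwitz_eigenvalue:
  assumes "hurwitz A" "eigenvalue (complex_mat A) \<mu>"
  shows "Re \<mu> < 0"
  using assms by (auto simp: hurwitz_def)

text \<open>The quadratic term \<open>W diag(\<rho>)\<^sup>-\<^sup>1 W\<^sup>T\<close> of the Riccati equation for the input matrix \<open>W\<close> and the input
penalty \<open>\<Sum>i\<in>I. \<rho> i * (w i)\<^sup>2\<close>. Inputs are indexed by an arbitrary finite set, so that the blocks of an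
interconnection can serve as indices directly.\<close>

definition gram_weighted :: "nat \<Rightarrow> 'i set \<Rightarrow> ('i \<Rightarrow> real) \<Rightarrow> (nat \<Rightarrow> 'i \<Rightarrow> real) \<Rightarrow> real mat" where
  "gram_weighted k I \<rho> W = mat k k (\<lambda>(r, s). \<Sum>i\<in>I. W r i * W s i / \<rho> i)"

definition input_adjoint :: "nat \<Rightarrow> (nat \<Rightarrow> 'i \<Rightarrow> real) \<Rightarrow> complex vec \<Rightarrow> 'i \<Rightarrow> complex" where
  "input_adjoint k W z i = (\<Sum>s<k. complex_of_real (W s i) * z $ s)"

lemma gram_weighted_carrier [simp]: "gram_weighted k I \<rho> W \<in> carrier_mat k k"
  by (simp add: gram_weighted_def)

lemma gram_weighted_mult:
  assumes z: "z \<in> carrier_vec k" and r: "r < k"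
  shows "(complex_mat (gram_weighted k I \<rho> W) *\<^sub>v z) $ r =
    (\<Sum>i\<in>I. complex_of_real (W r i) * (input_adjoint k W z i / complex_of_real (\<rho> i)))"
proof -
  have "(complex_mat (gram_weighted k I \<rho> W) *\<^sub>v z) $ r =
      (\<Sum>s<k. \<Sum>i\<in>I. complex_of_real (W r i) * (W s i * z $ s / complex_of_real (\<rho> i)))"
    by (subst mult_mat_vec_index[OF _ z r])
      (use r in \<open>auto simp: gram_weighted_def sum_distrib_right sum_distrib_left mult_ac intro!: sum.cong\<close>)
  also have "\<dots> = (\<Sum>i\<in>I. \<Sum>s<k. complex_of_real (W r i) * (W s i * z $ s / complex_of_real (\<rho> i)))"
    by (rule sum.swap)
  also have "\<dots> = (\<Sum>i\<in>I. complex_of_real (W r i) * (input_adjoint k W z i / complex_of_real (\<rho> i)))"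
    by (simp add: input_adjoint_def sum_distrib_left sum_divide_distrib)
  finally show ?thesis .
qed

lemma gram_weighted_form:
  assumes z: "z \<in> carrier_vec k"
  shows "z \<bullet>c (complex_mat (gram_weighted k I \<rho> W) *\<^sub>v z) =
    of_real (\<Sum>i\<in>I. (cmod (input_adjoint k W z i))\<^sup>2 / \<rho> i)"
proof -
  have "z \<bullet>c (complex_mat (gram_weighted k I \<rho> W) *\<^sub>v z) =
     (\<Sum>r<k. \<Sum>i\<in>I. W r i * z $ r * cnj (input_adjoint k W z i) / \<rho> i)"
  proof -
    define y where "y = complex_mat (gram_weighted k I \<rho> W) *\<^sub>v z"
    have y: "y \<in> carrier_vec k" unfolding y_def by (rule carrier_vecI) (simp add: gram_weighted_def)
    have "z $ r * cnj (y $ r) = (\<Sum>i\<in>I. W r i * z $ r * cnj (input_adjoint k W z i) / \<rho> i)" if "r < k" for r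
      unfolding y_def gram_weighted_mult[OF z that] cnj_sum sum_distrib_left
      by (rule sum.cong[OF refl]) simp
    then show ?thesis unfolding y_def[symmetric] cscalar_prod_sum[OF y] by (intro sum.cong refl) auto
  qed
  also have "\<dots> = (\<Sum>i\<in>I. \<Sum>r<k. W r i * z $ r * cnj (input_adjoint k W z i) / \<rho> i)"
    by (rule sum.swap)
  also have "\<dots> = (\<Sum>i\<in>I. input_adjoint k W z i * cnj (input_adjoint k W z i) / \<rho> i)"
    by (simp add: input_adjoint_def sum_distrib_right sum_divide_distrib del: cnj_sum)
  finally show ?thesis by (simp only: complex_norm_square[symmetric]) simp
qed

text \<open>For an eigenvalue on the imaginary axis, \<open>x\<close> is the state response at that frequency to the input that
\<open>z\<close> induces, and pairing the two block equations shows that its energy equals the energy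
\<open>\<langle>z, B z\<rangle>\<close> of this input.\<close>

lemma hamiltonian_imaginary_eigenvector:
  fixes A B :: "complex mat"
  assumes A: "A \<in> carrier_mat k k" and B: "B \<in> carrier_mat k k"
    and hB: "mat_adjoint B = B" and real: "mat_adjoint A = transpose_mat A"
    and ev: "eigenvalue (hamiltonian A B) \<mu>" and re: "Re \<mu> = 0"
  obtains x z where "x \<in> carrier_vec k" "z \<in> carrier_vec k" "A *\<^sub>v x + B *\<^sub>v z = \<mu> \<cdot>\<^sub>v x"
    "complex_of_real (norm_sq x) = z \<bullet>c (B *\<^sub>v z)"
    "x = 0\<^sub>v k \<Longrightarrow> eigenvalue A (- \<mu>)"
proof -
  have cm: "cnj \<mu> = - \<mu>" using re by (simp add: complex_eq_iff)
  have tA: "transpose_mat A \<in> carrier_mat k k" using A by simp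
  note H = hamiltonian_carrier[OF A B]
  from ev obtain v where v: "v \<in> carrier_vec (k + k)" "v \<noteq> 0\<^sub>v (k + k)"
      and hv: "hamiltonian A B *\<^sub>v v = \<mu> \<cdot>\<^sub>v v"
    using H unfolding eigenvalue_def eigenvector_def by auto
  define x where "x = vec_first v k"
  define z where "z = vec_last v k"
  have x: "x \<in> carrier_vec k" and z: "z \<in> carrier_vec k" by (simp_all add: x_def z_def)
  have vxz: "v = x @\<^sub>v z" using v(1) by (simp add: x_def z_def)
  define y where "y = transpose_mat A *\<^sub>v z"
  have y: "y \<in> carrier_vec k" using tA z by (simp only: y_def mult_mat_vec_carrier)
  have Ax: "A *\<^sub>v x \<in> carrier_vec k" using A x by simp
  have Bz: "B *\<^sub>v z \<in> carrier_vec k" using B z by simp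
  have "hamiltonian A B *\<^sub>v v = (A *\<^sub>v x + B *\<^sub>v z) @\<^sub>v ((- 1\<^sub>m k) *\<^sub>v x + (- transpose_mat A) *\<^sub>v z)"
    unfolding vxz hamiltonian_def using A B tA x z
    by (subst four_block_mat_mult_vec[of _ k k _ k _ k]) auto
  moreover have "(- 1\<^sub>m k) *\<^sub>v x = - x" using x by (simp add: uminus_mult_mat_vec)
  moreover have "(- transpose_mat A) *\<^sub>v z = - y" unfolding y_def by (rule uminus_mult_mat_vec) (use tA z in simp)
  moreover have "\<mu> \<cdot>\<^sub>v v = (\<mu> \<cdot>\<^sub>v x) @\<^sub>v (\<mu> \<cdot>\<^sub>v z)" unfolding vxz using x z by (intro eq_vecI) auto
  ultimately have e: "(A *\<^sub>v x + B *\<^sub>v z) @\<^sub>v (- x + - y) = (\<mu> \<cdot>\<^sub>v x) @\<^sub>v (\<mu> \<cdot>\<^sub>v z)"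
    using hv by simp
  have "A *\<^sub>v x + B *\<^sub>v z = \<mu> \<cdot>\<^sub>v x \<and> - x + - y = \<mu> \<cdot>\<^sub>v z"
    by (subst append_vec_eq[symmetric, of _ k]) (use e Ax Bz x in auto)
  then have e1: "A *\<^sub>v x + B *\<^sub>v z = \<mu> \<cdot>\<^sub>v x" and e2: "- x + - y = \<mu> \<cdot>\<^sub>v z"
    by auto
  have xr: "x $ r = - (\<mu> * z $ r) - y $ r" if r: "r < k" for r
  proof -
    have "(- x + - y) $ r = (\<mu> \<cdot>\<^sub>v z) $ r" by (simp only: e2)
    then have h: "- x $ r - y $ r = \<mu> * z $ r" using r x y z by simp
    have "x $ r = - (- x $ r - y $ r) - y $ r" by simp
    then show ?thesis by (simp only: h)
  qed
  have Bzr: "(B *\<^sub>v z) $ r = \<mu> * x $ r - (A *\<^sub>v x) $ r" if "r < k" for r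
  proof -
    have "(A *\<^sub>v x + B *\<^sub>v z) $ r = (\<mu> \<cdot>\<^sub>v x) $ r" by (simp only: e1)
    then have "(A *\<^sub>v x) $ r + (B *\<^sub>v z) $ r = \<mu> * x $ r" using that x A B by (simp del: index_mult_mat_vec)
    then show ?thesis by (simp add: algebra_simps del: index_mult_mat_vec)
  qed
  have Axz: "(A *\<^sub>v x) \<bullet>c z = x \<bullet>c y"
    using adjoint_swap[OF A x z] by (simp add: real y_def)
  have "x \<bullet>c x = (\<Sum>r<k. x $ r * cnj (- (\<mu> * z $ r) - y $ r))"
    by (subst cscalar_prod_sum[OF x], rule sum.cong[OF refl]) (use xr in auto)
  also have "\<dots> = \<mu> * (x \<bullet>c z) - x \<bullet>c y"
    unfolding cscalar_prod_sum[OF z] cscalar_prod_sum[OF y]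
    by (simp add: algebra_simps cm sum_distrib_left sum_subtractf sum_negf sum.distrib)
  also have "\<dots> = \<mu> * (x \<bullet>c z) - (A *\<^sub>v x) \<bullet>c z" by (simp only: Axz)
  also have "\<dots> = (\<Sum>r<k. (\<mu> * x $ r - (A *\<^sub>v x) $ r) * cnj (z $ r))"
    unfolding cscalar_prod_sum[OF z]
    by (simp add: algebra_simps sum_distrib_left sum_subtractf del: index_mult_mat_vec)
  also have "\<dots> = (B *\<^sub>v z) \<bullet>c z"
    by (subst cscalar_prod_sum[OF z], rule sum.cong[OF refl]) (use Bzr in \<open>simp del: index_mult_mat_vec\<close>)
  also have "\<dots> = z \<bullet>c (B *\<^sub>v z)" using adjoint_swap[OF B z z] by (simp add: hB)
  finally have n: "complex_of_real (norm_sq x) = z \<bullet>c (B *\<^sub>v z)" by (simp only: cscalar_prod_self)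
  show ?thesis
  proof (rule that[OF x z e1 n])
    assume x0: "x = 0\<^sub>v k"
    have "y = (- \<mu>) \<cdot>\<^sub>v z"
    proof (rule eq_vecI)
      fix r assume "r < dim_vec ((- \<mu>) \<cdot>\<^sub>v z)"
      then have r: "r < k" using z by simp
      then have "0 = - (\<mu> * z $ r) - y $ r" using xr[OF r] x0 by simp
      then show "y $ r = ((- \<mu>) \<cdot>\<^sub>v z) $ r" using r z by simp
    qed (use y z in simp)
    moreover have "z \<noteq> 0\<^sub>v k"
    proof
      assume "z = 0\<^sub>v k"
      then have "v = 0\<^sub>v (k + k)" unfolding vxz x0 by (intro eq_vecI) auto
      then show False using v by simp
    qed
    ultimately have "eigenvalue (transpose_mat A) (- \<mu>)"
      using z A unfolding eigenvalue_def eigenvector_def y_def by auto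
    then show "eigenvalue A (- \<mu>)"
      using A tA by (simp add: eigenvalue_root_char_poly[of _ k])
  qed
qed

text \<open>The frequency condition excludes imaginary eigenvalues of the Hamiltonian matrix: the state response
would have the same energy as the input. Hence the Riccati equation is solvable; it is stated here as an
identity for the derivative of the storage function \<open>\<langle>c, P c\<rangle>\<close> along the system without input.\<close>

lemma bounded_real_riccati:
  fixes A :: "real mat" and W :: "nat \<Rightarrow> 'i \<Rightarrow> real"
  assumes A: "A \<in> carrier_mat k k" and stable: "hurwitz A"
    and I: "finite I" and \<rho>: "\<And>i. i \<in> I \<Longrightarrow> 0 < \<rho> i"
    and freq: "\<And>\<omega> x w. x \<in> carrier_vec k \<Longrightarrow>
      complex_mat A *\<^sub>v x + vec k (\<lambda>r. \<Sum>i\<in>I. complex_of_real (W r i) * w i) = (\<i> * complex_of_real \<omega>) \<cdot>\<^sub>v x \<Longrightarrow>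
      \<exists>i\<in>I. w i \<noteq> 0 \<Longrightarrow> norm_sq x < (\<Sum>i\<in>I. \<rho> i * (cmod (w i))\<^sup>2)"
  obtains P where "P \<in> carrier_mat k k" "mat_adjoint P = P"
    "\<And>c. c \<in> carrier_vec k \<Longrightarrow> 2 * Re ((complex_mat A *\<^sub>v c) \<bullet>c (P *\<^sub>v c)) =
      - norm_sq c - (\<Sum>i\<in>I. (cmod (input_adjoint k W (P *\<^sub>v c) i))\<^sup>2 / \<rho> i)"
proof -
  define Ac where "Ac = complex_mat A"
  define Bc where "Bc = complex_mat (gram_weighted k I \<rho> W)"
  have cA: "Ac \<in> carrier_mat k k" and cB: "Bc \<in> carrier_mat k k" using A by (auto simp: Ac_def Bc_def)
  note form = gram_weighted_form[where k = k and I = I and \<rho> = \<rho> and W = W, folded Bc_def]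
  note mult = gram_weighted_mult[where k = k and I = I and \<rho> = \<rho> and W = W, folded Bc_def]
  have symG: "transpose_mat (gram_weighted k I \<rho> W) = gram_weighted k I \<rho> W"
    by (intro eq_matI) (auto simp: gram_weighted_def mult.commute)
  have symB: "transpose_mat Bc = Bc" unfolding Bc_def by (metis symG map_mat_transpose)
  have hB: "mat_adjoint Bc = Bc" by (simp add: Bc_def mat_adjoint_complex_mat symG)
  have real: "mat_adjoint Ac = transpose_mat Ac" by (simp add: Ac_def mat_adjoint_complex_mat map_mat_transpose)
  have tA: "transpose_mat Ac \<in> carrier_mat k k" using cA by simp
  have swap: "(Ac *\<^sub>v x) \<bullet>c z = x \<bullet>c (transpose_mat Ac *\<^sub>v z)"
    if "x \<in> carrier_vec k" "z \<in> carrier_vec k" for x z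
    using adjoint_swap[OF cA that] by (simp add: real)
  have semi: "Bc *\<^sub>v z = 0\<^sub>v k" if z: "z \<in> carrier_vec k" "z \<bullet>c (Bc *\<^sub>v z) = 0" for z
  proof -
    have "(\<Sum>i\<in>I. (cmod (input_adjoint k W z i))\<^sup>2 / \<rho> i) = 0"
      using z(2) unfolding form[OF z(1)] of_real_eq_0_iff .
    then have "\<forall>i\<in>I. (cmod (input_adjoint k W z i))\<^sup>2 / \<rho> i = 0"
      using I by (subst (asm) sum_nonneg_eq_0_iff) (auto intro!: divide_nonneg_pos \<rho>)
    then have "\<forall>i\<in>I. input_adjoint k W z i = 0" using \<rho> by fastforce
    then show ?thesis using cB by (intro eq_vecI) (auto simp: mult[OF z(1)] simp del: index_mult_mat_vec)
  qed
  have axis: "Re \<mu> \<noteq> 0" if ev: "eigenvalue (hamiltonian Ac Bc) \<mu>" for \<mu>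
  proof
    assume re: "Re \<mu> = 0"
    then have mu: "\<mu> = \<i> * complex_of_real (Im \<mu>)" by (simp add: complex_eq_iff)
    from hamiltonian_imaginary_eigenvector[OF cA cB hB real ev re]
    obtain x z where x: "x \<in> carrier_vec k" and z: "z \<in> carrier_vec k"
      and e1: "Ac *\<^sub>v x + Bc *\<^sub>v z = \<mu> \<cdot>\<^sub>v x" and n: "complex_of_real (norm_sq x) = z \<bullet>c (Bc *\<^sub>v z)"
      and x0: "x = 0\<^sub>v k \<Longrightarrow> eigenvalue Ac (- \<mu>)" by metis
    \<comment> \<open>the input that the costate \<open>z\<close> induces\<close>
    define w where "w i = input_adjoint k W z i / complex_of_real (\<rho> i)" for i
    have Bw: "Bc *\<^sub>v z = vec k (\<lambda>r. \<Sum>i\<in>I. complex_of_real (W r i) * w i)"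
      by (rule eq_vecI) (use cB in \<open>auto simp: mult[OF z] w_def simp del: index_mult_mat_vec\<close>)
    have "norm_sq x = (\<Sum>i\<in>I. (cmod (input_adjoint k W z i))\<^sup>2 / \<rho> i)"
      using n unfolding form[OF z] of_real_eq_iff .
    also have "\<dots> = (\<Sum>i\<in>I. \<rho> i * (cmod (w i))\<^sup>2)"
    proof (rule sum.cong[OF refl])
      fix i assume "i \<in> I"
      then show "(cmod (input_adjoint k W z i))\<^sup>2 / \<rho> i = \<rho> i * (cmod (w i))\<^sup>2"
        using \<rho>[of i] by (simp add: w_def norm_divide power2_eq_square)
    qed
    finally have nx: "norm_sq x = (\<Sum>i\<in>I. \<rho> i * (cmod (w i))\<^sup>2)" .
    have w0: "\<forall>i\<in>I. w i = 0"
    proof (rule ccontr)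
      assume "\<not> ?thesis"
      then have "norm_sq x < (\<Sum>i\<in>I. \<rho> i * (cmod (w i))\<^sup>2)"
        using freq[OF x, of w "Im \<mu>"] e1 unfolding Bw mu[symmetric] Ac_def by blast
      then show False using nx by simp
    qed
    then have "norm_sq x = 0" unfolding nx by simp
    then have "x = 0\<^sub>v k" using norm_sq_eq_0_iff[OF x] by simp
    from hurwitz_eigenvalue[OF stable x0[OF this, unfolded Ac_def]] re show False by simp
  qed
  obtain P where P: "P \<in> carrier_mat k k" and hP: "mat_adjoint P = P"
    and ric: "P * (Ac + Bc * P) = - 1\<^sub>m k - transpose_mat Ac * P"
    using riccati_solution[OF cA cB symB hB real hurwitz_eigenvalue[OF stable, folded Ac_def] semi axis] by blast
  show ?thesis
  proof (rule that[OF P hP])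
    fix c :: "complex vec" assume c: "c \<in> carrier_vec k"
    define g where "g = P *\<^sub>v c"
    have g: "g \<in> carrier_vec k" using P c by (simp add: g_def)
    have Ac: "Ac *\<^sub>v c \<in> carrier_vec k" using cA c by (rule mult_mat_vec_carrier)
    have Bg: "Bc *\<^sub>v g \<in> carrier_vec k" using cB g by (rule mult_mat_vec_carrier)
    have Atg: "transpose_mat Ac *\<^sub>v g \<in> carrier_vec k" using tA g by (rule mult_mat_vec_carrier)
    have "P *\<^sub>v (Ac *\<^sub>v c + Bc *\<^sub>v g) = (P * (Ac + Bc * P)) *\<^sub>v c"
    proof -
      have "(P * (Ac + Bc * P)) *\<^sub>v c = P *\<^sub>v ((Ac + Bc * P) *\<^sub>v c)"
        using P cA cB c by (intro assoc_mult_mat_vec[of _ k k _ k]) auto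
      also have "(Ac + Bc * P) *\<^sub>v c = Ac *\<^sub>v c + (Bc * P) *\<^sub>v c"
        using P cA cB c by (intro add_mult_distrib_mat_vec[of _ k k]) auto
      also have "(Bc * P) *\<^sub>v c = Bc *\<^sub>v g"
        unfolding g_def using P cB c by (intro assoc_mult_mat_vec[of _ k k _ k]) auto
      finally show ?thesis ..
    qed
    also have "\<dots> = (- 1\<^sub>m k) *\<^sub>v c - (transpose_mat Ac * P) *\<^sub>v c"
      unfolding ric using P tA c by (intro minus_mult_distrib_mat_vec[of _ k k]) auto
    also have "(- 1\<^sub>m k) *\<^sub>v c = - c" using c by (simp add: uminus_mult_mat_vec)
    also have "(transpose_mat Ac * P) *\<^sub>v c = transpose_mat Ac *\<^sub>v g"
      unfolding g_def using P tA c by (intro assoc_mult_mat_vec[of _ k k _ k]) auto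
    finally have e: "P *\<^sub>v (Ac *\<^sub>v c + Bc *\<^sub>v g) = - c - transpose_mat Ac *\<^sub>v g" .
    have "g \<bullet>c (Ac *\<^sub>v c) + g \<bullet>c (Bc *\<^sub>v g) = g \<bullet>c (Ac *\<^sub>v c + Bc *\<^sub>v g)"
    proof -
      have "g \<bullet>c y + g \<bullet>c z = g \<bullet>c (y + z)" if y: "y \<in> carrier_vec k" and z: "z \<in> carrier_vec k" for y z
      proof -
        have yz: "y + z \<in> carrier_vec k" using y z by simp
        show ?thesis
          unfolding cscalar_prod_sum[OF y] cscalar_prod_sum[OF z] cscalar_prod_sum[OF yz]
          using y z by (simp add: distrib_left sum.distrib)
      qed
      from this[OF Ac Bg] show ?thesis .
    qed
    also have "\<dots> = c \<bullet>c (P *\<^sub>v (Ac *\<^sub>v c + Bc *\<^sub>v g))"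
      unfolding g_def using adjoint_swap[OF P c, of "Ac *\<^sub>v c + Bc *\<^sub>v (P *\<^sub>v c)"] Ac Bg by (simp add: hP g_def)
    also have "\<dots> = c \<bullet>c (- c - transpose_mat Ac *\<^sub>v g)" unfolding e ..
    also have "\<dots> = - (c \<bullet>c c) - c \<bullet>c (transpose_mat Ac *\<^sub>v g)"
    proof -
      have "c \<bullet>c (- c - y) = - (c \<bullet>c c) - c \<bullet>c y" if y: "y \<in> carrier_vec k" for y
      proof -
        have "- c - y \<in> carrier_vec k" using c y by simp
        then show ?thesis
          unfolding cscalar_prod_sum[OF c] cscalar_prod_sum[OF y] cscalar_prod_sum[OF \<open>- c - y \<in> carrier_vec k\<close>]
          using c y by (simp add: right_diff_distrib sum_subtractf sum_negf)
      qed
      from this[OF Atg] show ?thesis .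
    qed
    also have "\<dots> = - of_real (norm_sq c) - (Ac *\<^sub>v c) \<bullet>c g"
      by (simp add: cscalar_prod_self swap[OF c g])
    finally have "g \<bullet>c (Ac *\<^sub>v c) + (Ac *\<^sub>v c) \<bullet>c g =
        - of_real (norm_sq c) - of_real (\<Sum>i\<in>I. (cmod (input_adjoint k W g i))\<^sup>2 / \<rho> i)"
      unfolding form[OF g] by (simp add: algebra_simps)
    from arg_cong[OF this, of Re] have "Re (g \<bullet>c (Ac *\<^sub>v c)) + Re ((Ac *\<^sub>v c) \<bullet>c g) =
        - norm_sq c - (\<Sum>i\<in>I. (cmod (input_adjoint k W g i))\<^sup>2 / \<rho> i)"
      by (simp only: plus_complex.sel minus_complex.sel uminus_complex.sel Re_complex_of_real)
    moreover have "Re (g \<bullet>c (Ac *\<^sub>v c)) = Re ((Ac *\<^sub>v c) \<bullet>c g)"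
      using g Ac by (subst (1 2) cscalar_prod_sum[of _ k]) (auto simp: mult.commute simp del: index_mult_mat_vec intro!: sum.cong)
    ultimately show "2 * Re ((complex_mat A *\<^sub>v c) \<bullet>c (P *\<^sub>v c)) = - norm_sq c - (\<Sum>i\<in>I. (cmod (input_adjoint k W (P *\<^sub>v c) i))\<^sup>2 / \<rho> i)"
      unfolding g_def Ac_def by simp
  qed
qed

lemma Re_cscalar_of_real:
  assumes x: "x \<in> carrier_vec k" and g: "g \<in> carrier_vec k"
  shows "Re (map_vec complex_of_real x \<bullet>c g) = (\<Sum>r<k. x $ r * Re (g $ r))"
  using x by (subst cscalar_prod_sum[OF g]) (auto intro!: sum.cong)

lemma norm_sq_of_real: "norm_sq (map_vec complex_of_real x) = (\<Sum>r<dim_vec x. (x $ r)\<^sup>2)"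
  by (auto simp: norm_sq_def)

lemma complex_mat_mult_of_real:
  assumes "A \<in> carrier_mat a b" "x \<in> carrier_vec b"
  shows "complex_mat A *\<^sub>v map_vec complex_of_real x = map_vec complex_of_real (A *\<^sub>v x)"
  by (rule of_real_hom.mult_mat_vec_hom[OF assms, symmetric])

lemma real_scalar_prod_sum:
  fixes v w :: "real vec"
  assumes "w \<in> carrier_vec n"
  shows "v \<bullet> w = (\<Sum>i<n. v $ i * w $ i)"
  using assms by (auto simp: scalar_prod_def lessThan_atLeast0)

text \<open>The bounded real lemma with separately weighted inputs. The real part of the Riccati solution is used as
the storage matrix; completing the square in \<open>w\<close> turns the Riccati equation into the dissipation
inequality.\<close>

lemma bounded_real_storage:
  fixes A :: "real mat" and W :: "nat \<Rightarrow> 'i \<Rightarrow> real"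
  assumes A: "A \<in> carrier_mat k k" and stable: "hurwitz A"
    and I: "finite I" and \<rho>: "\<And>i. i \<in> I \<Longrightarrow> 0 < \<rho> i"
    and freq: "\<And>\<omega> x w. x \<in> carrier_vec k \<Longrightarrow>
      complex_mat A *\<^sub>v x + vec k (\<lambda>r. \<Sum>i\<in>I. complex_of_real (W r i) * w i) = (\<i> * complex_of_real \<omega>) \<cdot>\<^sub>v x \<Longrightarrow>
      \<exists>i\<in>I. w i \<noteq> 0 \<Longrightarrow> norm_sq x < (\<Sum>i\<in>I. \<rho> i * (cmod (w i))\<^sup>2)"
  obtains P where "P \<in> carrier_mat k k" "positive_definite P"
    "\<And>x w. x \<in> carrier_vec k \<Longrightarrow>
      2 * ((P *\<^sub>v x) \<bullet> (A *\<^sub>v x + vec k (\<lambda>r. \<Sum>i\<in>I. W r i * w i))) + x \<bullet> x \<le> (\<Sum>i\<in>I. \<rho> i * (w i)\<^sup>2)"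
proof -
  obtain Q where Q: "Q \<in> carrier_mat k k" and hQ: "mat_adjoint Q = Q"
    and ric: "\<And>c. c \<in> carrier_vec k \<Longrightarrow> 2 * Re ((complex_mat A *\<^sub>v c) \<bullet>c (Q *\<^sub>v c)) =
      - norm_sq c - (\<Sum>i\<in>I. (cmod (input_adjoint k W (Q *\<^sub>v c) i))\<^sup>2 / \<rho> i)"
    by (rule bounded_real_riccati[where W = W and \<rho> = \<rho>, OF A stable I]) (blast intro: \<rho> freq)+
  define P where "P = map_mat Re Q"
  have P: "P \<in> carrier_mat k k" using Q by (simp add: P_def)
  let ?c = "map_vec complex_of_real"
  have g: "Q *\<^sub>v ?c x \<in> carrier_vec k" if "x \<in> carrier_vec k" for x using Q that by simp
  have Px: "(P *\<^sub>v x) $ r = Re ((Q *\<^sub>v ?c x) $ r)" if x: "x \<in> carrier_vec k" and r: "r < k" for x r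
  proof -
    have "(Q *\<^sub>v ?c x) $ r = (\<Sum>j<k. Q $$ (r, j) * complex_of_real (x $ j))"
      by (subst mult_mat_vec_index[OF Q _ r]) (use x in \<open>auto intro!: sum.cong\<close>)
    moreover have "(P *\<^sub>v x) $ r = (\<Sum>j<k. Re (Q $$ (r, j)) * x $ j)"
      by (subst mult_mat_vec_index[OF P x r]) (use Q r in \<open>auto simp: P_def intro!: sum.cong\<close>)
    ultimately show ?thesis by simp
  qed
  have sym: "transpose_mat P = P"
  proof (rule eq_matI)
    fix i j assume ij: "i < dim_row P" "j < dim_col P"
    have "mat_adjoint Q $$ (i, j) = cnj (Q $$ (j, i))" using ij P Q by simp
    then have "Re (Q $$ (i, j)) = Re (Q $$ (j, i))" by (simp add: hQ)
    then show "transpose_mat P $$ (i, j) = P $$ (i, j)" using ij P Q by (simp add: P_def)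
  qed (use P in auto)
  have qpos: "Re (c \<bullet>c (Q *\<^sub>v c)) > 0" if c: "c \<in> carrier_vec k" "c \<noteq> 0\<^sub>v k" for c
  proof (rule lyapunov_positive[of "complex_mat A" k Q])
    show "complex_mat A \<in> carrier_mat k k" using A by simp
    show "Re \<mu> < 0" if "eigenvalue (complex_mat A) \<mu>" for \<mu> by (rule hurwitz_eigenvalue[OF stable that])
    fix d :: "complex vec" assume d: "d \<in> carrier_vec k" "d \<noteq> 0\<^sub>v k"
    have "0 \<le> (\<Sum>i\<in>I. (cmod (input_adjoint k W (Q *\<^sub>v d) i))\<^sup>2 / \<rho> i)"
      by (intro sum_nonneg divide_nonneg_pos) (use \<rho> in auto)
    then show "Re ((complex_mat A *\<^sub>v d) \<bullet>c (Q *\<^sub>v d)) < 0"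
      using ric[OF d(1)] norm_sq_pos[OF d] by linarith
  qed (use Q hQ c in auto)
  have pd: "positive_definite P"
    unfolding positive_definite_def
  proof (intro conjI ballI impI)
    show "square_mat P" using P by simp
    show "transpose_mat P = P" by (rule sym)
    fix v :: "real vec" assume v: "v \<in> carrier_vec (dim_row P)" "v \<noteq> 0\<^sub>v (dim_row P)"
    then have vk: "v \<in> carrier_vec k" "v \<noteq> 0\<^sub>v k" using P by auto
    have "?c v \<noteq> 0\<^sub>v k"
    proof
      assume z: "?c v = 0\<^sub>v k"
      have "v $ i = 0" if "i < k" for i
        using arg_cong[OF z, of "\<lambda>u. u $ i"] that vk by simp
      then show False using vk by (metis carrier_vecD eq_vecI index_zero_vec)
    qed
    then have "0 < Re (?c v \<bullet>c (Q *\<^sub>v ?c v))" using vk by (intro qpos) auto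
    also have "\<dots> = v \<bullet> (P *\<^sub>v v)"
      using P vk g[OF vk(1)] by (simp add: Re_cscalar_of_real[OF vk(1) g[OF vk(1)]]
          real_scalar_prod_sum[of _ k] Px[OF vk(1)] del: index_mult_mat_vec)
    finally show "v \<bullet> (P *\<^sub>v v) > 0" .
  qed
  show ?thesis
  proof (rule that[OF P pd])
    fix x :: "real vec" and w :: "'i \<Rightarrow> real" assume x: "x \<in> carrier_vec k"
    define h where "h = input_adjoint k W (Q *\<^sub>v ?c x)"
    have Ax: "A *\<^sub>v x \<in> carrier_vec k" using A x by simp
    have cx: "?c x \<in> carrier_vec k" using x by simp
    have "(P *\<^sub>v x) \<bullet> (A *\<^sub>v x + vec k (\<lambda>r. \<Sum>i\<in>I. W r i * w i)) =
        (\<Sum>r<k. (P *\<^sub>v x) $ r * ((A *\<^sub>v x) $ r + (\<Sum>i\<in>I. W r i * w i)))"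
      by (subst real_scalar_prod_sum[of _ k]) (use Ax in \<open>auto simp del: index_mult_mat_vec\<close>)
    also have "\<dots> = (\<Sum>r<k. (A *\<^sub>v x) $ r * Re ((Q *\<^sub>v ?c x) $ r)) +
        (\<Sum>r<k. \<Sum>i\<in>I. W r i * Re ((Q *\<^sub>v ?c x) $ r) * w i)"
      unfolding sum.distrib[symmetric]
      by (rule sum.cong[OF refl])
        (simp add: Px[OF x] algebra_simps sum_distrib_left del: index_mult_mat_vec)
    also have "(\<Sum>r<k. \<Sum>i\<in>I. W r i * Re ((Q *\<^sub>v ?c x) $ r) * w i) =
        (\<Sum>i\<in>I. \<Sum>r<k. W r i * Re ((Q *\<^sub>v ?c x) $ r) * w i)" by (rule sum.swap)
    also have "\<dots> = (\<Sum>i\<in>I. Re (h i) * w i)"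
      by (simp add: h_def input_adjoint_def sum_distrib_right del: index_mult_mat_vec)
    also have "(\<Sum>r<k. (A *\<^sub>v x) $ r * Re ((Q *\<^sub>v ?c x) $ r)) = Re ((complex_mat A *\<^sub>v ?c x) \<bullet>c (Q *\<^sub>v ?c x))"
      unfolding complex_mat_mult_of_real[OF A x] by (rule Re_cscalar_of_real[OF Ax g[OF x], symmetric])
    finally have "2 * ((P *\<^sub>v x) \<bullet> (A *\<^sub>v x + vec k (\<lambda>r. \<Sum>i\<in>I. W r i * w i))) =
        - norm_sq (?c x) - (\<Sum>i\<in>I. (cmod (h i))\<^sup>2 / \<rho> i) + 2 * (\<Sum>i\<in>I. Re (h i) * w i)"
      using ric[OF cx] by (simp add: h_def)
    also have "norm_sq (?c x) = x \<bullet> x" using x by (simp add: norm_sq_of_real real_scalar_prod_sum[of _ k] power2_eq_square)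
    also have "2 * (\<Sum>i\<in>I. Re (h i) * w i) \<le> (\<Sum>i\<in>I. (cmod (h i))\<^sup>2 / \<rho> i) + (\<Sum>i\<in>I. \<rho> i * (w i)\<^sup>2)"
      unfolding sum_distrib_left sum.distrib[symmetric]
    proof (rule sum_mono)
      fix i assume "i \<in> I"
      then have r: "\<rho> i > 0" by (rule \<rho>)
      have "0 \<le> (Re (h i) - \<rho> i * w i)\<^sup>2 / \<rho> i" using r by simp
      also have "\<dots> = (Re (h i))\<^sup>2 / \<rho> i - 2 * (Re (h i) * w i) + \<rho> i * (w i)\<^sup>2"
        using r by (simp add: power2_eq_square field_simps)
      also have "(Re (h i))\<^sup>2 / \<rho> i \<le> (cmod (h i))\<^sup>2 / \<rho> i"
        using r abs_Re_le_cmod[of "h i"] by (intro divide_right_mono) (auto simp: abs_le_square_iff[symmetric])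
      finally show "2 * (Re (h i) * w i) \<le> (cmod (h i))\<^sup>2 / \<rho> i + \<rho> i * (w i)\<^sup>2" by simp
    qed
    finally show "2 * ((P *\<^sub>v x) \<bullet> (A *\<^sub>v x + vec k (\<lambda>r. \<Sum>i\<in>I. W r i * w i))) + x \<bullet> x \<le> (\<Sum>i\<in>I. \<rho> i * (w i)\<^sup>2)"
      by simp
  qed
qed

section \<open>Frequency responses of Hurwitz systems\<close>

lemma shifted_mat_mult_vec:
  fixes M :: "complex mat"
  assumes M: "M \<in> carrier_mat k k" and x: "x \<in> carrier_vec k"
  shows "(s \<cdot>\<^sub>m 1\<^sub>m k - M) *\<^sub>v x = s \<cdot>\<^sub>v x - M *\<^sub>v x"
proof -
  have "(s \<cdot>\<^sub>m 1\<^sub>m k - M) *\<^sub>v x = (s \<cdot>\<^sub>m 1\<^sub>m k) *\<^sub>v x - M *\<^sub>v x"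
    using M x by (intro minus_mult_distrib_mat_vec) auto
  then show ?thesis by (simp add: scalar_mat_mult_vec[OF x])
qed

lemma vec_minus_eq_iff:
  fixes x y z :: "'a :: ab_group_add vec"
  assumes "x \<in> carrier_vec k" "y \<in> carrier_vec k" "z \<in> carrier_vec k"
  shows "x - y = z \<longleftrightarrow> y + z = x"
proof -
  have "x - y = z \<longleftrightarrow> (\<forall>i<k. x $ i - y $ i = z $ i)" using assms by (auto simp: vec_eq_iff)
  also have "\<dots> \<longleftrightarrow> (\<forall>i<k. y $ i + z $ i = x $ i)"
    by (intro all_cong iffI) (auto simp: algebra_simps)
  also have "\<dots> \<longleftrightarrow> y + z = x" using assms by (auto simp: vec_eq_iff)
  finally show ?thesis .
qed

text \<open>Applied to \<open>b\<close>, the resolvent gives the state response to \<open>b\<close>, the unique solution of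
\<open>A x + b = s x\<close>. This equation is the form in which the bounded real lemma speaks about frequencies.\<close>

lemma hurwitz_resolvent:
  assumes A: "A \<in> carrier_mat k k" and stable: "hurwitz A" and s: "0 \<le> Re s"
  shows resolvent_carrier: "resolvent A s \<in> carrier_mat k k"
    and resolvent_solves: "b \<in> carrier_vec k \<Longrightarrow>
      complex_mat A *\<^sub>v (resolvent A s *\<^sub>v b) + b = s \<cdot>\<^sub>v (resolvent A s *\<^sub>v b)"
    and resolvent_unique: "b \<in> carrier_vec k \<Longrightarrow> x \<in> carrier_vec k \<Longrightarrow>
      complex_mat A *\<^sub>v x + b = s \<cdot>\<^sub>v x \<Longrightarrow> x = resolvent A s *\<^sub>v b"
proof -
  define M where "M = complex_mat A"
  have M: "M \<in> carrier_mat k k" using A by (simp add: M_def)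
  define X where "X = s \<cdot>\<^sub>m 1\<^sub>m k - M"
  have X: "X \<in> carrier_mat k k" using M unfolding X_def by auto
  have Xv: "X *\<^sub>v x = s \<cdot>\<^sub>v x - M *\<^sub>v x" if "x \<in> carrier_vec k" for x
    unfolding X_def by (rule shifted_mat_mult_vec[OF M that])
  have iff: "X *\<^sub>v x = b \<longleftrightarrow> M *\<^sub>v x + b = s \<cdot>\<^sub>v x" if x: "x \<in> carrier_vec k" and b: "b \<in> carrier_vec k" for x b
    unfolding Xv[OF x] by (rule vec_minus_eq_iff) (use M x b in auto)
  have inj: "x = 0\<^sub>v k" if x: "x \<in> carrier_vec k" "X *\<^sub>v x = 0\<^sub>v k" for x
  proof (rule ccontr)
    assume "x \<noteq> 0\<^sub>v k"
    moreover have "M *\<^sub>v x = s \<cdot>\<^sub>v x" using iff[OF x(1), of "0\<^sub>v k"] x M by simp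
    ultimately have "eigenvalue (complex_mat A) s"
      using x M unfolding eigenvalue_def eigenvector_def M_def by auto
    from hurwitz_eigenvalue[OF stable this] s show False by simp
  qed
  have R: "resolvent A s = mat_inv X" using A by (simp add: resolvent_def X_def M_def)
  note inv = mat_inv_inverse[OF X inj, folded R]
  show "resolvent A s \<in> carrier_mat k k" by (rule inv(1))
  show "complex_mat A *\<^sub>v (resolvent A s *\<^sub>v b) + b = s \<cdot>\<^sub>v (resolvent A s *\<^sub>v b)" if b: "b \<in> carrier_vec k"
  proof -
    have Rb: "resolvent A s *\<^sub>v b \<in> carrier_vec k" using inv(1) b by (rule mult_mat_vec_carrier)
    have "X *\<^sub>v (resolvent A s *\<^sub>v b) = b"
      using assoc_mult_mat_vec[OF X inv(1) b] inv(2) b by simp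
    then show ?thesis using iff[OF Rb b] by (simp add: M_def)
  qed
  show "x = resolvent A s *\<^sub>v b" if b: "b \<in> carrier_vec k" and x: "x \<in> carrier_vec k"
    and e: "complex_mat A *\<^sub>v x + b = s \<cdot>\<^sub>v x"
  proof -
    have "X *\<^sub>v x = b" using iff[OF x b] e by (simp add: M_def)
    then show ?thesis using assoc_mult_mat_vec[OF inv(1) X x] inv(3) x by simp
  qed
qed

lemma cscalar_prod_commute:
  assumes "x \<in> carrier_vec k" "y \<in> carrier_vec k"
  shows "y \<bullet>c x = cnj (x \<bullet>c y)"
  unfolding cscalar_prod_sum[OF assms(1)] cscalar_prod_sum[OF assms(2)] by (simp add: mult.commute)

lemma Re_cscalar_prod_le:
  assumes x: "x \<in> carrier_vec k" and y: "y \<in> carrier_vec k"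
  shows "2 * Re (y \<bullet>c x) \<le> norm_sq x / 2 + 2 * norm_sq y"
proof -
  have "2 * Re (a * cnj b) \<le> (cmod b)\<^sup>2 / 2 + 2 * (cmod a)\<^sup>2" for a b
  proof -
    have young: "2 * (p * q) \<le> q\<^sup>2 / 2 + 2 * p\<^sup>2" for p q :: real
    proof -
      have "0 \<le> (q - 2 * p)\<^sup>2 / 2" by simp
      also have "\<dots> = q\<^sup>2 / 2 + 2 * p\<^sup>2 - 2 * (p * q)" by (simp add: power2_eq_square field_simps)
      finally show ?thesis by simp
    qed
    show ?thesis using young[of "Re a" "Re b"] young[of "Im a" "Im b"]
      by (simp add: cmod_power2 add_divide_distrib)
  qed
  then have "(\<Sum>i<k. 2 * Re (y $ i * cnj (x $ i))) \<le> (\<Sum>i<k. (cmod (x $ i))\<^sup>2 / 2 + 2 * (cmod (y $ i))\<^sup>2)"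
    by (intro sum_mono)
  then show ?thesis
    unfolding cscalar_prod_sum[OF x] norm_sq_def using x y
    by (simp add: sum.distrib sum_divide_distrib sum_distrib_left del: times_complex.sel)
qed

text \<open>The bounded real lemma without inputs provides a Lyapunov matrix \<open>Q\<close>. In the closed right half-plane the
real part of \<open>\<langle>s x, Q x\<rangle>\<close> is nonnegative, so the decay of \<open>x\<close> is paid for by \<open>b\<close> alone, uniformly in \<open>s\<close>.
The imaginary axis is needed for H-infinity norms, the positive real axis for Metzler matrices.\<close>

lemma resolvent_bound:
  assumes A: "A \<in> carrier_mat k k" and stable: "hurwitz A" and k: "k > 0"
  obtains c where "0 \<le> c" "\<And>s x b. 0 \<le> Re s \<Longrightarrow> x \<in> carrier_vec k \<Longrightarrow> b \<in> carrier_vec k \<Longrightarrow>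
    complex_mat A *\<^sub>v x + b = s \<cdot>\<^sub>v x \<Longrightarrow> norm_sq x \<le> c\<^sup>2 * norm_sq b"
proof -
  obtain Q where Q: "Q \<in> carrier_mat k k" and hQ: "mat_adjoint Q = Q"
    and ric: "\<And>c. c \<in> carrier_vec k \<Longrightarrow> 2 * Re ((complex_mat A *\<^sub>v c) \<bullet>c (Q *\<^sub>v c)) = - norm_sq c"
    by (rule bounded_real_riccati[where I = "{}" and W = "\<lambda>_ _. 0" and \<rho> = "\<lambda>_. 1", OF A stable]) auto
  define M where "M = complex_mat A"
  have M: "M \<in> carrier_mat k k" using A by (simp add: M_def)
  note ric = ric[folded M_def]
  have qpos: "Re (x \<bullet>c (Q *\<^sub>v x)) \<ge> 0" if x: "x \<in> carrier_vec k" for x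
  proof (cases "x = 0\<^sub>v k")
    case False
    have "Re (x \<bullet>c (Q *\<^sub>v x)) > 0"
    proof (rule lyapunov_positive[of M k Q])
      show "Re \<mu> < 0" if "eigenvalue M \<mu>" for \<mu> using hurwitz_eigenvalue[OF stable] that by (simp add: M_def)
      fix d :: "complex vec" assume d: "d \<in> carrier_vec k" "d \<noteq> 0\<^sub>v k"
      then show "Re ((M *\<^sub>v d) \<bullet>c (Q *\<^sub>v d)) < 0" using ric[OF d(1)] norm_sq_pos[OF d] by linarith
    qed (use M Q hQ x False in auto)
    then show ?thesis by simp
  qed (use Q in auto)
  \<comment> \<open>by Young's inequality, \<open>\<bar>x\<bar>\<^sup>2 \<le> \<bar>x\<bar>\<^sup>2 / 2 + 2 \<bar>Q b\<bar>\<^sup>2\<close>\<close>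
  show ?thesis
  proof (rule that[of "2 * spectral_norm Q"])
    show "0 \<le> 2 * spectral_norm Q" using spectral_norm_nonneg[OF Q k] by simp
    fix s x b assume s: "0 \<le> Re s" and x: "x \<in> carrier_vec k" and b: "b \<in> carrier_vec k"
      and e: "complex_mat A *\<^sub>v x + b = s \<cdot>\<^sub>v x"
    have Qx: "Q *\<^sub>v x \<in> carrier_vec k" and Qb: "Q *\<^sub>v b \<in> carrier_vec k" using Q x b by simp_all
    have Mx: "M *\<^sub>v x \<in> carrier_vec k" using M x by simp
    have "cnj (x \<bullet>c (Q *\<^sub>v x)) = x \<bullet>c (Q *\<^sub>v x)"
      using cscalar_prod_commute[OF x Qx] adjoint_swap[OF Q x x] by (simp add: hQ)
    then have im: "Im (x \<bullet>c (Q *\<^sub>v x)) = 0" by (simp add: complex_eq_iff)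
    have "(s \<cdot>\<^sub>v x) \<bullet>c (Q *\<^sub>v x) = s * (x \<bullet>c (Q *\<^sub>v x))" using x Qx by simp
    then have "0 \<le> Re ((s \<cdot>\<^sub>v x) \<bullet>c (Q *\<^sub>v x))" using s qpos[OF x] im by simp
    also have "(s \<cdot>\<^sub>v x) \<bullet>c (Q *\<^sub>v x) = (M *\<^sub>v x) \<bullet>c (Q *\<^sub>v x) + b \<bullet>c (Q *\<^sub>v x)"
      unfolding e[symmetric] M_def[symmetric] by (rule add_scalar_prod_distrib) (use Mx b Qx in auto)
    also have "b \<bullet>c (Q *\<^sub>v x) = (Q *\<^sub>v b) \<bullet>c x" using adjoint_swap[OF Q b x] by (simp add: hQ)
    finally have "norm_sq x \<le> 2 * Re ((Q *\<^sub>v b) \<bullet>c x)" using ric[OF x] by simp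
    also have "\<dots> \<le> norm_sq x / 2 + 2 * norm_sq (Q *\<^sub>v b)" by (rule Re_cscalar_prod_le[OF x Qb])
    finally have "norm_sq x \<le> 4 * norm_sq (Q *\<^sub>v b)" by simp
    also have "\<dots> \<le> (2 * spectral_norm Q)\<^sup>2 * norm_sq b"
      using norm_sq_mult_le_spectral_norm[OF Q k b] by (simp add: power_mult_distrib)
    finally show "norm_sq x \<le> (2 * spectral_norm Q)\<^sup>2 * norm_sq b" .
  qed
qed

lemma hinf_norm_resolvent:
  assumes A: "A \<in> carrier_mat k k" and stable: "hurwitz A" and k: "k > 0"
    and Z: "Z \<in> carrier_mat k m" and m: "m > 0"
  defines "\<phi> \<equiv> hinf_norm (\<lambda>s. resolvent A s * complex_mat Z)"
  shows "0 \<le> \<phi>"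
    and "w \<in> carrier_vec m \<Longrightarrow>
      norm_sq (resolvent A (\<i> * complex_of_real \<omega>) *\<^sub>v (complex_mat Z *\<^sub>v w)) \<le> \<phi>\<^sup>2 * norm_sq w"
proof -
  obtain c where c: "0 \<le> c" and bound: "\<And>s x b. 0 \<le> Re s \<Longrightarrow> x \<in> carrier_vec k \<Longrightarrow> b \<in> carrier_vec k \<Longrightarrow>
    complex_mat A *\<^sub>v x + b = s \<cdot>\<^sub>v x \<Longrightarrow> norm_sq x \<le> c\<^sup>2 * norm_sq b"
    using resolvent_bound[OF A stable k] by blast
  define M where "M = complex_mat Z"
  have M: "M \<in> carrier_mat k m" using Z by (simp add: M_def)
  let ?s = "\<lambda>\<omega>. \<i> * complex_of_real \<omega>"
  have R: "resolvent A (?s \<omega>) \<in> carrier_mat k k" for \<omega>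
    by (rule resolvent_carrier[OF A stable]) simp
  have T: "resolvent A (?s \<omega>) * M \<in> carrier_mat k m" for \<omega> using R M by (rule mult_carrier_mat)
  have Tv: "(resolvent A (?s \<omega>) * M) *\<^sub>v w = resolvent A (?s \<omega>) *\<^sub>v (M *\<^sub>v w)" if "w \<in> carrier_vec m" for \<omega> w
    by (rule assoc_mult_mat_vec[OF R M that])
  have le: "norm_sq ((resolvent A (?s \<omega>) * M) *\<^sub>v w) \<le> (c * spectral_norm M)\<^sup>2 * norm_sq w"
    if w: "w \<in> carrier_vec m" for \<omega> w
  proof -
    have Mw: "M *\<^sub>v w \<in> carrier_vec k" using M w by simp
    have "norm_sq (resolvent A (?s \<omega>) *\<^sub>v (M *\<^sub>v w)) \<le> c\<^sup>2 * norm_sq (M *\<^sub>v w)"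
      by (rule bound[of "?s \<omega>"])
        (use Mw R resolvent_solves[OF A stable, of "?s \<omega>"] in \<open>auto intro!: mult_mat_vec_carrier[OF R]\<close>)
    also have "\<dots> \<le> c\<^sup>2 * ((spectral_norm M)\<^sup>2 * norm_sq w)"
      by (intro mult_left_mono norm_sq_mult_le_spectral_norm[OF M m w]) simp
    finally show ?thesis by (simp add: Tv[OF w] power_mult_distrib mult.assoc)
  qed
  have cn: "0 \<le> c * spectral_norm M" using c spectral_norm_nonneg[OF M m] by simp
  note b = hinf_norm_nonneg[where T = "\<lambda>s. resolvent A s * M", OF T m cn le]
    norm_sq_le_hinf_norm[where T = "\<lambda>s. resolvent A s * M", OF T m cn le]
  show "0 \<le> \<phi>" using b(1) by (simp add: \<phi>_def M_def)
  show "norm_sq (resolvent A (?s \<omega>) *\<^sub>v (complex_mat Z *\<^sub>v w)) \<le> \<phi>\<^sup>2 * norm_sq w" if w: "w \<in> carrier_vec m"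
    using b(2)[OF _ w, of \<omega>] unfolding Tv[OF w] by (simp add: \<phi>_def M_def)
qed

section \<open>Metzler matrices\<close>

text \<open>Compare \<open>x\<close> with the largest multiple of \<open>\<xi>\<close> below it: a negative factor contradicts the inequalities in
the row where the two touch.\<close>

lemma metzler_minimum_principle:
  fixes F :: "nat \<Rightarrow> nat \<Rightarrow> real"
  assumes metzler: "\<And>i j. i < n \<Longrightarrow> j < n \<Longrightarrow> i \<noteq> j \<Longrightarrow> 0 \<le> F i j"
    and \<xi>: "\<And>i. i < n \<Longrightarrow> 0 < \<xi> i" "\<And>i. i < n \<Longrightarrow> (\<Sum>j<n. F i j * \<xi> j) < s * \<xi> i"
    and x: "\<And>i. i < n \<Longrightarrow> (\<Sum>j<n. F i j * x j) \<le> s * x i"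
    and i: "i < n"
  shows "0 \<le> x i"
proof -
  obtain m where m: "m < n" and least: "\<And>j. j < n \<Longrightarrow> x m / \<xi> m \<le> x j / \<xi> j"
    using ex_min_if_finite[of "(\<lambda>j. x j / \<xi> j) ` {..<n}"] i by (force simp: not_less)
  define t where "t = x m / \<xi> m"
  have xm: "x m = t * \<xi> m" using \<xi>(1)[OF m] by (simp add: t_def)
  have ge: "t * \<xi> j \<le> x j" if "j < n" for j
    using least[OF that] \<xi>(1)[OF that] by (simp add: t_def field_simps)
  have "t * (\<Sum>j<n. F m j * \<xi> j) = (\<Sum>j<n. F m j * (t * \<xi> j))"
    by (simp add: sum_distrib_left mult_ac)
  also have "\<dots> \<le> (\<Sum>j<n. F m j * x j)"
  proof (rule sum_mono)
    fix j assume "j \<in> {..<n}"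
    then show "F m j * (t * \<xi> j) \<le> F m j * x j"
      using metzler[OF m, of j] ge[of j] xm by (cases "j = m") (auto intro: mult_left_mono)
  qed
  also have "\<dots> \<le> s * x m" by (rule x[OF m])
  finally have "t * (s * \<xi> m - (\<Sum>j<n. F m j * \<xi> j)) \<ge> 0" by (simp add: xm algebra_simps)
  then have "t \<ge> 0" using \<xi>(2)[OF m] by (simp add: zero_le_mult_iff)
  then have "0 \<le> t * \<xi> i" using \<xi>(1)[OF i] by simp
  then show ?thesis using ge[OF i] by simp
qed

lemma metzler_positive:
  fixes F :: "nat \<Rightarrow> nat \<Rightarrow> real"
  assumes metzler: "\<And>i j. i < n \<Longrightarrow> j < n \<Longrightarrow> i \<noteq> j \<Longrightarrow> 0 \<le> F i j"
    and \<xi>: "\<And>i. i < n \<Longrightarrow> 0 < \<xi> i" "\<And>i. i < n \<Longrightarrow> (\<Sum>j<n. F i j * \<xi> j) < s * \<xi> i"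
    and x: "\<And>i. i < n \<Longrightarrow> (\<Sum>j<n. F i j * x j) < s * x i"
    and i: "i < n"
  shows "0 < x i"
proof (rule ccontr)
  have nonneg: "0 \<le> x j" if "j < n" for j
    by (rule metzler_minimum_principle[where F = F and \<xi> = \<xi> and s = s])
      (use metzler \<xi> x that in \<open>auto intro: less_imp_le\<close>)
  assume "\<not> 0 < x i"
  then have "x i = 0" using nonneg[OF i] by simp
  moreover have "0 \<le> (\<Sum>j<n. F i j * x j)"
  proof (rule sum_nonneg)
    fix j assume "j \<in> {..<n}"
    then show "0 \<le> F i j * x j"
      using metzler[OF i, of j] nonneg[of j] \<open>x i = 0\<close> by (cases "j = i") auto
  qed
  ultimately show False using x[OF i] by simp
qed

lemma component_le_norm_sq: "i < dim_vec x \<Longrightarrow> (Re (x $ i))\<^sup>2 \<le> norm_sq x"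
proof -
  assume i: "i < dim_vec x"
  have "(Re (x $ i))\<^sup>2 \<le> (cmod (x $ i))\<^sup>2"
    using abs_Re_le_cmod[of "x $ i"] by (simp add: abs_le_square_iff[symmetric])
  also have "\<dots> \<le> norm_sq x" unfolding norm_sq_def using i by (intro member_le_sum) auto
  finally show ?thesis .
qed

text \<open>Call \<open>s\<close> good if some positive \<open>\<xi>\<close> satisfies \<open>F \<xi> < s \<xi>\<close>. Large \<open>s\<close> are good. From a good \<open>s \<ge> 0\<close>, the
solution of \<open>(s - F) x = 1\<close> is positive, and it is bounded independently of \<open>s\<close>; it therefore witnesses
that \<open>s - \<epsilon>\<close> is good, with the same \<open>\<epsilon>\<close> at each step. Finitely many steps lead to \<open>s = 0\<close>.\<close>

lemma metzler_hurwitz_subsolution: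
  assumes F: "F \<in> carrier_mat n n" and stable: "hurwitz F" and n: "n > 0"
    and metzler: "\<And>i j. i < n \<Longrightarrow> j < n \<Longrightarrow> i \<noteq> j \<Longrightarrow> 0 \<le> F $$ (i, j)"
  obtains \<xi> where "\<And>i. i < n \<Longrightarrow> 0 < \<xi> i" "\<And>i. i < n \<Longrightarrow> (\<Sum>j<n. F $$ (i, j) * \<xi> j) < 0"
proof -
  define good where "good s \<longleftrightarrow> (\<exists>\<xi>. (\<forall>i<n. 0 < \<xi> i) \<and> (\<forall>i<n. (\<Sum>j<n. F $$ (i, j) * \<xi> j) < s * \<xi> i))" for s :: real
  obtain c where c: "0 \<le> c" and bound: "\<And>s x b. 0 \<le> Re s \<Longrightarrow> x \<in> carrier_vec n \<Longrightarrow> b \<in> carrier_vec n \<Longrightarrow>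
    complex_mat F *\<^sub>v x + b = s \<cdot>\<^sub>v x \<Longrightarrow> norm_sq x \<le> c\<^sup>2 * norm_sq b"
    using resolvent_bound[OF F stable n] by blast
  \<comment> \<open>a bound, valid for all \<open>s \<ge> 0\<close>, on the components of the solution of \<open>(s - F) x = 1\<close>\<close>
  define K where "K = c * sqrt (real n)"
  define \<epsilon> where "\<epsilon> = 1 / (K + 1)"
  have K: "0 \<le> K" using c by (simp add: K_def)
  then have \<epsilon>: "\<epsilon> > 0" by (simp add: \<epsilon>_def)
  have mono: "good t" if "good s" "s \<le> t" for s t
  proof -
    from that obtain \<xi> where "\<forall>i<n. 0 < \<xi> i" "\<forall>i<n. (\<Sum>j<n. F $$ (i, j) * \<xi> j) < s * \<xi> i"
      by (auto simp: good_def)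
    then show ?thesis unfolding good_def using \<open>s \<le> t\<close>
      by (intro exI[of _ \<xi>]) (meson less_imp_le mult_right_mono order_less_le_trans)
  qed
  have step: "good (s - \<epsilon>)" if g: "good s" and s: "0 \<le> s" for s
  proof -
    from g obtain \<xi> where \<xi>: "\<forall>i<n. 0 < \<xi> i" "\<forall>i<n. (\<Sum>j<n. F $$ (i, j) * \<xi> j) < s * \<xi> i"
      by (auto simp: good_def)
    define b :: "complex vec" where "b = vec n (\<lambda>_. 1)"
    have b: "b \<in> carrier_vec n" by (simp add: b_def)
    define z where "z = resolvent F (complex_of_real s) *\<^sub>v b"
    have z: "z \<in> carrier_vec n"
      unfolding z_def by (rule mult_mat_vec_carrier[OF resolvent_carrier[OF F stable] b]) (use s in simp)
    have ze: "complex_mat F *\<^sub>v z + b = complex_of_real s \<cdot>\<^sub>v z"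
      unfolding z_def by (rule resolvent_solves[OF F stable _ b]) (use s in simp)
    define x where "x i = Re (z $ i)" for i
    have xe: "(\<Sum>j<n. F $$ (i, j) * x j) + 1 = s * x i" if i: "i < n" for i
    proof -
      have "(complex_mat F *\<^sub>v z + b) $ i = (complex_of_real s \<cdot>\<^sub>v z) $ i" by (simp only: ze)
      then have "(complex_mat F *\<^sub>v z) $ i + 1 = complex_of_real s * z $ i"
        using i F z by (simp add: b_def del: index_mult_mat_vec)
      moreover have "(complex_mat F *\<^sub>v z) $ i = (\<Sum>j<n. complex_of_real (F $$ (i, j)) * z $ j)"
        by (subst mult_mat_vec_index[OF _ z i]) (use F i in \<open>auto intro!: sum.cong\<close>)
      ultimately have "Re ((\<Sum>j<n. complex_of_real (F $$ (i, j)) * z $ j) + 1) = Re (complex_of_real s * z $ i)"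
        by simp
      then show ?thesis by (simp add: x_def)
    qed
    have pos: "0 < x i" if "i < n" for i
      by (rule metzler_positive[where F = "\<lambda>i j. F $$ (i, j)" and \<xi> = \<xi> and s = s and n = n])
        (use metzler \<xi> that xe in \<open>auto simp flip: xe\<close>)
    have le: "x i \<le> K" if i: "i < n" for i
    proof (rule power2_le_imp_le[OF _ K])
      have "(x i)\<^sup>2 \<le> norm_sq z" using component_le_norm_sq[of i z] z i by (simp add: x_def)
      also have "\<dots> \<le> c\<^sup>2 * norm_sq b" by (rule bound[OF _ z b ze]) (use s in simp)
      also have "\<dots> = K\<^sup>2" by (simp add: K_def b_def norm_sq_def power_mult_distrib)
      finally show "(x i)\<^sup>2 \<le> K\<^sup>2" .
    qed
    have "(\<Sum>j<n. F $$ (i, j) * x j) < (s - \<epsilon>) * x i" if i: "i < n" for i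
    proof -
      have "\<epsilon> * x i \<le> \<epsilon> * K" using le[OF i] \<epsilon> by simp
      also have "\<dots> < 1" using K by (simp add: \<epsilon>_def)
      finally show ?thesis using xe[OF i] by (simp add: algebra_simps)
    qed
    then show ?thesis unfolding good_def using pos by blast
  qed
  \<comment> \<open>the all-ones vector witnesses that values above all row sums are good\<close>
  define s0 where "s0 = 1 + (\<Sum>i<n. \<Sum>j<n. \<bar>F $$ (i, j)\<bar>)"
  have "good s0"
    unfolding good_def
  proof (intro exI[of _ "\<lambda>_. 1"] conjI allI impI)
    fix i assume i: "i < n"
    have "(\<Sum>j<n. F $$ (i, j)) \<le> (\<Sum>j<n. \<bar>F $$ (i, j)\<bar>)" by (intro sum_mono) simp
    also have "\<dots> \<le> (\<Sum>i<n. \<Sum>j<n. \<bar>F $$ (i, j)\<bar>)"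
      by (rule member_le_sum[of i _ "\<lambda>i. \<Sum>j<n. \<bar>F $$ (i, j)\<bar>"]) (use i in \<open>auto intro: sum_nonneg\<close>)
    finally show "(\<Sum>j<n. F $$ (i, j) * 1) < s0 * 1" by (simp add: s0_def)
  qed simp
  have "good (max 0 (s0 - real m * \<epsilon>))" for m
  proof (induction m)
    case 0
    then show ?case using \<open>good s0\<close> by (auto intro: mono)
  next
    case (Suc m)
    have "good (max 0 (s0 - real m * \<epsilon>) - \<epsilon>)" by (rule step[OF Suc.IH]) simp
    then show ?case by (rule mono) (use \<epsilon> in \<open>auto simp: algebra_simps max_def\<close>)
  qed
  moreover obtain m :: nat where "s0 / \<epsilon> \<le> real m" using real_arch_simple by blast
  then have "max 0 (s0 - real m * \<epsilon>) = 0" using \<epsilon> by (simp add: field_simps)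
  ultimately have "good 0" by metis
  then show ?thesis using that by (auto simp: good_def)
qed

section \<open>Gains of transfer functions\<close>

lemma norm_sq_add_le:
  assumes "a \<in> carrier_vec n" "b \<in> carrier_vec n"
  shows "norm_sq (a + b) \<le> 2 * norm_sq a + 2 * norm_sq b"
proof -
  have "(cmod (x + y))\<^sup>2 \<le> 2 * (cmod x)\<^sup>2 + 2 * (cmod y)\<^sup>2" for x y
  proof -
    have "(cmod (x + y))\<^sup>2 \<le> (cmod x + cmod y)\<^sup>2" by (intro power_mono norm_triangle_ineq) simp
    also have "\<dots> = 2 * (cmod x)\<^sup>2 + 2 * (cmod y)\<^sup>2 - (cmod x - cmod y)\<^sup>2"
      by (simp add: power2_eq_square algebra_simps)
    finally show ?thesis using zero_le_power2[of "cmod x - cmod y"] by linarith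
  qed
  then have "(\<Sum>i<n. (cmod (a $ i + b $ i))\<^sup>2) \<le> (\<Sum>i<n. 2 * (cmod (a $ i))\<^sup>2 + 2 * (cmod (b $ i))\<^sup>2)"
    by (intro sum_mono)
  then show ?thesis using assms by (simp add: norm_sq_def sum.distrib sum_distrib_left)
qed

lemma transfer_function_mult_vec:
  assumes A: "A \<in> carrier_mat k k" and B: "B \<in> carrier_mat k m"
    and C: "C \<in> carrier_mat p k" and D: "D \<in> carrier_mat p m"
    and stable: "hurwitz A" and s: "0 \<le> Re s"
  shows "transfer_function A B C D s \<in> carrier_mat p m"
    and "u \<in> carrier_vec m \<Longrightarrow> transfer_function A B C D s *\<^sub>v u =
      complex_mat C *\<^sub>v (resolvent A s *\<^sub>v (complex_mat B *\<^sub>v u)) + complex_mat D *\<^sub>v u"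
proof -
  define b where "b = complex_mat B"
  define c where "c = complex_mat C"
  define d where "d = complex_mat D"
  define R where "R = resolvent A s"
  have b: "b \<in> carrier_mat k m" and c: "c \<in> carrier_mat p k" and d: "d \<in> carrier_mat p m"
    using B C D by (simp_all add: b_def c_def d_def)
  have R: "R \<in> carrier_mat k k" unfolding R_def by (rule resolvent_carrier[OF A stable s])
  have cR: "c * R \<in> carrier_mat p k" using c R by (rule mult_carrier_mat)
  have cRb: "c * R * b \<in> carrier_mat p m" using cR b by (rule mult_carrier_mat)
  have T: "transfer_function A B C D s = c * R * b + d"
    by (simp add: transfer_function_def b_def c_def d_def R_def)
  show "transfer_function A B C D s \<in> carrier_mat p m" unfolding T using cRb d by simp
  show "transfer_function A B C D s *\<^sub>v u =
      complex_mat C *\<^sub>v (resolvent A s *\<^sub>v (complex_mat B *\<^sub>v u)) + complex_mat D *\<^sub>v u"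
    if u: "u \<in> carrier_vec m"
  proof -
    have bu: "b *\<^sub>v u \<in> carrier_vec k" using b u by simp
    have "(c * R * b + d) *\<^sub>v u = (c * R * b) *\<^sub>v u + d *\<^sub>v u"
      by (rule add_mult_distrib_mat_vec[OF cRb d u])
    also have "(c * R * b) *\<^sub>v u = c *\<^sub>v (R *\<^sub>v (b *\<^sub>v u))"
      using assoc_mult_mat_vec[OF cR b u] assoc_mult_mat_vec[OF c R bu] by simp
    finally show ?thesis unfolding T b_def c_def d_def R_def .
  qed
qed

lemma hinf_norm_transfer_function:
  assumes A: "A \<in> carrier_mat k k" and B: "B \<in> carrier_mat k m"
    and C: "C \<in> carrier_mat p k" and D: "D \<in> carrier_mat p m"
    and stable: "hurwitz A" and k: "k > 0" and m: "m > 0"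
  shows "0 \<le> hinf_norm (transfer_function A B C D)"
    and "u \<in> carrier_vec m \<Longrightarrow>
      norm_sq (transfer_function A B C D (\<i> * complex_of_real \<omega>) *\<^sub>v u) \<le> (hinf_norm (transfer_function A B C D))\<^sup>2 * norm_sq u"
proof -
  let ?s = "\<lambda>\<omega>. \<i> * complex_of_real \<omega>"
  define \<phi> where "\<phi> = hinf_norm (\<lambda>s. resolvent A s * complex_mat B)"
  define c where "c = complex_mat C"
  define d where "d = complex_mat D"
  have c: "c \<in> carrier_mat p k" and d: "d \<in> carrier_mat p m" using C D by (simp_all add: c_def d_def)
  have T: "transfer_function A B C D (?s \<omega>) \<in> carrier_mat p m" for \<omega>
    by (rule transfer_function_mult_vec(1)[OF A B C D stable]) simp
  define K where "K = sqrt (2 * (spectral_norm c)\<^sup>2 * \<phi>\<^sup>2 + 2 * (spectral_norm d)\<^sup>2)"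
  have K: "0 \<le> K" by (simp add: K_def)
  have le: "norm_sq (transfer_function A B C D (?s \<omega>) *\<^sub>v u) \<le> K\<^sup>2 * norm_sq u" if u: "u \<in> carrier_vec m" for \<omega> u
  proof -
    define x where "x = resolvent A (?s \<omega>) *\<^sub>v (complex_mat B *\<^sub>v u)"
    have x: "x \<in> carrier_vec k" unfolding x_def
      by (rule mult_mat_vec_carrier[OF resolvent_carrier[OF A stable]]) (use B u in auto)
    have nx: "norm_sq x \<le> \<phi>\<^sup>2 * norm_sq u"
      unfolding x_def \<phi>_def by (rule hinf_norm_resolvent(2)[OF A stable k B m u])
    have "transfer_function A B C D (?s \<omega>) *\<^sub>v u = c *\<^sub>v x + d *\<^sub>v u"
      unfolding x_def c_def d_def by (rule transfer_function_mult_vec(2)[OF A B C D stable _ u]) simp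
    then have "norm_sq (transfer_function A B C D (?s \<omega>) *\<^sub>v u) \<le> 2 * norm_sq (c *\<^sub>v x) + 2 * norm_sq (d *\<^sub>v u)"
      using norm_sq_add_le[of "c *\<^sub>v x" p "d *\<^sub>v u"] c d x u by simp
    also have "\<dots> \<le> 2 * ((spectral_norm c)\<^sup>2 * (\<phi>\<^sup>2 * norm_sq u)) + 2 * ((spectral_norm d)\<^sup>2 * norm_sq u)"
      using norm_sq_mult_le_spectral_norm[OF c k x] norm_sq_mult_le_spectral_norm[OF d m u]
        mult_left_mono[OF nx, of "(spectral_norm c)\<^sup>2"] by simp
    also have "\<dots> = K\<^sup>2 * norm_sq u" by (simp add: K_def algebra_simps)
    finally show ?thesis .
  qed
  note b = hinf_norm_nonneg[where T = "transfer_function A B C D", OF T m K le]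
    norm_sq_le_hinf_norm[where T = "transfer_function A B C D", OF T m K le]
  show "0 \<le> hinf_norm (transfer_function A B C D)" by (rule b(1))
  show "norm_sq (transfer_function A B C D (?s \<omega>) *\<^sub>v u) \<le> (hinf_norm (transfer_function A B C D))\<^sup>2 * norm_sq u"
    if "u \<in> carrier_vec m" by (rule b(2)[OF _ that])
qed

lemma hurwitz_transpose:
  assumes F: "F \<in> carrier_mat n n" and "hurwitz F"
  shows "hurwitz (transpose_mat F)"
proof -
  have "char_poly (complex_mat (transpose_mat F)) = char_poly (complex_mat F)"
    using char_poly_transpose_mat[of "complex_mat F" n] F by (simp add: map_mat_transpose)
  then have "eigenvalue (complex_mat (transpose_mat F)) \<mu> \<longleftrightarrow> eigenvalue (complex_mat F) \<mu>" for \<mu>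
    using F by (simp add: eigenvalue_root_char_poly[of _ n])
  then show ?thesis using assms by (auto simp: hurwitz_def)
qed

lemma negative_form_hurwitz:
  assumes M: "M \<in> carrier_mat n n"
    and neg: "\<And>v. v \<in> carrier_vec n \<Longrightarrow> v \<noteq> 0\<^sub>v n \<Longrightarrow> Re ((complex_mat M *\<^sub>v v) \<bullet>c v) < 0"
  shows "hurwitz M"
  unfolding hurwitz_def
proof (intro conjI allI impI)
  show "square_mat M" using M by simp
  fix \<mu> assume "eigenvalue (complex_mat M) \<mu>"
  then obtain v where v: "v \<in> carrier_vec n" "v \<noteq> 0\<^sub>v n" and e: "complex_mat M *\<^sub>v v = \<mu> \<cdot>\<^sub>v v"
    using M unfolding eigenvalue_def eigenvector_def by auto
  have "(\<mu> \<cdot>\<^sub>v v) \<bullet>c v = \<mu> * (v \<bullet>c v)" using v by simp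
  also have "\<dots> = \<mu> * of_real (norm_sq v)" by (simp only: cscalar_prod_self)
  finally have eq: "(\<mu> \<cdot>\<^sub>v v) \<bullet>c v = \<mu> * of_real (norm_sq v)" .
  have "Re (\<mu> * complex_of_real (norm_sq v)) < 0" using neg[OF v] by (simp only: e eq)
  then have "Re \<mu> * norm_sq v < 0" by simp
  then show "Re \<mu> < 0" using norm_sq_pos[OF v] by (simp add: mult_less_0_iff)
qed

section \<open>Positive test vectors for the comparison system\<close>

lemma uniform_small_perturbation:
  fixes a b c :: "nat \<Rightarrow> real"
  assumes "\<And>l. l < m \<Longrightarrow> a l < c l"
  obtains \<epsilon> where "\<epsilon> > 0" "\<And>l. l < m \<Longrightarrow> a l + \<epsilon> * b l < c l"
proof -
  define \<epsilon> where "\<epsilon> = Min (insert 1 ((\<lambda>l. (c l - a l) / (2 * (\<bar>b l\<bar> + 1))) ` {..<m}))"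
  have "\<epsilon> > 0" unfolding \<epsilon>_def using assms by (subst Min_gr_iff) auto
  moreover have "a l + \<epsilon> * b l < c l" if l: "l < m" for l
  proof -
    have "\<epsilon> \<le> (c l - a l) / (2 * (\<bar>b l\<bar> + 1))" unfolding \<epsilon>_def using l by (intro Min_le) auto
    then have "\<epsilon> * (2 * (\<bar>b l\<bar> + 1)) \<le> c l - a l" by (simp add: pos_le_divide_eq)
    moreover have "\<epsilon> * b l \<le> \<epsilon> * \<bar>b l\<bar>" using \<open>\<epsilon> > 0\<close> by (intro mult_left_mono) auto
    moreover have "\<epsilon> * \<bar>b l\<bar> \<ge> 0" using \<open>\<epsilon> > 0\<close> by simp
    moreover have "\<epsilon> * (2 * (\<bar>b l\<bar> + 1)) = 2 * (\<epsilon> * \<bar>b l\<bar>) + 2 * \<epsilon>" by (simp add: algebra_simps)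
    ultimately show ?thesis using \<open>\<epsilon> > 0\<close> by linarith
  qed
  ultimately show ?thesis by (rule that)
qed

lemma nonneg_mult_mat_vec:
  fixes M :: "real mat"
  assumes "M \<in> carrier_mat a b" "v \<in> carrier_vec b" "i < a"
    and "\<And>i j. i < a \<Longrightarrow> j < b \<Longrightarrow> 0 \<le> M $$ (i, j)" "\<And>j. j < b \<Longrightarrow> 0 \<le> v $ j"
  shows "0 \<le> (M *\<^sub>v v) $ i"
  by (subst mult_mat_vec_index[OF assms(1-3)]) (use assms in \<open>auto intro!: sum_nonneg\<close>)

lemma hurwitz_negative_inverse:
  fixes F :: "real mat"
  assumes F: "F \<in> carrier_mat n n" and stable: "hurwitz F"
  obtains R where "R \<in> carrier_mat n n" "F * R = - 1\<^sub>m n" "R * F = - 1\<^sub>m n"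
proof -
  have Finj: "x = 0\<^sub>v n" if x: "x \<in> carrier_vec n" "F *\<^sub>v x = 0\<^sub>v n" for x
  proof (rule ccontr)
    assume nz: "x \<noteq> 0\<^sub>v n"
    define z where "z = map_vec complex_of_real x"
    have z: "z \<in> carrier_vec n" using x by (simp add: z_def)
    have "z \<noteq> 0\<^sub>v n"
    proof
      assume "z = 0\<^sub>v n"
      then have "z $ i = 0" if "i < n" for i using that by simp
      then have "x = 0\<^sub>v n" using x(1) by (intro eq_vecI) (auto simp: z_def)
      then show False using nz by simp
    qed
    moreover have "complex_mat F *\<^sub>v z = 0 \<cdot>\<^sub>v z"
      unfolding z_def complex_mat_mult_of_real[OF F x(1)] x(2) using x(1) by (intro eq_vecI) auto
    ultimately have "eigenvalue (complex_mat F) 0"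
      using z F unfolding eigenvalue_def eigenvector_def by auto
    from hurwitz_eigenvalue[OF stable this] show False by simp
  qed
  obtain Y where Y: "Y \<in> carrier_mat n n" and FY: "F * Y = 1\<^sub>m n" "Y * F = 1\<^sub>m n"
    using mat_inv_inverse[OF F Finj] by blast
  define R where "R = - Y"
  have R: "R \<in> carrier_mat n n" using Y by (simp add: R_def)
  have FRm: "F * R = - 1\<^sub>m n" "R * F = - 1\<^sub>m n"
    using F Y by (simp_all add: R_def uminus_mult_left_mat uminus_mult_right_mat FY)
  show ?thesis by (rule that[OF R FRm])
qed

lemma negative_inverse_mult:
  fixes M K :: "real mat"
  assumes MK: "M * K = - 1\<^sub>m n" and M: "M \<in> carrier_mat n n" and K: "K \<in> carrier_mat n n"
    and b: "b \<in> carrier_vec n" and i: "i < n"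
  shows "(M *\<^sub>v (K *\<^sub>v b)) $ i = - b $ i"
proof -
  have "M *\<^sub>v (K *\<^sub>v b) = (- 1\<^sub>m n) *\<^sub>v b"
    using assoc_mult_mat_vec[OF M K b] by (simp only: MK)
  then show ?thesis using b i by (simp add: uminus_mult_mat_vec del: assoc_mult_mat_vec)
qed

lemma metzler_negative_inverse_nonneg:
  fixes M K :: "real mat"
  assumes M: "M \<in> carrier_mat n n" and K: "K \<in> carrier_mat n n" and MK: "M * K = - 1\<^sub>m n"
    and metzler: "\<And>i j. i < n \<Longrightarrow> j < n \<Longrightarrow> i \<noteq> j \<Longrightarrow> 0 \<le> M $$ (i, j)"
    and \<zeta>: "\<And>i. i < n \<Longrightarrow> 0 < \<zeta> i" "\<And>i. i < n \<Longrightarrow> (\<Sum>j<n. M $$ (i, j) * \<zeta> j) < 0"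
    and b: "b \<in> carrier_vec n" "\<And>i. i < n \<Longrightarrow> 0 \<le> b $ i" and i: "i < n"
  shows "0 \<le> (K *\<^sub>v b) $ i"
proof (rule metzler_minimum_principle[where F = "\<lambda>i j. M $$ (i, j)" and s = 0 and \<xi> = \<zeta> and n = n])
  fix i assume i: "i < n"
  have "(\<Sum>j<n. M $$ (i, j) * (K *\<^sub>v b) $ j) = (M *\<^sub>v (K *\<^sub>v b)) $ i"
    by (rule mult_mat_vec_index[OF M _ i, symmetric]) (use K b in simp)
  then show "(\<Sum>j<n. M $$ (i, j) * (K *\<^sub>v b) $ j) \<le> 0 * (K *\<^sub>v b) $ i"
    using negative_inverse_mult[OF MK M K b(1) i] b(2)[OF i] by simp
qed (use metzler \<zeta> i in auto)

lemma metzler_negative_inverse_pos: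
  fixes M K :: "real mat"
  assumes M: "M \<in> carrier_mat n n" and K: "K \<in> carrier_mat n n" and MK: "M * K = - 1\<^sub>m n"
    and metzler: "\<And>i j. i < n \<Longrightarrow> j < n \<Longrightarrow> i \<noteq> j \<Longrightarrow> 0 \<le> M $$ (i, j)"
    and \<zeta>: "\<And>i. i < n \<Longrightarrow> 0 < \<zeta> i" "\<And>i. i < n \<Longrightarrow> (\<Sum>j<n. M $$ (i, j) * \<zeta> j) < 0"
    and b: "b \<in> carrier_vec n" "\<And>i. i < n \<Longrightarrow> 0 < b $ i" and i: "i < n"
  shows "0 < (K *\<^sub>v b) $ i"
proof (rule metzler_positive[where F = "\<lambda>i j. M $$ (i, j)" and s = 0 and \<xi> = \<zeta> and n = n])
  fix i assume i: "i < n"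
  have "(\<Sum>j<n. M $$ (i, j) * (K *\<^sub>v b) $ j) = (M *\<^sub>v (K *\<^sub>v b)) $ i"
    by (rule mult_mat_vec_index[OF M _ i, symmetric]) (use K b in simp)
  then show "(\<Sum>j<n. M $$ (i, j) * (K *\<^sub>v b) $ j) < 0 * (K *\<^sub>v b) $ i"
    using negative_inverse_mult[OF MK M K b(1) i] b(2)[OF i] by simp
qed (use metzler \<zeta> i in auto)

text \<open>\<open>H R G + J\<close> is the transfer function at frequency zero, so the H-infinity norm bounds its gain.\<close>

lemma static_gain:
  fixes F G H J R :: "real mat"
  assumes F: "F \<in> carrier_mat n n" and G: "G \<in> carrier_mat n m"
    and H: "H \<in> carrier_mat p n" and J: "J \<in> carrier_mat p m" and R: "R \<in> carrier_mat n n"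
    and n: "n > 0" and m: "m > 0" and stable: "hurwitz F" and FR: "F * R = - 1\<^sub>m n"
    and u: "u \<in> carrier_vec m"
  defines "T \<equiv> H * R * G + J"
  shows "norm_sq (complex_mat T *\<^sub>v u) \<le> (hinf_norm (transfer_function F G H J))\<^sup>2 * norm_sq u"
proof -
  have HR: "H * R \<in> carrier_mat p n" using H R by (rule mult_carrier_mat)
  have HRG: "H * R * G \<in> carrier_mat p m" using HR G by (rule mult_carrier_mat)
  define g where "g = complex_mat G *\<^sub>v u"
  have g: "g \<in> carrier_vec n" unfolding g_def by (rule mult_mat_vec_carrier[OF _ u]) (use G in simp)
  define r where "r = complex_mat R *\<^sub>v g"
  have r: "r \<in> carrier_vec n" unfolding r_def by (rule mult_mat_vec_carrier[OF _ g]) (use R in simp)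
  have cH: "complex_mat H \<in> carrier_mat p n" and cR: "complex_mat R \<in> carrier_mat n n"
    and cG: "complex_mat G \<in> carrier_mat n m" and cJ: "complex_mat J \<in> carrier_mat p m"
    and cF: "complex_mat F \<in> carrier_mat n n"
    using H R G J F by simp_all
  have "complex_mat F *\<^sub>v r = (complex_mat F * complex_mat R) *\<^sub>v g"
    unfolding r_def by (rule assoc_mult_mat_vec[OF cF cR g, symmetric])
  also have "complex_mat F * complex_mat R = complex_mat (- 1\<^sub>m n)"
    using of_real_hom.mat_hom_mult[OF F R, symmetric] by (simp only: FR)
  also have "complex_mat (- 1\<^sub>m n) = - 1\<^sub>m n" by (intro eq_matI) auto
  finally have "complex_mat F *\<^sub>v r = - g" using g by (simp add: uminus_mult_mat_vec)
  then have "complex_mat F *\<^sub>v r + g = 0 \<cdot>\<^sub>v r" using g r by (intro eq_vecI) auto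
  then have "r = resolvent F 0 *\<^sub>v g"
    by (intro resolvent_unique[OF F stable _ g r]) simp_all
  then have "transfer_function F G H J 0 *\<^sub>v u = complex_mat H *\<^sub>v r + complex_mat J *\<^sub>v u"
    using transfer_function_mult_vec(2)[OF F G H J stable _ u, of 0] by (simp add: g_def)
  also have "\<dots> = complex_mat T *\<^sub>v u"
  proof -
    have "complex_mat (X + Y) = complex_mat X + complex_mat Y"
      if "X \<in> carrier_mat p m" "Y \<in> carrier_mat p m" for X Y
      using that by (intro eq_matI) auto
    from this[OF HRG J] have "complex_mat T = complex_mat (H * R * G) + complex_mat J"
      unfolding T_def .
    then have "complex_mat T = complex_mat H * complex_mat R * complex_mat G + complex_mat J"
      unfolding of_real_hom.mat_hom_mult[OF HR G] of_real_hom.mat_hom_mult[OF H R] .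
    moreover have cHR: "complex_mat H * complex_mat R \<in> carrier_mat p n" using cH cR by (rule mult_carrier_mat)
    moreover have cHRG: "complex_mat H * complex_mat R * complex_mat G \<in> carrier_mat p m"
      using cHR cG by (rule mult_carrier_mat)
    ultimately show ?thesis
      using add_mult_distrib_mat_vec[OF cHRG cJ u] assoc_mult_mat_vec[OF cHR cG u]
        assoc_mult_mat_vec[OF cH cR g] by (simp only: g_def r_def)
  qed
  finally show ?thesis
    using hinf_norm_transfer_function(2)[OF F G H J stable n m u, of 0] by (simp add: T_def)
qed

text \<open>The form of this symmetric matrix is \<open>\<bar>T u\<bar>\<^sup>2 - \<delta>\<^sup>2 \<bar>u\<bar>\<^sup>2\<close>, which is negative definite.\<close>

lemma gram_minus_scalar_hurwitz:
  fixes T :: "real mat"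
  assumes T: "T \<in> carrier_mat p m" and \<gamma>: "0 \<le> \<gamma>" "\<gamma> < \<delta>"
    and gainT: "\<And>u. u \<in> carrier_vec m \<Longrightarrow> norm_sq (complex_mat T *\<^sub>v u) \<le> \<gamma>\<^sup>2 * norm_sq u"
  shows "hurwitz (transpose_mat T * T - \<delta>\<^sup>2 \<cdot>\<^sub>m 1\<^sub>m m)"
proof -
  have Tt: "transpose_mat T \<in> carrier_mat m p" using T by simp
  define K where "K = transpose_mat T * T - \<delta>\<^sup>2 \<cdot>\<^sub>m 1\<^sub>m m"
  have TT: "transpose_mat T * T \<in> carrier_mat m m" using Tt T by (rule mult_carrier_mat)
  have K: "K \<in> carrier_mat m m" unfolding K_def by (intro minus_carrier_mat) simp
  have "hurwitz K"
  proof (rule negative_form_hurwitz[OF K])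
    fix u :: "complex vec" assume u: "u \<in> carrier_vec m" "u \<noteq> 0\<^sub>v m"
    define X where "X = complex_mat T"
    have X: "X \<in> carrier_mat p m" using T by (simp add: X_def)
    have aX: "mat_adjoint X \<in> carrier_mat m p" using X by (rule mat_adjoint_carrier)
    have XX: "mat_adjoint X * X \<in> carrier_mat m m" using aX X by (rule mult_carrier_mat)
    have cK: "complex_mat K = mat_adjoint X * X - complex_of_real (\<delta>\<^sup>2) \<cdot>\<^sub>m 1\<^sub>m m"
    proof -
      have "mat_adjoint X * X = complex_mat (transpose_mat T * T)"
        unfolding X_def mat_adjoint_complex_mat by (rule of_real_hom.mat_hom_mult[OF Tt T, symmetric])
      then show ?thesis unfolding K_def using TT by (intro eq_matI) auto
    qed
    have cKu: "complex_mat K *\<^sub>v u = (mat_adjoint X * X) *\<^sub>v u - complex_of_real (\<delta>\<^sup>2) \<cdot>\<^sub>v u"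
      unfolding cK
      by (subst minus_mult_distrib_mat_vec[OF XX _ u(1)]) (simp_all only: scalar_mat_mult_vec[OF u(1)] smult_carrier_mat one_carrier_mat)
    have w: "(mat_adjoint X * X) *\<^sub>v u \<in> carrier_vec m" using XX u(1) by (rule mult_mat_vec_carrier)
    have "(complex_mat K *\<^sub>v u) \<bullet>c u =
        ((mat_adjoint X * X) *\<^sub>v u) \<bullet>c u - (complex_of_real (\<delta>\<^sup>2) \<cdot>\<^sub>v u) \<bullet>c u"
      unfolding cKu by (rule minus_scalar_prod_distrib[OF w]) (use u in auto)
    also have "((mat_adjoint X * X) *\<^sub>v u) \<bullet>c u = of_real (norm_sq (X *\<^sub>v u))"
      using cscalar_prod_commute[OF u(1) w] gram_form[OF X u(1)] by simp
    also have "(complex_of_real (\<delta>\<^sup>2) \<cdot>\<^sub>v u) \<bullet>c u = complex_of_real (\<delta>\<^sup>2) * (u \<bullet>c u)" using u by simp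
    also have "u \<bullet>c u = of_real (norm_sq u)" by (rule cscalar_prod_self)
    finally have "(complex_mat K *\<^sub>v u) \<bullet>c u = of_real (norm_sq (X *\<^sub>v u)) - complex_of_real (\<delta>\<^sup>2) * of_real (norm_sq u)" .
    then have "Re ((complex_mat K *\<^sub>v u) \<bullet>c u) = norm_sq (X *\<^sub>v u) - \<delta>\<^sup>2 * norm_sq u"
      by (simp del: of_real_power)
    also have "\<dots> \<le> (\<gamma>\<^sup>2 - \<delta>\<^sup>2) * norm_sq u" using gainT[OF u(1)] by (simp add: X_def left_diff_distrib)
    also have "\<dots> < 0"
      using norm_sq_pos[OF u] power_strict_mono[of \<gamma> \<delta> 2] \<gamma> by (simp add: mult_less_0_iff)
    finally show "Re ((complex_mat K *\<^sub>v u) \<bullet>c u) < 0" .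
  qed
  then show ?thesis by (simp only: K_def)
qed

text \<open>The negative inverse \<open>R\<close> of the Hurwitz Metzler matrix \<open>F\<close> is nonnegative, hence so is the static gain
\<open>T = H R G + J\<close>, and \<open>T\<^sup>T T - \<delta>\<^sup>2 I\<close> is a Hurwitz Metzler matrix. A positive \<open>v\<close> with \<open>T\<^sup>T T v < \<delta>\<^sup>2 v\<close>
follows. The vectors \<open>\<xi> = R (G v + \<epsilon> 1)\<close> and \<open>\<eta> = R\<^sup>T (H\<^sup>T y + \<epsilon> 1)\<close> make the first two inequalities
strict, and the third one becomes \<open>T\<^sup>T T v < \<delta>\<^sup>2 v\<close> as \<open>\<epsilon>\<close> tends to zero.\<close>

lemma comparison_vectors:
  fixes F G H J :: "real mat"
  assumes F: "F \<in> carrier_mat n n" and G: "G \<in> carrier_mat n m"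
    and H: "H \<in> carrier_mat p n" and J: "J \<in> carrier_mat p m"
    and n: "n > 0" and m: "m > 0" and stable: "hurwitz F"
    and metzler: "\<And>i j. i < n \<Longrightarrow> j < n \<Longrightarrow> i \<noteq> j \<Longrightarrow> 0 \<le> F $$ (i, j)"
    and G0: "\<And>i j. i < n \<Longrightarrow> j < m \<Longrightarrow> 0 \<le> G $$ (i, j)"
    and H0: "\<And>i j. i < p \<Longrightarrow> j < n \<Longrightarrow> 0 \<le> H $$ (i, j)"
    and J0: "\<And>i j. i < p \<Longrightarrow> j < m \<Longrightarrow> 0 \<le> J $$ (i, j)"
    and gain: "hinf_norm (transfer_function F G H J) < \<delta>"
  obtains \<xi> \<eta> v y where
    "\<And>i. i < n \<Longrightarrow> 0 < \<xi> i" "\<And>i. i < n \<Longrightarrow> 0 < \<eta> i" "\<And>l. l < m \<Longrightarrow> 0 < v l"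
    "\<And>q. q < p \<Longrightarrow> y q = (\<Sum>j<n. H $$ (q, j) * \<xi> j) + (\<Sum>l<m. J $$ (q, l) * v l)"
    "\<And>i. i < n \<Longrightarrow> (\<Sum>j<n. F $$ (i, j) * \<xi> j) + (\<Sum>l<m. G $$ (i, l) * v l) < 0"
    "\<And>j. j < n \<Longrightarrow> (\<Sum>i<n. F $$ (i, j) * \<eta> i) + (\<Sum>q<p. H $$ (q, j) * y q) < 0"
    "\<And>l. l < m \<Longrightarrow> (\<Sum>i<n. G $$ (i, l) * \<eta> i) + (\<Sum>q<p. J $$ (q, l) * y q) < \<delta>\<^sup>2 * v l"
proof -
  define \<gamma> where "\<gamma> = hinf_norm (transfer_function F G H J)"
  have \<gamma>: "0 \<le> \<gamma>" unfolding \<gamma>_def by (rule hinf_norm_transfer_function(1)[OF F G H J stable n m])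
  obtain R where R: "R \<in> carrier_mat n n" and FRm: "F * R = - 1\<^sub>m n" "R * F = - 1\<^sub>m n"
    by (rule hurwitz_negative_inverse[OF F stable])
  let ?Ft = "transpose_mat F" and ?Rt = "transpose_mat R"
  have Ft: "?Ft \<in> carrier_mat n n" and Rt: "?Rt \<in> carrier_mat n n" using F R by simp_all
  have FRtm: "?Ft * ?Rt = - 1\<^sub>m n"
  proof -
    have "?Ft * ?Rt = transpose_mat (R * F)" by (rule transpose_mult[OF R F, symmetric])
    also have "\<dots> = - 1\<^sub>m n" unfolding FRm by (intro eq_matI) auto
    finally show ?thesis .
  qed
  note FR = negative_inverse_mult[OF FRm(1) F R] and FRt = negative_inverse_mult[OF FRtm Ft Rt]
  have metzler': "0 \<le> ?Ft $$ (i, j)" if "i < n" "j < n" "i \<noteq> j" for i j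
    using metzler[of j i] that F by auto
  obtain \<xi>s where \<xi>s: "\<And>i. i < n \<Longrightarrow> 0 < \<xi>s i" "\<And>i. i < n \<Longrightarrow> (\<Sum>j<n. F $$ (i, j) * \<xi>s j) < 0"
    using metzler_hurwitz_subsolution[OF F stable n metzler] by blast
  obtain \<eta>s where \<eta>s: "\<And>i. i < n \<Longrightarrow> 0 < \<eta>s i" "\<And>i. i < n \<Longrightarrow> (\<Sum>j<n. ?Ft $$ (i, j) * \<eta>s j) < 0"
    using metzler_hurwitz_subsolution[OF Ft hurwitz_transpose[OF F stable] n metzler'] by blast
  have Rnn: "0 \<le> (R *\<^sub>v b) $ i"
    if "b \<in> carrier_vec n" "\<And>i. i < n \<Longrightarrow> 0 \<le> b $ i" "i < n" for b i
    by (rule metzler_negative_inverse_nonneg[OF F R FRm(1) metzler \<xi>s that])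
  have Rpos: "0 < (R *\<^sub>v b) $ i"
    if "b \<in> carrier_vec n" "\<And>i. i < n \<Longrightarrow> 0 < b $ i" "i < n" for b i
    by (rule metzler_negative_inverse_pos[OF F R FRm(1) metzler \<xi>s that])
  have Rtnn: "0 \<le> (?Rt *\<^sub>v b) $ i"
    if "b \<in> carrier_vec n" "\<And>i. i < n \<Longrightarrow> 0 \<le> b $ i" "i < n" for b i
    by (rule metzler_negative_inverse_nonneg[OF Ft Rt FRtm metzler' \<eta>s that])
  have Rtpos: "0 < (?Rt *\<^sub>v b) $ i"
    if "b \<in> carrier_vec n" "\<And>i. i < n \<Longrightarrow> 0 < b $ i" "i < n" for b i
    by (rule metzler_negative_inverse_pos[OF Ft Rt FRtm metzler' \<eta>s that])
  define T where "T = H * R * G + J"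
  have HR: "H * R \<in> carrier_mat p n" using H R by (rule mult_carrier_mat)
  have HRG: "H * R * G \<in> carrier_mat p m" using HR G by (rule mult_carrier_mat)
  have T: "T \<in> carrier_mat p m" using HRG J by (simp add: T_def)
  have Tv: "T *\<^sub>v u = H *\<^sub>v (R *\<^sub>v (G *\<^sub>v u)) + J *\<^sub>v u" if u: "u \<in> carrier_vec m" for u
  proof -
    have Gu: "G *\<^sub>v u \<in> carrier_vec n" using G u by simp
    have "T *\<^sub>v u = (H * R * G) *\<^sub>v u + J *\<^sub>v u"
      unfolding T_def by (rule add_mult_distrib_mat_vec[OF HRG J u])
    then show ?thesis
      using assoc_mult_mat_vec[OF HR G u] assoc_mult_mat_vec[OF H R Gu] by simp
  qed
  have T0: "0 \<le> T $$ (q, l)" if q: "q < p" and l: "l < m" for q l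
  proof -
    define u :: "real vec" where "u = unit_vec m l"
    have u: "u \<in> carrier_vec m" and u0: "\<And>i. i < m \<Longrightarrow> 0 \<le> u $ i"
      using l by (auto simp: u_def unit_vec_def)
    have Gu: "G *\<^sub>v u \<in> carrier_vec n" using G u by simp
    have RGu: "R *\<^sub>v (G *\<^sub>v u) \<in> carrier_vec n" using R Gu by simp
    have "T $$ (q, l) = (T *\<^sub>v u) $ q"
      using T q l by (simp add: u_def)
    also have "\<dots> = (H *\<^sub>v (R *\<^sub>v (G *\<^sub>v u))) $ q + (J *\<^sub>v u) $ q"
      unfolding Tv[OF u] using J q by (simp del: index_mult_mat_vec)
    also have "\<dots> \<ge> 0"
      by (intro add_nonneg_nonneg nonneg_mult_mat_vec[OF H RGu q] nonneg_mult_mat_vec[OF J u q] H0 J0 u0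
          Rnn[OF Gu] nonneg_mult_mat_vec[OF G u] G0)
    finally show ?thesis .
  qed
  have gainT: "norm_sq (complex_mat T *\<^sub>v u) \<le> \<gamma>\<^sup>2 * norm_sq u" if "u \<in> carrier_vec m" for u
    unfolding \<gamma>_def T_def by (rule static_gain[OF F G H J R n m stable FRm(1) that])
  have Tt: "transpose_mat T \<in> carrier_mat m p" using T by simp
  define K where "K = transpose_mat T * T - \<delta>\<^sup>2 \<cdot>\<^sub>m 1\<^sub>m m"
  have TT: "transpose_mat T * T \<in> carrier_mat m m" using Tt T by (rule mult_carrier_mat)
  have K: "K \<in> carrier_mat m m" unfolding K_def by (intro minus_carrier_mat) simp
  have Kv: "(K *\<^sub>v u) $ l = (transpose_mat T *\<^sub>v (T *\<^sub>v u)) $ l - \<delta>\<^sup>2 * u $ l"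
    if u: "u \<in> carrier_vec m" and l: "l < m" for u l
  proof -
    have "K *\<^sub>v u = (transpose_mat T * T) *\<^sub>v u - (\<delta>\<^sup>2 \<cdot>\<^sub>m 1\<^sub>m m) *\<^sub>v u"
      unfolding K_def by (rule minus_mult_distrib_mat_vec[OF TT _ u]) simp
    also have "\<dots> = transpose_mat T *\<^sub>v (T *\<^sub>v u) - \<delta>\<^sup>2 \<cdot>\<^sub>v u"
      by (simp only: scalar_mat_mult_vec[OF u] assoc_mult_mat_vec[OF Tt T u])
    finally show ?thesis using u l Tt by (simp del: index_mult_mat_vec)
  qed
  have "hurwitz K"
    unfolding K_def
    by (rule gram_minus_scalar_hurwitz[OF T \<gamma> _ gainT]) (use gain in \<open>simp_all add: \<gamma>_def\<close>)
  moreover have "0 \<le> K $$ (i, j)" if "i < m" "j < m" "i \<noteq> j" for i j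
  proof -
    have "K $$ (i, j) = (\<Sum>q<p. T $$ (q, i) * T $$ (q, j))"
      using that T by (simp add: K_def scalar_prod_def lessThan_atLeast0)
    then show ?thesis using T0 that by (auto intro!: sum_nonneg)
  qed
  ultimately obtain v where v: "\<And>l. l < m \<Longrightarrow> 0 < v l" "\<And>l. l < m \<Longrightarrow> (\<Sum>j<m. K $$ (l, j) * v j) < 0"
    using metzler_hurwitz_subsolution[OF K _ m] by blast
  define vv where "vv = vec m v"
  have vv: "vv \<in> carrier_vec m" by (simp add: vv_def)
  have vvi: "vv $ l = v l" if "l < m" for l using that by (simp add: vv_def)
  let ?o = "vec n (\<lambda>_. 1) :: real vec"
  let ?Ht = "transpose_mat H" and ?Gt = "transpose_mat G" and ?Jt = "transpose_mat J"
  have Ht: "?Ht \<in> carrier_mat n p" and Gt: "?Gt \<in> carrier_mat m n" and Jt: "?Jt \<in> carrier_mat m p"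
    using H G J by simp_all
  \<comment> \<open>index \<open>0\<close>: the vectors for \<open>\<epsilon> = 0\<close>; index \<open>1\<close>: their increments per unit of \<open>\<epsilon>\<close>\<close>
  define g where "g = G *\<^sub>v vv"
  define \<xi>0 where "\<xi>0 = R *\<^sub>v g"
  define \<xi>1 where "\<xi>1 = R *\<^sub>v ?o"
  define y0 where "y0 = H *\<^sub>v \<xi>0 + J *\<^sub>v vv"
  define y1 where "y1 = H *\<^sub>v \<xi>1"
  define h0 where "h0 = ?Ht *\<^sub>v y0"
  define h1 where "h1 = ?Ht *\<^sub>v y1 + ?o"
  define \<eta>0 where "\<eta>0 = ?Rt *\<^sub>v h0"
  define \<eta>1 where "\<eta>1 = ?Rt *\<^sub>v h1"
  have g: "g \<in> carrier_vec n" unfolding g_def using G vv by (rule mult_mat_vec_carrier)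
  have \<xi>0: "\<xi>0 \<in> carrier_vec n" unfolding \<xi>0_def using R g by (rule mult_mat_vec_carrier)
  have \<xi>1: "\<xi>1 \<in> carrier_vec n" unfolding \<xi>1_def by (rule mult_mat_vec_carrier[OF R]) simp
  have y0: "y0 \<in> carrier_vec p" unfolding y0_def using H J \<xi>0 vv by simp
  have y1: "y1 \<in> carrier_vec p" unfolding y1_def using H \<xi>1 by simp
  have h0: "h0 \<in> carrier_vec n" unfolding h0_def using Ht y0 by (rule mult_mat_vec_carrier)
  have Hty1: "?Ht *\<^sub>v y1 \<in> carrier_vec n" using Ht y1 by (rule mult_mat_vec_carrier)
  have h1: "h1 \<in> carrier_vec n" unfolding h1_def using Hty1 by simp
  have \<eta>0: "\<eta>0 \<in> carrier_vec n" unfolding \<eta>0_def using Rt h0 by (rule mult_mat_vec_carrier)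
  have \<eta>1: "\<eta>1 \<in> carrier_vec n" unfolding \<eta>1_def using Rt h1 by (rule mult_mat_vec_carrier)
  have y0i: "y0 $ q = (H *\<^sub>v \<xi>0) $ q + (J *\<^sub>v vv) $ q" if "q < p" for q
    unfolding y0_def using that J by (simp del: index_mult_mat_vec)
  have g0: "0 \<le> g $ i" if "i < n" for i
    unfolding g_def by (rule nonneg_mult_mat_vec[OF G vv that G0]) (use v vvi in \<open>auto intro: less_imp_le\<close>)
  have \<xi>0nn: "0 \<le> \<xi>0 $ i" if "i < n" for i unfolding \<xi>0_def by (rule Rnn[OF g g0 that])
  have \<xi>1pos: "0 < \<xi>1 $ i" if "i < n" for i unfolding \<xi>1_def by (rule Rpos) (use that in auto)
  have y0nn: "0 \<le> y0 $ q" if q: "q < p" for q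
    unfolding y0i[OF q]
    by (intro add_nonneg_nonneg nonneg_mult_mat_vec[OF H \<xi>0 q] nonneg_mult_mat_vec[OF J vv q] H0 J0 \<xi>0nn)
      (use v vvi in \<open>auto intro: less_imp_le\<close>)
  have y1nn: "0 \<le> y1 $ q" if q: "q < p" for q
    unfolding y1_def by (rule nonneg_mult_mat_vec[OF H \<xi>1 q H0]) (use \<xi>1pos in \<open>auto intro: less_imp_le\<close>)
  have Htnn: "0 \<le> ?Ht $$ (j, q)" if "j < n" "q < p" for j q using H0 that H by simp
  have h0nn: "0 \<le> h0 $ i" if i: "i < n" for i
    unfolding h0_def by (rule nonneg_mult_mat_vec[OF Ht y0 i Htnn y0nn])
  have h1i: "h1 $ i = (?Ht *\<^sub>v y1) $ i + 1" if "i < n" for i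
    unfolding h1_def using that by (simp del: index_mult_mat_vec)
  have h1pos: "0 < h1 $ i" if i: "i < n" for i
    unfolding h1i[OF i] using nonneg_mult_mat_vec[OF Ht y1 i Htnn y1nn] by simp
  have \<eta>0nn: "0 \<le> \<eta>0 $ i" if "i < n" for i unfolding \<eta>0_def by (rule Rtnn[OF h0 h0nn that])
  have \<eta>1pos: "0 < \<eta>1 $ i" if "i < n" for i unfolding \<eta>1_def by (rule Rtpos[OF h1 h1pos that])
  define a where "a l = (?Gt *\<^sub>v \<eta>0) $ l + (?Jt *\<^sub>v y0) $ l" for l
  define b where "b l = (?Gt *\<^sub>v \<eta>1) $ l + (?Jt *\<^sub>v y1) $ l" for l
  have "a l < \<delta>\<^sup>2 * v l" if l: "l < m" for l
  proof -
    have Tvv: "T *\<^sub>v vv = y0" unfolding Tv[OF vv] y0_def \<xi>0_def g_def ..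
    have TtE: "transpose_mat T = ?Gt * (?Rt * ?Ht) + ?Jt"
      unfolding T_def transpose_add[OF HRG J] transpose_mult[OF HR G] transpose_mult[OF H R] ..
    have RtHt: "?Rt * ?Ht \<in> carrier_mat n p" using Rt Ht by (rule mult_carrier_mat)
    have GRH: "?Gt * (?Rt * ?Ht) \<in> carrier_mat m p" using Gt RtHt by (rule mult_carrier_mat)
    have "transpose_mat T *\<^sub>v y0 = ?Gt *\<^sub>v \<eta>0 + ?Jt *\<^sub>v y0"
      unfolding TtE add_mult_distrib_mat_vec[OF GRH Jt y0] assoc_mult_mat_vec[OF Gt RtHt y0]
        assoc_mult_mat_vec[OF Rt Ht y0] \<eta>0_def h0_def ..
    then have "(transpose_mat T *\<^sub>v (T *\<^sub>v vv)) $ l = a l"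
      unfolding Tvv a_def using l Jt by (simp del: index_mult_mat_vec)
    moreover have "(K *\<^sub>v vv) $ l < 0"
      unfolding mult_mat_vec_index[OF K vv l] using v(2)[OF l] by (simp add: vv_def)
    ultimately show ?thesis using Kv[OF vv l] vvi[OF l] by simp
  qed
  then obtain \<epsilon> where \<epsilon>: "\<epsilon> > 0" and small: "\<And>l. l < m \<Longrightarrow> a l + \<epsilon> * b l < \<delta>\<^sup>2 * v l"
    using uniform_small_perturbation[of m a "\<lambda>l. \<delta>\<^sup>2 * v l" b] by blast
  have lin: "(\<Sum>j<c. M $$ (i, j) * (x $ j + \<epsilon> * z $ j)) = (M *\<^sub>v x) $ i + \<epsilon> * (M *\<^sub>v z) $ i"
    if M: "M \<in> carrier_mat r c" and x: "x \<in> carrier_vec c" and z: "z \<in> carrier_vec c" and i: "i < r"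
    for M :: "real mat" and r c x z i
    unfolding mult_mat_vec_index[OF M x i] mult_mat_vec_index[OF M z i]
    by (simp add: sum_distrib_left sum.distrib algebra_simps)
  have lint: "(\<Sum>j<c. M $$ (j, i) * (x $ j + \<epsilon> * z $ j)) = (transpose_mat M *\<^sub>v x) $ i + \<epsilon> * (transpose_mat M *\<^sub>v z) $ i"
    if M: "M \<in> carrier_mat c r" and x: "x \<in> carrier_vec c" and z: "z \<in> carrier_vec c" and i: "i < r"
    for M :: "real mat" and r c x z i
  proof -
    have Mt: "transpose_mat M \<in> carrier_mat r c" using M by simp
    have "(\<Sum>j<c. M $$ (j, i) * (x $ j + \<epsilon> * z $ j)) = (\<Sum>j<c. transpose_mat M $$ (i, j) * (x $ j + \<epsilon> * z $ j))"
      using M i by (intro sum.cong) auto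
    then show ?thesis using lin[OF Mt x z i] by simp
  qed
  have vsum: "(\<Sum>l<m. M $$ (i, l) * v l) = (M *\<^sub>v vv) $ i" if "M \<in> carrier_mat r m" "i < r" for M r i
    unfolding mult_mat_vec_index[OF that(1) vv that(2)] by (simp add: vv_def)
  show ?thesis
  proof (rule that[of "\<lambda>i. \<xi>0 $ i + \<epsilon> * \<xi>1 $ i" "\<lambda>i. \<eta>0 $ i + \<epsilon> * \<eta>1 $ i" v "\<lambda>q. y0 $ q + \<epsilon> * y1 $ q"])
    show "0 < \<xi>0 $ i + \<epsilon> * \<xi>1 $ i" "0 < \<eta>0 $ i + \<epsilon> * \<eta>1 $ i" if "i < n" for i
      using \<epsilon> that \<xi>0nn \<xi>1pos \<eta>0nn \<eta>1pos by (auto intro!: add_nonneg_pos)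
    show "0 < v l" if "l < m" for l using v(1) that .
    show "y0 $ q + \<epsilon> * y1 $ q = (\<Sum>j<n. H $$ (q, j) * (\<xi>0 $ j + \<epsilon> * \<xi>1 $ j)) + (\<Sum>l<m. J $$ (q, l) * v l)"
      if q: "q < p" for q
      unfolding lin[OF H \<xi>0 \<xi>1 q] vsum[OF J q] y0i[OF q] y1_def by simp
    show "(\<Sum>j<n. F $$ (i, j) * (\<xi>0 $ j + \<epsilon> * \<xi>1 $ j)) + (\<Sum>l<m. G $$ (i, l) * v l) < 0"
      if i: "i < n" for i
    proof -
      have "(F *\<^sub>v \<xi>0) $ i = - g $ i" unfolding \<xi>0_def by (rule FR[OF g i])
      moreover have "(F *\<^sub>v \<xi>1) $ i = - 1" unfolding \<xi>1_def using FR[of ?o i] i by simp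
      ultimately show ?thesis
        unfolding lin[OF F \<xi>0 \<xi>1 i] vsum[OF G i] g_def[symmetric] using \<epsilon> by simp
    qed
    show "(\<Sum>i<n. F $$ (i, j) * (\<eta>0 $ i + \<epsilon> * \<eta>1 $ i)) + (\<Sum>q<p. H $$ (q, j) * (y0 $ q + \<epsilon> * y1 $ q)) < 0"
      if j: "j < n" for j
    proof -
      have e0: "(?Ft *\<^sub>v \<eta>0) $ j = - (?Ht *\<^sub>v y0) $ j"
        unfolding \<eta>0_def using FRt[OF h0 j] by (simp only: h0_def)
      have e1: "(?Ft *\<^sub>v \<eta>1) $ j = - ((?Ht *\<^sub>v y1) $ j + 1)"
        unfolding \<eta>1_def using FRt[OF h1 j] by (simp only: h1i[OF j])
      show ?thesis
        unfolding lint[OF F \<eta>0 \<eta>1 j] lint[OF H y0 y1 j] e0 e1 using \<epsilon>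
        by (simp add: algebra_simps del: index_mult_mat_vec)
    qed
    show "(\<Sum>i<n. G $$ (i, l) * (\<eta>0 $ i + \<epsilon> * \<eta>1 $ i)) + (\<Sum>q<p. J $$ (q, l) * (y0 $ q + \<epsilon> * y1 $ q)) < \<delta>\<^sup>2 * v l"
      if l: "l < m" for l
      unfolding lint[OF G \<eta>0 \<eta>1 l] lint[OF J y0 y1 l] using small[OF l]
      by (simp add: a_def b_def algebra_simps del: index_mult_mat_vec)
  qed
qed

section \<open>Dissipation in a single block\<close>

text \<open>A vanishing weight contributes \<open>0\<close> to the right-hand side, by \<open>x / 0 = 0\<close>; this is harmless because the
corresponding \<open>r j\<close> vanishes as well.\<close>

lemma weighted_cauchy:
  fixes r \<alpha> :: "'j \<Rightarrow> real"
  assumes "finite S" and "\<And>j. j \<in> S \<Longrightarrow> 0 \<le> \<alpha> j" and "\<And>j. j \<in> S \<Longrightarrow> \<alpha> j = 0 \<Longrightarrow> r j = 0"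
  shows "(\<Sum>j\<in>S. r j)\<^sup>2 \<le> (\<Sum>j\<in>S. \<alpha> j) * (\<Sum>j\<in>S. (r j)\<^sup>2 / \<alpha> j)"
  using assms
proof (induction S)
  case empty
  then show ?case by simp
next
  case (insert j S)
  define s where "s = (\<Sum>j\<in>S. r j)"
  define a where "a = (\<Sum>j\<in>S. \<alpha> j)"
  define b where "b = (\<Sum>j\<in>S. (r j)\<^sup>2 / \<alpha> j)"
  have ih: "s\<^sup>2 \<le> a * b" unfolding s_def a_def b_def using insert by auto
  have a: "0 \<le> a" unfolding a_def using insert by (auto intro: sum_nonneg)
  have b: "0 \<le> b" unfolding b_def using insert by (auto intro!: sum_nonneg divide_nonneg_nonneg)
  have \<alpha>: "0 \<le> \<alpha> j" "\<alpha> j = 0 \<Longrightarrow> r j = 0" using insert by auto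
  have "(r j + s)\<^sup>2 \<le> (\<alpha> j + a) * ((r j)\<^sup>2 / \<alpha> j + b)"
  proof (cases "\<alpha> j = 0 \<or> a = 0")
    case True
    then show ?thesis
    proof
      assume "\<alpha> j = 0"
      then show ?thesis using \<alpha> ih by simp
    next
      assume a0: "a = 0"
      then have "s = 0" using ih by simp
      moreover have "(r j)\<^sup>2 \<le> \<alpha> j * ((r j)\<^sup>2 / \<alpha> j)" using \<alpha> by (cases "\<alpha> j = 0") auto
      moreover have "0 \<le> \<alpha> j * b" using \<alpha> b by simp
      ultimately show ?thesis using a0 by (simp add: distrib_left)
    qed
  next
    case False
    then have p: "\<alpha> j > 0" "a > 0" using \<alpha> a by auto
    have "0 \<le> (\<alpha> j * s - a * r j)\<^sup>2 / (\<alpha> j * a)" using p by simp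
    also have "\<dots> = \<alpha> j * (s\<^sup>2 / a) + a * ((r j)\<^sup>2 / \<alpha> j) - 2 * (r j * s)"
      using p by (simp add: power2_eq_square field_simps)
    also have "s\<^sup>2 / a \<le> b" using ih p by (simp add: field_simps)
    finally have "2 * (r j * s) \<le> \<alpha> j * b + a * ((r j)\<^sup>2 / \<alpha> j)" using p by simp
    moreover have "(\<alpha> j + a) * ((r j)\<^sup>2 / \<alpha> j + b) = (r j)\<^sup>2 + a * b + (\<alpha> j * b + a * ((r j)\<^sup>2 / \<alpha> j))"
      using p by (simp add: distrib_left distrib_right add_divide_distrib)
    ultimately show ?thesis using ih by (simp add: power2_sum)
  qed
  then show ?case using insert by (simp add: s_def a_def b_def)
qed

text \<open>Cauchy-Schwarz with the weights \<open>\<phi> j * \<chi> j\<close>. It passes from a sum of gains to a sum of squares, and the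
test vector \<open>\<chi>\<close> is what makes this passage lossless for the comparison system.\<close>

lemma norm_sq_sum_le_weighted:
  fixes z :: "'j \<Rightarrow> complex vec" and \<phi> \<chi> a :: "'j \<Rightarrow> real"
  assumes S: "finite S" and z: "\<And>j. j \<in> S \<Longrightarrow> z j \<in> carrier_vec k"
    and x: "x \<in> carrier_vec k" "\<And>r. r < k \<Longrightarrow> x $ r = (\<Sum>j\<in>S. z j $ r)"
    and \<phi>: "\<And>j. j \<in> S \<Longrightarrow> 0 \<le> \<phi> j" and \<chi>: "\<And>j. j \<in> S \<Longrightarrow> 0 < \<chi> j"
    and gain: "\<And>j. j \<in> S \<Longrightarrow> norm_sq (z j) \<le> (\<phi> j)\<^sup>2 * a j"
  shows "norm_sq x \<le> (\<Sum>j\<in>S. \<phi> j * \<chi> j) * (\<Sum>j\<in>S. \<phi> j * a j / \<chi> j)"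
proof -
  define \<theta> where "\<theta> = (\<Sum>j\<in>S. \<phi> j * \<chi> j)"
  have \<theta>: "0 \<le> \<theta>" unfolding \<theta>_def using \<phi> \<chi> by (intro sum_nonneg mult_nonneg_nonneg) (auto intro: less_imp_le)
  have le: "(cmod (x $ r))\<^sup>2 \<le> \<theta> * (\<Sum>j\<in>S. (cmod (z j $ r))\<^sup>2 / (\<phi> j * \<chi> j))" if r: "r < k" for r
  proof -
    have zr: "cmod (z j $ r) = 0" if j: "j \<in> S" and 0: "\<phi> j * \<chi> j = 0" for j
    proof -
      have "\<phi> j = 0" using 0 \<chi>[OF j] by simp
      then have "norm_sq (z j) = 0" using gain[OF j] norm_sq_nonneg[of "z j"] by simp
      then have "z j = 0\<^sub>v k" using norm_sq_eq_0_iff[OF z[OF j]] by simp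
      then show ?thesis using r by simp
    qed
    have "(cmod (x $ r))\<^sup>2 \<le> (\<Sum>j\<in>S. cmod (z j $ r))\<^sup>2"
      unfolding x(2)[OF r] by (intro power_mono norm_sum) simp
    also have "\<dots> \<le> \<theta> * (\<Sum>j\<in>S. (cmod (z j $ r))\<^sup>2 / (\<phi> j * \<chi> j))"
      unfolding \<theta>_def
      by (rule weighted_cauchy[OF S]) (simp_all only: zr \<phi> \<chi> less_imp_le mult_nonneg_nonneg)
    finally show ?thesis .
  qed
  have "norm_sq x = (\<Sum>r<k. (cmod (x $ r))\<^sup>2)" using x by (simp add: norm_sq_def)
  also have "\<dots> \<le> (\<Sum>r<k. \<theta> * (\<Sum>j\<in>S. (cmod (z j $ r))\<^sup>2 / (\<phi> j * \<chi> j)))"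
    by (intro sum_mono le) simp
  also have "\<dots> = \<theta> * (\<Sum>j\<in>S. norm_sq (z j) / (\<phi> j * \<chi> j))"
    unfolding sum_distrib_left[symmetric]
  proof (subst sum.swap, rule arg_cong[where f = "\<lambda>t. \<theta> * t"], rule sum.cong[OF refl])
    fix j assume "j \<in> S"
    then have "dim_vec (z j) = k" using z by simp
    then show "(\<Sum>r<k. (cmod (z j $ r))\<^sup>2 / (\<phi> j * \<chi> j)) = norm_sq (z j) / (\<phi> j * \<chi> j)"
      by (simp add: norm_sq_def sum_divide_distrib)
  qed
  also have "\<dots> \<le> \<theta> * (\<Sum>j\<in>S. \<phi> j * a j / \<chi> j)"
  proof (intro mult_left_mono[OF _ \<theta>] sum_mono)
    fix j assume j: "j \<in> S"
    show "norm_sq (z j) / (\<phi> j * \<chi> j) \<le> \<phi> j * a j / \<chi> j"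
    proof (cases "\<phi> j = 0")
      case False
      then have p: "\<phi> j > 0" using \<phi>[OF j] by simp
      then have "norm_sq (z j) / (\<phi> j * \<chi> j) \<le> (\<phi> j)\<^sup>2 * a j / (\<phi> j * \<chi> j)"
        using gain[OF j] \<chi>[OF j] by (intro divide_right_mono) auto
      also have "\<dots> = \<phi> j * a j / \<chi> j" using p by (simp add: power2_eq_square)
      finally show ?thesis .
    qed simp
  qed
  finally show ?thesis by (simp only: \<theta>_def)
qed

text \<open>The bounded real lemma for one block, with the other blocks and the external inputs as inputs. The input
\<open>j\<close> is weighted by \<open>\<phi> j * \<xi> / \<chi> j\<close>, which suffices for the frequency condition by the weighted
Cauchy-Schwarz inequality; the additional \<open>\<kappa>\<close> makes the weights positive where \<open>\<phi> j = 0\<close> and the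
frequency condition strict.\<close>

lemma subsystem_dissipation:
  fixes A :: "real mat" and Z :: "'j \<Rightarrow> real mat" and \<chi> :: "'j \<Rightarrow> real"
  assumes A: "A \<in> carrier_mat k k" and stable: "hurwitz A" and k: "k > 0"
    and S: "finite S" and d: "\<And>j. j \<in> S \<Longrightarrow> d j > 0"
    and Z: "\<And>j. j \<in> S \<Longrightarrow> Z j \<in> carrier_mat k (d j)"
    and \<phi>: "\<And>j. j \<in> S \<Longrightarrow> \<phi> j = hinf_norm (\<lambda>s. resolvent A s * complex_mat (Z j))"
    and \<chi>: "\<And>j. j \<in> S \<Longrightarrow> 0 < \<chi> j" and \<xi>: "(\<Sum>j\<in>S. \<phi> j * \<chi> j) \<le> \<xi>" "0 < \<xi>" and \<kappa>: "0 < \<kappa>"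
  obtains P where "P \<in> carrier_mat k k" "positive_definite P"
    "\<And>x w. x \<in> carrier_vec k \<Longrightarrow> (\<And>j. j \<in> S \<Longrightarrow> w j \<in> carrier_vec (d j)) \<Longrightarrow>
      2 * ((P *\<^sub>v x) \<bullet> (A *\<^sub>v x + vec k (\<lambda>r. \<Sum>j\<in>S. (Z j *\<^sub>v w j) $ r))) + x \<bullet> x
        \<le> (\<Sum>j\<in>S. (\<phi> j * \<xi> / \<chi> j + \<kappa>) * (w j \<bullet> w j))"
proof -
  \<comment> \<open>the scalar inputs are the components of all input blocks\<close>
  define I where "I = Sigma S (\<lambda>j. {..<d j})"
  define W where "W r i = Z (fst i) $$ (r, snd i)" for r i
  define \<sigma> where "\<sigma> j = \<phi> j * \<xi> / \<chi> j + \<kappa>" for j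
  define \<rho> where "\<rho> i = \<sigma> (fst i)" for i :: "'j \<times> nat"
  have I: "finite I" using S by (simp add: I_def)
  have sumI: "(\<Sum>i\<in>I. f i) = (\<Sum>j\<in>S. \<Sum>s<d j. f (j, s))" for f :: "'j \<times> nat \<Rightarrow> 'b :: comm_monoid_add"
    unfolding I_def using S by (subst sum.Sigma) auto
  have \<phi>0: "0 \<le> \<phi> j" if "j \<in> S" for j
    unfolding \<phi>[OF that] by (rule hinf_norm_resolvent(1)[OF A stable k Z[OF that] d[OF that]])
  have \<sigma>: "0 < \<sigma> j" if "j \<in> S" for j
    unfolding \<sigma>_def using \<phi>0[OF that] \<chi>[OF that] \<xi> \<kappa> by (intro add_nonneg_pos divide_nonneg_pos mult_nonneg_nonneg) auto
  have freq: "norm_sq x < (\<Sum>i\<in>I. \<rho> i * (cmod (w i))\<^sup>2)"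
    if x: "x \<in> carrier_vec k"
      and e: "complex_mat A *\<^sub>v x + vec k (\<lambda>r. \<Sum>i\<in>I. complex_of_real (W r i) * w i) = (\<i> * complex_of_real \<omega>) \<cdot>\<^sub>v x"
      and nz: "\<exists>i\<in>I. w i \<noteq> 0" for \<omega> x w
  proof -
    let ?s = "\<i> * complex_of_real \<omega>"
    define u where "u j = vec (d j) (\<lambda>s. w (j, s))" for j
    have u: "u j \<in> carrier_vec (d j)" for j by (simp add: u_def)
    have nu: "norm_sq (u j) = (\<Sum>s<d j. (cmod (w (j, s)))\<^sup>2)" for j by (simp add: norm_sq_def u_def)
    have R: "resolvent A ?s \<in> carrier_mat k k" by (rule resolvent_carrier[OF A stable]) simp
    define y where "y j = complex_mat (Z j) *\<^sub>v u j" for j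
    have y: "y j \<in> carrier_vec k" if "j \<in> S" for j
      unfolding y_def by (rule mult_mat_vec_carrier[OF _ u]) (use Z[OF that] in simp)
    define z where "z j = resolvent A ?s *\<^sub>v y j" for j
    have z: "z j \<in> carrier_vec k" if "j \<in> S" for j
      unfolding z_def by (rule mult_mat_vec_carrier[OF R y[OF that]])
    have nz': "norm_sq (z j) \<le> (\<phi> j)\<^sup>2 * norm_sq (u j)" if j: "j \<in> S" for j
      unfolding z_def y_def \<phi>[OF j] by (rule hinf_norm_resolvent(2)[OF A stable k Z[OF j] d[OF j] u])
    have b: "(\<Sum>i\<in>I. complex_of_real (W r i) * w i) = (\<Sum>j\<in>S. y j $ r)" if r: "r < k" for r
      unfolding sumI
    proof (rule sum.cong[OF refl])
      fix j assume j: "j \<in> S"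
      have "y j $ r = (\<Sum>s<d j. complex_mat (Z j) $$ (r, s) * u j $ s)"
        unfolding y_def by (rule mult_mat_vec_index[OF _ u r]) (use Z[OF j] in simp)
      also have "\<dots> = (\<Sum>s<d j. complex_of_real (W r (j, s)) * w (j, s))"
        using Z[OF j] r by (intro sum.cong) (auto simp: W_def u_def)
      finally show "(\<Sum>s<d j. complex_of_real (W r (j, s)) * w (j, s)) = y j $ r" ..
    qed
    define b where "b = vec k (\<lambda>r. \<Sum>j\<in>S. y j $ r)"
    have bc: "b \<in> carrier_vec k" by (simp add: b_def)
    have "vec k (\<lambda>r. \<Sum>i\<in>I. complex_of_real (W r i) * w i) = b"
      unfolding b_def using b by (intro eq_vecI) auto
    then have xe: "x = resolvent A ?s *\<^sub>v b"
      using e by (intro resolvent_unique[OF A stable _ bc x]) simp_all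
    have xr: "x $ r = (\<Sum>j\<in>S. z j $ r)" if r: "r < k" for r
    proof -
      have "x $ r = (\<Sum>q<k. resolvent A ?s $$ (r, q) * (\<Sum>j\<in>S. y j $ q))"
        unfolding xe mult_mat_vec_index[OF R bc r] by (simp add: b_def)
      also have "\<dots> = (\<Sum>j\<in>S. \<Sum>q<k. resolvent A ?s $$ (r, q) * y j $ q)"
        unfolding sum_distrib_left by (rule sum.swap)
      also have "\<dots> = (\<Sum>j\<in>S. z j $ r)"
        unfolding z_def by (intro sum.cong refl) (simp add: mult_mat_vec_index[OF R y r] del: index_mult_mat_vec)
      finally show ?thesis .
    qed
    have "norm_sq x \<le> (\<Sum>j\<in>S. \<phi> j * \<chi> j) * (\<Sum>j\<in>S. \<phi> j * norm_sq (u j) / \<chi> j)"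
      by (rule norm_sq_sum_le_weighted[OF S z x xr \<phi>0 \<chi> nz'])
    also have "\<dots> \<le> \<xi> * (\<Sum>j\<in>S. \<phi> j * norm_sq (u j) / \<chi> j)"
      by (intro mult_right_mono \<xi> sum_nonneg divide_nonneg_nonneg mult_nonneg_nonneg)
        (use \<phi>0 \<chi> in \<open>auto intro: less_imp_le\<close>)
    also have "\<dots> = (\<Sum>j\<in>S. (\<phi> j * \<xi> / \<chi> j) * norm_sq (u j))"
      unfolding sum_distrib_left by (intro sum.cong refl) (simp add: mult_ac)
    also have "\<dots> < (\<Sum>j\<in>S. \<sigma> j * norm_sq (u j))"
    proof (rule sum_strict_mono_ex1[OF S])
      show "\<forall>j\<in>S. \<phi> j * \<xi> / \<chi> j * norm_sq (u j) \<le> \<sigma> j * norm_sq (u j)"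
        using \<kappa> by (intro ballI mult_right_mono) (simp_all add: \<sigma>_def)
      from nz obtain j s where js: "j \<in> S" "s < d j" "w (j, s) \<noteq> 0" by (auto simp: I_def)
      then have "u j $ s \<noteq> 0" by (simp add: u_def)
      then have "u j \<noteq> 0\<^sub>v (d j)" using js by auto
      then have "0 < norm_sq (u j)" by (rule norm_sq_pos[OF u])
      then show "\<exists>j\<in>S. \<phi> j * \<xi> / \<chi> j * norm_sq (u j) < \<sigma> j * norm_sq (u j)"
        using js \<kappa> by (intro bexI[of _ j] mult_strict_right_mono) (simp_all add: \<sigma>_def)
    qed
    also have "\<dots> = (\<Sum>i\<in>I. \<rho> i * (cmod (w i))\<^sup>2)"
      unfolding sumI by (simp add: \<rho>_def nu sum_distrib_left)
    finally show ?thesis .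
  qed
  have \<rho>: "0 < \<rho> i" if "i \<in> I" for i using that \<sigma> by (auto simp: \<rho>_def I_def)
  obtain P where P: "P \<in> carrier_mat k k" "positive_definite P"
    and dis: "\<And>x w. x \<in> carrier_vec k \<Longrightarrow>
      2 * ((P *\<^sub>v x) \<bullet> (A *\<^sub>v x + vec k (\<lambda>r. \<Sum>i\<in>I. W r i * w i))) + x \<bullet> x \<le> (\<Sum>i\<in>I. \<rho> i * (w i)\<^sup>2)"
    by (rule bounded_real_storage[where W = W and \<rho> = \<rho> and I = I, OF A stable I \<rho> freq]) blast+
  show ?thesis
  proof (rule that[OF P])
    fix x :: "real vec" and w :: "'j \<Rightarrow> real vec"
    assume x: "x \<in> carrier_vec k" and w: "\<And>j. j \<in> S \<Longrightarrow> w j \<in> carrier_vec (d j)"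
    define f where "f i = w (fst i) $ snd i" for i
    have "vec k (\<lambda>r. \<Sum>i\<in>I. W r i * f i) = vec k (\<lambda>r. \<Sum>j\<in>S. (Z j *\<^sub>v w j) $ r)"
    proof (rule eq_vecI)
      fix r assume "r < dim_vec (vec k (\<lambda>r. \<Sum>j\<in>S. (Z j *\<^sub>v w j) $ r))"
      then have r: "r < k" by simp
      then show "vec k (\<lambda>r. \<Sum>i\<in>I. W r i * f i) $ r = vec k (\<lambda>r. \<Sum>j\<in>S. (Z j *\<^sub>v w j) $ r) $ r"
        by (auto simp: sumI W_def f_def mult_mat_vec_index[OF Z w r] simp del: index_mult_mat_vec intro!: sum.cong)
    qed simp
    moreover have "(\<Sum>i\<in>I. \<rho> i * (f i)\<^sup>2) = (\<Sum>j\<in>S. \<sigma> j * (w j \<bullet> w j))"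
      unfolding sumI
      by (auto simp: \<rho>_def f_def real_scalar_prod_sum[OF w] sum_distrib_left power2_eq_square intro!: sum.cong)
    ultimately show "2 * ((P *\<^sub>v x) \<bullet> (A *\<^sub>v x + vec k (\<lambda>r. \<Sum>j\<in>S. (Z j *\<^sub>v w j) $ r))) + x \<bullet> x
        \<le> (\<Sum>j\<in>S. (\<phi> j * \<xi> / \<chi> j + \<kappa>) * (w j \<bullet> w j))"
      using dis[OF x, of f] by (simp add: \<sigma>_def)
  qed
qed

section \<open>Block partitions\<close>

definition offset :: "(nat \<Rightarrow> nat) \<Rightarrow> nat \<Rightarrow> nat" where
  "offset k i = (\<Sum>r<i. k r)"

lemma offset_Suc [simp]: "offset k (Suc i) = offset k i + k i"
  by (simp add: offset_def)

lemma offset_add_le: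
  assumes "i < n"
  shows "offset k i + k i \<le> offset k n"
proof -
  have "offset k (Suc i) \<le> offset k n" unfolding offset_def using assms by (intro sum_mono2) auto
  then show ?thesis by simp
qed

lemma offset_add_less:
  assumes "i < n" "r < k i"
  shows "offset k i + r < offset k n"
  using offset_add_le[of i n k] assms by simp

lemma pick_interval:
  assumes "r < c"
  shows "pick {a..<a + c} r = a + r"
proof -
  have "pick {a..<a + c} (card {x \<in> {a..<a + c}. x < a + r}) = a + r"
    by (rule pick_card_in_set) (use assms in simp)
  moreover have "{x \<in> {a..<a + c}. x < a + r} = {a..<a + r}" using assms by auto
  ultimately show ?thesis by simp
qed

lemma block_indices_offset: "block_indices k i = {offset k i..<offset k i + k i}"
  by (simp add: block_indices_def offset_def)

lemma block_entries:
  fixes X :: "'a mat"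
  assumes X: "X \<in> carrier_mat (offset k n) (offset m n')" and i: "i < n" and j: "j < n'"
  shows block_carrier: "block k m X i j \<in> carrier_mat (k i) (m j)"
    and block_index: "r < k i \<Longrightarrow> s < m j \<Longrightarrow>
      block k m X i j $$ (r, s) = X $$ (offset k i + r, offset m j + s)"
proof -
  have c: "card {x. x < offset k n \<and> x \<in> block_indices k i} = k i" if "i < n" for k :: "nat \<Rightarrow> nat" and i n
  proof -
    have "{x. x < offset k n \<and> x \<in> block_indices k i} = {offset k i..<offset k i + k i}"
      unfolding block_indices_offset using offset_add_le[OF that, of k] by auto
    then show ?thesis by simp
  qed
  have rows: "card {x. x < dim_row X \<and> x \<in> block_indices k i} = k i"
    and cols: "card {x. x < dim_col X \<and> x \<in> block_indices m j} = m j"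
    using c[OF i] c[OF j] X by auto
  show "block k m X i j \<in> carrier_mat (k i) (m j)"
    unfolding block_def by (rule carrier_matI) (simp_all add: dim_submatrix rows cols)
  show "block k m X i j $$ (r, s) = X $$ (offset k i + r, offset m j + s)" if "r < k i" "s < m j"
  proof -
    have "block k m X i j $$ (r, s) = X $$ (pick (block_indices k i) r, pick (block_indices m j) s)"
      unfolding block_def by (rule submatrix_index) (simp_all only: rows cols that)
    then show ?thesis using that by (simp add: block_indices_offset pick_interval)
  qed
qed

definition vec_block :: "(nat \<Rightarrow> nat) \<Rightarrow> 'a vec \<Rightarrow> nat \<Rightarrow> 'a vec" where
  "vec_block k x i = vec (k i) (\<lambda>r. x $ (offset k i + r))"

lemma vec_block_carrier [simp]: "vec_block k x i \<in> carrier_vec (k i)"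
  by (simp add: vec_block_def)

lemma vec_block_index [simp]: "r < k i \<Longrightarrow> vec_block k x i $ r = x $ (offset k i + r)"
  by (simp add: vec_block_def)

lemma sum_blocks:
  fixes f :: "nat \<Rightarrow> 'b :: comm_monoid_add"
  shows "(\<Sum>a<offset k n. f a) = (\<Sum>i<n. \<Sum>r<k i. f (offset k i + r))"
proof (induction n)
  case 0
  then show ?case by (simp add: offset_def)
next
  case (Suc n)
  have "(\<Sum>a<c + d. f a) = (\<Sum>a<c. f a) + (\<Sum>r<d. f (c + r))" for c d
    by (induction d) (simp_all add: add.assoc)
  then show ?case by (simp add: Suc.IH)
qed

lemma offset_decompose:
  assumes "a < offset k n"
  obtains i r where "i < n" "r < k i" "a = offset k i + r"
  using assms
proof (induction n arbitrary: thesis)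
  case 0
  then show ?case by (simp add: offset_def)
next
  case (Suc n)
  show ?case
  proof (cases "a < offset k n")
    case True
    show ?thesis by (rule Suc.IH[OF _ True]) (use Suc.prems(1) in \<open>auto intro: less_SucI\<close>)
  next
    case False
    then show ?thesis using Suc.prems(2) by (intro Suc.prems(1)[of n "a - offset k n"]) auto
  qed
qed

lemma scalar_prod_blocks:
  fixes x y :: "real vec"
  assumes "y \<in> carrier_vec (offset k n)"
  shows "x \<bullet> y = (\<Sum>i<n. vec_block k x i \<bullet> vec_block k y i)"
  unfolding real_scalar_prod_sum[OF assms] sum_blocks
  by (intro sum.cong refl) (simp add: real_scalar_prod_sum[OF vec_block_carrier])

lemma mult_mat_vec_blocks:
  fixes X :: "'a :: semiring_0 mat"
  assumes X: "X \<in> carrier_mat (offset k n) (offset m n')" and x: "x \<in> carrier_vec (offset m n')"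
    and i: "i < n" and r: "r < k i"
  shows "(X *\<^sub>v x) $ (offset k i + r) = (\<Sum>j<n'. (block k m X i j *\<^sub>v vec_block m x j) $ r)"
proof -
  have "(X *\<^sub>v x) $ (offset k i + r) = (\<Sum>j<n'. \<Sum>s<m j. X $$ (offset k i + r, offset m j + s) * x $ (offset m j + s))"
    unfolding mult_mat_vec_index[OF X x offset_add_less[where k = k, OF i r]] sum_blocks ..
  also have "\<dots> = (\<Sum>j<n'. (block k m X i j *\<^sub>v vec_block m x j) $ r)"
  proof (rule sum.cong[OF refl])
    fix j assume "j \<in> {..<n'}"
    then have j: "j < n'" by simp
    show "(\<Sum>s<m j. X $$ (offset k i + r, offset m j + s) * x $ (offset m j + s)) = (block k m X i j *\<^sub>v vec_block m x j) $ r"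
      unfolding mult_mat_vec_index[OF block_carrier[OF X i j] vec_block_carrier[where k = m] r]
      using block_index[OF X i j r] by (intro sum.cong) auto
  qed
  finally show ?thesis .
qed

lemma diag_block_mat_entries:
  fixes Ps :: "nat \<Rightarrow> 'a :: zero mat"
  assumes "\<And>i. i < n \<Longrightarrow> Ps i \<in> carrier_mat (k i) (k i)"
  shows "diag_block_mat (map Ps [0..<n]) \<in> carrier_mat (offset k n) (offset k n) \<and>
    (\<forall>i<n. \<forall>j<n. \<forall>r<k i. \<forall>s<k j.
      diag_block_mat (map Ps [0..<n]) $$ (offset k i + r, offset k j + s) = (if i = j then Ps i $$ (r, s) else 0))"
  using assms
proof (induction n)
  case 0
  then show ?case by (simp add: offset_def)
next
  case (Suc n)
  define Q where "Q = diag_block_mat (map Ps [0..<n])"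
  have IH: "Q \<in> carrier_mat (offset k n) (offset k n)"
    "\<And>i j r s. i < n \<Longrightarrow> j < n \<Longrightarrow> r < k i \<Longrightarrow> s < k j \<Longrightarrow>
      Q $$ (offset k i + r, offset k j + s) = (if i = j then Ps i $$ (r, s) else 0)"
    using Suc unfolding Q_def by auto
  have P: "Ps n \<in> carrier_mat (k n) (k n)" using Suc.prems by simp
  have e: "diag_block_mat (map Ps [0..<Suc n]) =
      four_block_mat Q (0\<^sub>m (offset k n) (k n)) (0\<^sub>m (k n) (offset k n)) (Ps n)"
    using IH(1) P by (simp add: diag_block_mat_last Q_def[symmetric] Let_def)
  have c: "diag_block_mat (map Ps [0..<Suc n]) \<in> carrier_mat (offset k (Suc n)) (offset k (Suc n))"
    unfolding e offset_Suc by (rule four_block_carrier_mat[OF IH(1) P])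
  have "diag_block_mat (map Ps [0..<Suc n]) $$ (offset k i + r, offset k j + s) = (if i = j then Ps i $$ (r, s) else 0)"
    if ij: "i < Suc n" "j < Suc n" and rs: "r < k i" "s < k j" for i j r s
  proof -
    have b: "offset k i + r < offset k n + k n" "offset k j + s < offset k n + k n"
      using offset_add_less[where k = k, OF ij(1) rs(1)] offset_add_less[where k = k, OF ij(2) rs(2)] by simp_all
    have lt: "offset k i + r < offset k n \<longleftrightarrow> i < n" "offset k j + s < offset k n \<longleftrightarrow> j < n"
      using ij offset_add_less[where k = k and n = n, of i r] offset_add_less[where k = k and n = n, of j s] rs
      by (auto simp: less_Suc_eq)
    show ?thesis
      unfolding e using IH(1) P b lt ij rs by (auto simp: less_Suc_eq IH(2))
  qed
  with c show ?case by blast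
qed

lemma diag_block_mat_carrier:
  assumes "\<And>i. i < n \<Longrightarrow> Ps i \<in> carrier_mat (k i) (k i)"
  shows "diag_block_mat (map Ps [0..<n]) \<in> carrier_mat (offset k n) (offset k n)"
  using diag_block_mat_entries[of n Ps k] assms by blast

lemma diag_block_mat_mult_vec:
  fixes Ps :: "nat \<Rightarrow> real mat"
  assumes Ps: "\<And>i. i < n \<Longrightarrow> Ps i \<in> carrier_mat (k i) (k i)"
    and x: "x \<in> carrier_vec (offset k n)" and i: "i < n"
  shows "vec_block k (diag_block_mat (map Ps [0..<n]) *\<^sub>v x) i = Ps i *\<^sub>v vec_block k x i"
proof (rule eq_vecI)
  fix r assume "r < dim_vec (Ps i *\<^sub>v vec_block k x i)"
  then have r: "r < k i" using Ps[OF i] by simp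
  define Q where "Q = diag_block_mat (map Ps [0..<n])"
  have Q: "Q \<in> carrier_mat (offset k n) (offset k n)" unfolding Q_def by (rule diag_block_mat_carrier[OF Ps])
  have Qe: "Q $$ (offset k i + r, offset k j + s) = (if i = j then Ps i $$ (r, s) else 0)"
    if "j < n" "s < k j" for j s
    using diag_block_mat_entries[of n Ps k] Ps i r that unfolding Q_def by blast
  have "(Q *\<^sub>v x) $ (offset k i + r) = (\<Sum>j<n. \<Sum>s<k j. Q $$ (offset k i + r, offset k j + s) * x $ (offset k j + s))"
    unfolding mult_mat_vec_index[OF Q x offset_add_less[where k = k, OF i r]] sum_blocks ..
  also have "\<dots> = (\<Sum>j<n. if j = i then \<Sum>s<k i. Ps i $$ (r, s) * x $ (offset k i + s) else 0)"
    by (intro sum.cong refl) (auto simp: Qe)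
  also have "\<dots> = (Ps i *\<^sub>v vec_block k x i) $ r"
    unfolding mult_mat_vec_index[OF Ps[OF i] vec_block_carrier[where k = k and i = i] r] using i by simp
  finally show "vec_block k (diag_block_mat (map Ps [0..<n]) *\<^sub>v x) i $ r = (Ps i *\<^sub>v vec_block k x i) $ r"
    using r by (simp add: Q_def)
qed (use Ps[OF i] in \<open>simp add: vec_block_def\<close>)

lemma diag_block_mat_positive_definite:
  fixes Ps :: "nat \<Rightarrow> real mat"
  assumes Ps: "\<And>i. i < n \<Longrightarrow> Ps i \<in> carrier_mat (k i) (k i)"
    and pd: "\<And>i. i < n \<Longrightarrow> positive_definite (Ps i)"
  shows "positive_definite (diag_block_mat (map Ps [0..<n]))"
proof -
  define Q where "Q = diag_block_mat (map Ps [0..<n])"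
  have Q: "Q \<in> carrier_mat (offset k n) (offset k n)" unfolding Q_def by (rule diag_block_mat_carrier[OF Ps])
  have Qe: "Q $$ (offset k i + r, offset k j + s) = (if i = j then Ps i $$ (r, s) else 0)"
    if "i < n" "r < k i" "j < n" "s < k j" for i j r s
    using diag_block_mat_entries[of n Ps k] Ps that unfolding Q_def by blast
  have sym: "Ps i $$ (r, s) = Ps i $$ (s, r)" if "i < n" "r < k i" "s < k i" for i r s
  proof -
    have "transpose_mat (Ps i) $$ (r, s) = Ps i $$ (s, r)" using Ps[OF that(1)] that by simp
    then show ?thesis using pd[OF that(1)] by (simp add: positive_definite_def)
  qed
  have "positive_definite Q"
    unfolding positive_definite_def
  proof (intro conjI ballI impI)
    show "square_mat Q" using Q by simp
    show "transpose_mat Q = Q"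
    proof (rule eq_matI)
      fix a b assume "a < dim_row Q" "b < dim_col Q"
      then have ab: "a < offset k n" "b < offset k n" using Q by simp_all
      obtain i r where i: "i < n" "r < k i" "a = offset k i + r" by (rule offset_decompose[OF ab(1)])
      obtain j s where j: "j < n" "s < k j" "b = offset k j + s" by (rule offset_decompose[OF ab(2)])
      have "transpose_mat Q $$ (a, b) = Q $$ (b, a)" using ab Q by simp
      also have "\<dots> = Q $$ (a, b)" unfolding i(3) j(3) using i j sym by (auto simp: Qe)
      finally show "transpose_mat Q $$ (a, b) = Q $$ (a, b)" .
    qed (use Q in auto)
    fix x :: "real vec" assume "x \<in> carrier_vec (dim_row Q)" "x \<noteq> 0\<^sub>v (dim_row Q)"
    then have x: "x \<in> carrier_vec (offset k n)" "x \<noteq> 0\<^sub>v (offset k n)" using Q by auto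
    have Qx: "Q *\<^sub>v x \<in> carrier_vec (offset k n)" using Q x by simp
    have e: "x \<bullet> (Q *\<^sub>v x) = (\<Sum>i<n. vec_block k x i \<bullet> (Ps i *\<^sub>v vec_block k x i))"
      unfolding scalar_prod_blocks[OF Qx]
      by (intro sum.cong refl) (simp add: Q_def diag_block_mat_mult_vec[OF Ps x(1)])
    have nn: "0 < vec_block k x i \<bullet> (Ps i *\<^sub>v vec_block k x i)" if "i < n" "vec_block k x i \<noteq> 0\<^sub>v (k i)" for i
      using pd[OF that(1)] Ps[OF that(1)] that(2) by (auto simp: positive_definite_def)
    have nn0: "0 \<le> vec_block k x i \<bullet> (Ps i *\<^sub>v vec_block k x i)" if "i < n" for i
      using nn[OF that] Ps[OF that] by (cases "vec_block k x i = 0\<^sub>v (k i)") (auto simp: less_imp_le)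
    have "\<exists>i<n. vec_block k x i \<noteq> 0\<^sub>v (k i)"
    proof (rule ccontr)
      assume none: "\<not> ?thesis"
      have "x $ a = 0" if a: "a < offset k n" for a
      proof -
        obtain i r where i: "i < n" "r < k i" "a = offset k i + r" by (rule offset_decompose[OF a])
        have "vec_block k x i $ r = 0" using none i by auto
        then show ?thesis using i by simp
      qed
      then have "x = 0\<^sub>v (offset k n)" using x by (intro eq_vecI) auto
      then show False using x by simp
    qed
    then obtain i where "i < n" "vec_block k x i \<noteq> 0\<^sub>v (k i)" by blast
    then show "0 < x \<bullet> (Q *\<^sub>v x)"
      unfolding e using nn nn0 by (intro sum_pos2[of _ i]) auto
  qed
  then show ?thesis by (simp add: Q_def)
qed

section \<open>Consequences of strict dissipation\<close>

text \<open>The storage function \<open>x\<^sup>T P x\<close> together with the integral of \<open>\<bar>y\<bar>\<^sup>2 - \<delta>\<^sup>2 \<bar>u\<bar>\<^sup>2\<close> decreases along all trajectories,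
with margin \<open>\<kappa>\<close>.\<close>

definition strictly_dissipative ::
    "real mat \<Rightarrow> real mat \<Rightarrow> real mat \<Rightarrow> real mat \<Rightarrow> real mat \<Rightarrow> real \<Rightarrow> real \<Rightarrow> bool" where
  "strictly_dissipative P A B C D \<delta> \<kappa> \<longleftrightarrow>
    (\<forall>x \<in> carrier_vec (dim_row A). \<forall>u \<in> carrier_vec (dim_col B).
      2 * ((P *\<^sub>v x) \<bullet> (A *\<^sub>v x + B *\<^sub>v u)) + (C *\<^sub>v x + D *\<^sub>v u) \<bullet> (C *\<^sub>v x + D *\<^sub>v u) - \<delta>\<^sup>2 * (u \<bullet> u)
        \<le> - \<kappa> * (x \<bullet> x + u \<bullet> u))"

lemma strictly_dissipativeD:
  assumes "strictly_dissipative P A B C D \<delta> \<kappa>" "A \<in> carrier_mat n n" "B \<in> carrier_mat n m"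
    and "x \<in> carrier_vec n" "u \<in> carrier_vec m"
  shows "2 * ((P *\<^sub>v x) \<bullet> (A *\<^sub>v x + B *\<^sub>v u)) + (C *\<^sub>v x + D *\<^sub>v u) \<bullet> (C *\<^sub>v x + D *\<^sub>v u) - \<delta>\<^sup>2 * (u \<bullet> u)
    \<le> - \<kappa> * (x \<bullet> x + u \<bullet> u)"
  using assms unfolding strictly_dissipative_def by auto

text \<open>All matrices are real, so the inequality for complex vectors is the sum of those for the real and the
imaginary parts.\<close>

lemma dissipation_complex:
  fixes P A B C D :: "real mat"
  assumes P: "P \<in> carrier_mat n n" and A: "A \<in> carrier_mat n n" and B: "B \<in> carrier_mat n m"
    and C: "C \<in> carrier_mat p n" and D: "D \<in> carrier_mat p m"
    and diss: "strictly_dissipative P A B C D \<delta> \<kappa>"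
    and x: "x \<in> carrier_vec n" and u: "u \<in> carrier_vec m"
  shows "2 * Re ((complex_mat A *\<^sub>v x + complex_mat B *\<^sub>v u) \<bullet>c (complex_mat P *\<^sub>v x)) +
      norm_sq (complex_mat C *\<^sub>v x + complex_mat D *\<^sub>v u) - \<delta>\<^sup>2 * norm_sq u \<le> - \<kappa> * (norm_sq x + norm_sq u)"
proof -
  note dis = strictly_dissipativeD[OF diss A B]
  define re where "re v = map_vec Re v" for v
  define im where "im v = map_vec Im v" for v
  have rc: "re v \<in> carrier_vec d" "im v \<in> carrier_vec d" if "v \<in> carrier_vec d" for v d
    using that by (simp_all add: re_def im_def)
  have n: "norm_sq v = re v \<bullet> re v + im v \<bullet> im v" for v
    unfolding norm_sq_def cmod_power2
    by (simp add: re_def im_def scalar_prod_def sum.distrib power2_eq_square lessThan_atLeast0)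
  have ip: "Re (v \<bullet>c w) = re w \<bullet> re v + im w \<bullet> im v" if "v \<in> carrier_vec d" "w \<in> carrier_vec d" for v w d
    using that by (simp add: cscalar_prod_sum[of _ d] re_def im_def scalar_prod_def sum.distrib lessThan_atLeast0 mult.commute)
  have mult: "re (complex_mat M *\<^sub>v v) = M *\<^sub>v re v" "im (complex_mat M *\<^sub>v v) = M *\<^sub>v im v"
    if M: "M \<in> carrier_mat c d" and v: "v \<in> carrier_vec d" for M c d v
  proof -
    have cM: "complex_mat M \<in> carrier_mat c d" using M by simp
    have e: "(complex_mat M *\<^sub>v v) $ i = (\<Sum>j<d. complex_of_real (M $$ (i, j)) * v $ j)" if "i < c" for i
      unfolding mult_mat_vec_index[OF cM v that] using M that by (intro sum.cong) auto
    show "re (complex_mat M *\<^sub>v v) = M *\<^sub>v re v"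
    proof (rule eq_vecI)
      fix i assume "i < dim_vec (M *\<^sub>v re v)"
      then have i: "i < c" using M by simp
      then show "re (complex_mat M *\<^sub>v v) $ i = (M *\<^sub>v re v) $ i"
        unfolding mult_mat_vec_index[OF M rc(1)[OF v] i] using e[OF i] M v
        by (simp add: re_def del: index_mult_mat_vec)
    qed (use M in \<open>simp add: re_def\<close>)
    show "im (complex_mat M *\<^sub>v v) = M *\<^sub>v im v"
    proof (rule eq_vecI)
      fix i assume "i < dim_vec (M *\<^sub>v im v)"
      then have i: "i < c" using M by simp
      then show "im (complex_mat M *\<^sub>v v) $ i = (M *\<^sub>v im v) $ i"
        unfolding mult_mat_vec_index[OF M rc(2)[OF v] i] using e[OF i] M v
        by (simp add: im_def del: index_mult_mat_vec)
    qed (use M in \<open>simp add: im_def\<close>)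
  qed
  have add: "re (v + w) = re v + re w" "im (v + w) = im v + im w"
    if "v \<in> carrier_vec d" "w \<in> carrier_vec d" for v w d
    using that by (auto simp: re_def im_def intro!: eq_vecI)
  have c: "complex_mat M *\<^sub>v v \<in> carrier_vec c" if "M \<in> carrier_mat c d" "v \<in> carrier_vec d" for M c d v
    by (rule mult_mat_vec_carrier[OF _ that(2)]) (use that in simp)
  have "Re ((complex_mat A *\<^sub>v x + complex_mat B *\<^sub>v u) \<bullet>c (complex_mat P *\<^sub>v x)) =
      (P *\<^sub>v re x) \<bullet> (A *\<^sub>v re x + B *\<^sub>v re u) + (P *\<^sub>v im x) \<bullet> (A *\<^sub>v im x + B *\<^sub>v im u)"
    by (subst ip[of _ n]) (simp_all add: c[OF A x] c[OF B u] c[OF P x] add[OF c[OF A x] c[OF B u]]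
        mult[OF A x] mult[OF B u] mult[OF P x])
  moreover have "norm_sq (complex_mat C *\<^sub>v x + complex_mat D *\<^sub>v u) =
      (C *\<^sub>v re x + D *\<^sub>v re u) \<bullet> (C *\<^sub>v re x + D *\<^sub>v re u) + (C *\<^sub>v im x + D *\<^sub>v im u) \<bullet> (C *\<^sub>v im x + D *\<^sub>v im u)"
    unfolding n by (simp add: add[OF c[OF C x] c[OF D u]] mult[OF C x] mult[OF D u])
  ultimately show ?thesis
    using dis[OF rc(1)[OF x] rc(1)[OF u]] dis[OF rc(2)[OF x] rc(2)[OF u]]
    unfolding n[of x] n[of u] by (simp add: algebra_simps)
qed

text \<open>Stability is seen at an eigenvector, with zero input. For the gain, take the state response to a harmonic
input: the storage term vanishes on the imaginary axis, and the inequality leaves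
\<open>\<bar>y\<bar>\<^sup>2 \<le> (\<delta>\<^sup>2 - \<kappa>) \<bar>u\<bar>\<^sup>2\<close>. The margin \<open>\<kappa>\<close> keeps the supremum over all frequencies strictly below \<open>\<delta>\<close>.\<close>

lemma dissipation_stability_and_gain:
  fixes P A B C D :: "real mat"
  assumes P: "P \<in> carrier_mat n n" and A: "A \<in> carrier_mat n n" and B: "B \<in> carrier_mat n m"
    and C: "C \<in> carrier_mat p n" and D: "D \<in> carrier_mat p m"
    and m: "m > 0" and pd: "positive_definite P" and \<kappa>: "0 < \<kappa>" and \<delta>: "0 < \<delta>"
    and diss: "strictly_dissipative P A B C D \<delta> \<kappa>"
  shows "hurwitz A" and "hinf_norm (transfer_function A B C D) < \<delta>"
proof -
  define p' where "p' = complex_mat P"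
  define a where "a = complex_mat A"
  define b where "b = complex_mat B"
  have p': "p' \<in> carrier_mat n n" and a: "a \<in> carrier_mat n n" and b: "b \<in> carrier_mat n m"
    using P A B by (simp_all add: p'_def a_def b_def)
  have hp: "mat_adjoint p' = p'"
    using pd by (simp add: p'_def mat_adjoint_complex_mat positive_definite_def)
  have cdis: "2 * Re ((a *\<^sub>v x + b *\<^sub>v u) \<bullet>c (p' *\<^sub>v x)) +
      norm_sq (complex_mat C *\<^sub>v x + complex_mat D *\<^sub>v u) - \<delta>\<^sup>2 * norm_sq u \<le> - \<kappa> * (norm_sq x + norm_sq u)"
    if "x \<in> carrier_vec n" "u \<in> carrier_vec m" for x u
    unfolding a_def b_def p'_def by (rule dissipation_complex[OF P A B C D diss that])
  have ppos: "Re (x \<bullet>c (p' *\<^sub>v x)) > 0" if x: "x \<in> carrier_vec n" "x \<noteq> 0\<^sub>v n" for x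
  proof -
    define xr where "xr = map_vec Re x"
    define xi where "xi = map_vec Im x"
    have r: "xr \<in> carrier_vec n" and i: "xi \<in> carrier_vec n" using x by (simp_all add: xr_def xi_def)
    have e: "Re (x \<bullet>c (p' *\<^sub>v x)) = xr \<bullet> (P *\<^sub>v xr) + xi \<bullet> (P *\<^sub>v xi)"
    proof -
      have px: "p' *\<^sub>v x \<in> carrier_vec n" using p' x by simp
      have pi: "(p' *\<^sub>v x) $ i = (\<Sum>j<n. complex_of_real (P $$ (i, j)) * x $ j)" if "i < n" for i
        by (subst mult_mat_vec_index[OF p' x(1) that]) (use P that in \<open>auto simp: p'_def intro!: sum.cong\<close>)
      have "Re ((p' *\<^sub>v x) $ i) = (P *\<^sub>v xr) $ i" "Im ((p' *\<^sub>v x) $ i) = (P *\<^sub>v xi) $ i" if "i < n" for i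
        unfolding mult_mat_vec_index[OF P r that] mult_mat_vec_index[OF P i that] pi[OF that]
        using x by (simp_all add: xr_def xi_def)
      then show ?thesis
        using P r i x unfolding cscalar_prod_sum[OF px]
        by (simp add: real_scalar_prod_sum[of _ n] xr_def[symmetric] del: index_mult_mat_vec)
          (simp add: xr_def xi_def sum.distrib del: index_mult_mat_vec)
    qed
    have nn: "0 \<le> v \<bullet> (P *\<^sub>v v)" "v \<noteq> 0\<^sub>v n \<Longrightarrow> 0 < v \<bullet> (P *\<^sub>v v)" if v: "v \<in> carrier_vec n" for v
      using pd P v by (cases "v = 0\<^sub>v n"; auto simp: positive_definite_def less_imp_le)+
    have "xr \<noteq> 0\<^sub>v n \<or> xi \<noteq> 0\<^sub>v n"
    proof (rule ccontr)
      assume "\<not> ?thesis"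
      then have z: "xr = 0\<^sub>v n" "xi = 0\<^sub>v n" by auto
      have "x $ j = 0" if j: "j < n" for j
        using arg_cong[OF z(1), of "\<lambda>v. v $ j"] arg_cong[OF z(2), of "\<lambda>v. v $ j"] j x
        by (simp add: xr_def xi_def complex_eq_iff)
      then have "x = 0\<^sub>v n" using x by (intro eq_vecI) auto
      then show False using x by simp
    qed
    then show ?thesis unfolding e using nn[OF r] nn[OF i] by linarith
  qed
  show hA: "hurwitz A"
    unfolding hurwitz_def
  proof (intro conjI allI impI)
    show "square_mat A" using A by simp
    fix \<mu> assume "eigenvalue (complex_mat A) \<mu>"
    then obtain x where x: "x \<in> carrier_vec n" "x \<noteq> 0\<^sub>v n" and e: "a *\<^sub>v x = \<mu> \<cdot>\<^sub>v x"
      using a unfolding eigenvalue_def eigenvector_def a_def by auto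
    have px: "p' *\<^sub>v x \<in> carrier_vec n" using p' x by simp
    have "b *\<^sub>v 0\<^sub>v m = 0\<^sub>v n" using b by (intro eq_vecI) (auto simp: scalar_prod_def)
    then have bx: "a *\<^sub>v x + b *\<^sub>v 0\<^sub>v m = \<mu> \<cdot>\<^sub>v x" using e x by simp
    have "2 * Re ((\<mu> \<cdot>\<^sub>v x) \<bullet>c (p' *\<^sub>v x)) \<le> - \<kappa> * norm_sq x"
    proof -
      have "2 * Re ((\<mu> \<cdot>\<^sub>v x) \<bullet>c (p' *\<^sub>v x)) + norm_sq (complex_mat C *\<^sub>v x + complex_mat D *\<^sub>v 0\<^sub>v m) \<le> - \<kappa> * norm_sq x"
        using cdis[OF x(1), of "0\<^sub>v m"] unfolding bx by simp
      then show ?thesis using norm_sq_nonneg[of "complex_mat C *\<^sub>v x + complex_mat D *\<^sub>v 0\<^sub>v m"] by linarith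
    qed
    also have "\<dots> < 0" using \<kappa> norm_sq_pos[OF x] by simp
    finally have neg: "Re ((\<mu> \<cdot>\<^sub>v x) \<bullet>c (p' *\<^sub>v x)) < 0" by simp
    have "(\<mu> \<cdot>\<^sub>v x) \<bullet>c (p' *\<^sub>v x) = \<mu> * (x \<bullet>c (p' *\<^sub>v x))" using x px by simp
    moreover have "Im (x \<bullet>c (p' *\<^sub>v x)) = 0"
    proof -
      have "cnj (x \<bullet>c (p' *\<^sub>v x)) = x \<bullet>c (p' *\<^sub>v x)"
        using cscalar_prod_commute[OF x(1) px] adjoint_swap[OF p' x(1) x(1)] by (simp add: hp)
      then show ?thesis by (simp add: complex_eq_iff)
    qed
    ultimately have "Re \<mu> * Re (x \<bullet>c (p' *\<^sub>v x)) < 0" using neg by simp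
    then show "Re \<mu> < 0" using ppos[OF x] by (simp add: mult_less_0_iff)
  qed
  \<comment> \<open>the maximum keeps the radicand nonnegative\<close>
  define \<gamma> where "\<gamma> = sqrt (max 0 (\<delta>\<^sup>2 - \<kappa>))"
  have \<gamma>: "0 \<le> \<gamma>" "\<gamma>\<^sup>2 = max 0 (\<delta>\<^sup>2 - \<kappa>)" by (simp_all add: \<gamma>_def)
  have "hinf_norm (transfer_function A B C D) \<le> \<gamma>"
  proof (rule hinf_norm_le[OF _ m \<gamma>(1)])
    fix \<omega> :: real
    let ?s = "\<i> * complex_of_real \<omega>"
    show "transfer_function A B C D ?s \<in> carrier_mat p m"
      by (rule transfer_function_mult_vec(1)[OF A B C D hA]) simp
    fix u :: "complex vec" assume u: "u \<in> carrier_vec m"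
    have bu: "b *\<^sub>v u \<in> carrier_vec n" using b u by simp
    define x where "x = resolvent A ?s *\<^sub>v (b *\<^sub>v u)"
    have x: "x \<in> carrier_vec n"
      unfolding x_def by (rule mult_mat_vec_carrier[OF resolvent_carrier[OF A hA] bu]) simp
    have px: "p' *\<^sub>v x \<in> carrier_vec n" using p' x by simp
    have e: "a *\<^sub>v x + b *\<^sub>v u = ?s \<cdot>\<^sub>v x"
      unfolding x_def a_def by (rule resolvent_solves[OF A hA _ bu]) simp
    have "Im (x \<bullet>c (p' *\<^sub>v x)) = 0"
    proof -
      have "cnj (x \<bullet>c (p' *\<^sub>v x)) = x \<bullet>c (p' *\<^sub>v x)"
        using cscalar_prod_commute[OF x px] adjoint_swap[OF p' x x] by (simp add: hp)
      then show ?thesis by (simp add: complex_eq_iff)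
    qed
    moreover have "(?s \<cdot>\<^sub>v x) \<bullet>c (p' *\<^sub>v x) = ?s * (x \<bullet>c (p' *\<^sub>v x))" using x px by simp
    ultimately have "Re ((a *\<^sub>v x + b *\<^sub>v u) \<bullet>c (p' *\<^sub>v x)) = 0" unfolding e by simp
    then have "norm_sq (complex_mat C *\<^sub>v x + complex_mat D *\<^sub>v u) \<le> (\<delta>\<^sup>2 - \<kappa>) * norm_sq u - \<kappa> * norm_sq x"
      using cdis[OF x u] by (simp add: algebra_simps)
    also have "\<dots> \<le> (\<delta>\<^sup>2 - \<kappa>) * norm_sq u" using \<kappa> by simp
    also have "\<dots> \<le> \<gamma>\<^sup>2 * norm_sq u" unfolding \<gamma>(2) by (intro mult_right_mono) auto
    also have "complex_mat C *\<^sub>v x + complex_mat D *\<^sub>v u = transfer_function A B C D ?s *\<^sub>v u"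
      unfolding x_def b_def by (rule transfer_function_mult_vec(2)[OF A B C D hA _ u, symmetric]) simp
    finally show "norm_sq (transfer_function A B C D ?s *\<^sub>v u) \<le> \<gamma>\<^sup>2 * norm_sq u" .
  qed
  also have "\<gamma> < \<delta>"
    using \<gamma> \<delta> \<kappa> by (intro power2_less_imp_less[of \<gamma> \<delta>]) auto
  finally show "hinf_norm (transfer_function A B C D) < \<delta>" .
qed

text \<open>The Riccati expression at \<open>x\<close> is the value of the dissipation inequality at the worst input
\<open>u = - E\<^sup>-\<^sup>1 (D\<^sup>T C + B\<^sup>T P) x\<close>, where \<open>E = D\<^sup>T D - \<delta>\<^sup>2 I\<close> is negative definite by the inequality at \<open>x = 0\<close>.\<close>

lemma dissipation_riccati:
  fixes P A B C D :: "real mat"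
  assumes P: "P \<in> carrier_mat n n" and A: "A \<in> carrier_mat n n" and B: "B \<in> carrier_mat n m"
    and C: "C \<in> carrier_mat p n" and D: "D \<in> carrier_mat p m"
    and symP: "transpose_mat P = P" and \<kappa>: "0 < \<kappa>"
    and diss: "strictly_dissipative P A B C D \<delta> \<kappa>"
  shows "negative_definite
    (P * A + transpose_mat A * P + transpose_mat C * C -
     (P * B + transpose_mat C * D) * mat_inv (transpose_mat D * D - \<delta>\<^sup>2 \<cdot>\<^sub>m 1\<^sub>m m) *
     (transpose_mat D * C + transpose_mat B * P))"
proof -
  note dis = strictly_dissipativeD[OF diss A B]
  define At where "At = transpose_mat A"
  define Bt where "Bt = transpose_mat B"
  define Ct where "Ct = transpose_mat C"
  define Dt where "Dt = transpose_mat D"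
  have t: "At \<in> carrier_mat n n" "Bt \<in> carrier_mat m n" "Ct \<in> carrier_mat n p" "Dt \<in> carrier_mat m p"
    using A B C D by (simp_all add: At_def Bt_def Ct_def Dt_def)
  have tt: "transpose_mat At = A" "transpose_mat Bt = B" "transpose_mat Ct = C" "transpose_mat Dt = D"
    by (simp_all add: At_def Bt_def Ct_def Dt_def)
  have swap: "y \<bullet> (M *\<^sub>v x) = (transpose_mat M *\<^sub>v y) \<bullet> x"
    if "M \<in> carrier_mat a b" "x \<in> carrier_vec b" "y \<in> carrier_vec a" for M :: "real mat" and a b x y
    using transpose_vec_mult_scalar[OF that] by simp
  define E where "E = Dt * D - \<delta>\<^sup>2 \<cdot>\<^sub>m 1\<^sub>m m"
  have DD: "Dt * D \<in> carrier_mat m m" using t D by simp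
  have E: "E \<in> carrier_mat m m" unfolding E_def by (rule minus_carrier_mat) simp
  have Ev: "E *\<^sub>v u = Dt *\<^sub>v (D *\<^sub>v u) - \<delta>\<^sup>2 \<cdot>\<^sub>v u" if u: "u \<in> carrier_vec m" for u
  proof -
    have "E *\<^sub>v u = (Dt * D) *\<^sub>v u - (\<delta>\<^sup>2 \<cdot>\<^sub>m 1\<^sub>m m) *\<^sub>v u"
      unfolding E_def by (rule minus_mult_distrib_mat_vec[OF DD _ u]) simp
    then show ?thesis by (simp only: scalar_mat_mult_vec[OF u] assoc_mult_mat_vec[OF t(4) D u])
  qed
  have uEu: "u \<bullet> (E *\<^sub>v u) = (D *\<^sub>v u) \<bullet> (D *\<^sub>v u) - \<delta>\<^sup>2 * (u \<bullet> u)" if u: "u \<in> carrier_vec m" for u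
  proof -
    have Du: "D *\<^sub>v u \<in> carrier_vec p" using D u by simp
    have DDu: "Dt *\<^sub>v (D *\<^sub>v u) \<in> carrier_vec m" using t(4) Du by simp
    have "u \<bullet> (E *\<^sub>v u) = u \<bullet> (Dt *\<^sub>v (D *\<^sub>v u)) - u \<bullet> (\<delta>\<^sup>2 \<cdot>\<^sub>v u)"
      unfolding Ev[OF u] by (rule scalar_prod_minus_distrib[OF u DDu]) (use u in simp)
    also have "u \<bullet> (Dt *\<^sub>v (D *\<^sub>v u)) = (D *\<^sub>v u) \<bullet> (D *\<^sub>v u)"
      using swap[OF t(4) Du u] by (simp add: tt)
    finally show ?thesis using u by simp
  qed
  have vv: "0 < v \<bullet> v" if "v \<in> carrier_vec d" "v \<noteq> 0\<^sub>v d" for v :: "real vec" and d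
  proof -
    have "map_vec complex_of_real v \<noteq> 0\<^sub>v d"
    proof
      assume z: "map_vec complex_of_real v = 0\<^sub>v d"
      have "v $ i = 0" if "i < d" for i
        using arg_cong[OF z, of "\<lambda>u. u $ i"] that \<open>v \<in> carrier_vec d\<close> by simp
      then have "v = 0\<^sub>v d" using \<open>v \<in> carrier_vec d\<close> by (intro eq_vecI) auto
      then show False using \<open>v \<noteq> 0\<^sub>v d\<close> by simp
    qed
    then have "0 < norm_sq (map_vec complex_of_real v)"
      using that by (intro norm_sq_pos[of _ d]) auto
    then show ?thesis using that by (simp add: norm_sq_of_real real_scalar_prod_sum[of _ d] power2_eq_square)
  qed
  have M0: "M *\<^sub>v 0\<^sub>v b = 0\<^sub>v a" if "M \<in> carrier_mat a b" for M :: "real mat" and a b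
    using that by (intro eq_vecI) (auto simp: scalar_prod_def)
  have Einj: "u = 0\<^sub>v m" if u: "u \<in> carrier_vec m" "E *\<^sub>v u = 0\<^sub>v m" for u
  proof (rule ccontr)
    assume nz: "u \<noteq> 0\<^sub>v m"
    have Du: "D *\<^sub>v u \<in> carrier_vec p" and Bu: "B *\<^sub>v u \<in> carrier_vec n" using D B u by simp_all
    have "(D *\<^sub>v u) \<bullet> (D *\<^sub>v u) - \<delta>\<^sup>2 * (u \<bullet> u) \<le> - \<kappa> * (u \<bullet> u)"
      using dis[of "0\<^sub>v n" u] u Du Bu by (simp add: M0[OF P] M0[OF A] M0[OF C])
    moreover have "u \<bullet> (E *\<^sub>v u) = 0" using u by simp
    ultimately have "\<kappa> * (u \<bullet> u) \<le> 0" using uEu[OF u(1)] by simp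
    then show False using vv[OF u(1) nz] \<kappa> by (simp add: mult_le_0_iff)
  qed
  define Ei where "Ei = mat_inv E"
  have inv1: "Ei \<in> carrier_mat m m" unfolding Ei_def by (rule mat_inv_inverse(1)[OF E Einj])
  have inv2: "E * Ei = 1\<^sub>m m" unfolding Ei_def by (rule mat_inv_inverse(2)[OF E Einj])
  have symE: "transpose_mat E = E"
  proof -
    have "transpose_mat (Dt * D) = Dt * D"
      using transpose_mult[OF t(4) D] by (simp add: tt Dt_def)
    moreover have "transpose_mat (\<delta>\<^sup>2 \<cdot>\<^sub>m 1\<^sub>m m) = \<delta>\<^sup>2 \<cdot>\<^sub>m 1\<^sub>m m" by (intro eq_matI) auto
    ultimately show ?thesis
      unfolding E_def using transpose_minus[OF DD, of "\<delta>\<^sup>2 \<cdot>\<^sub>m 1\<^sub>m m"] by simp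
  qed
  have Eit: "transpose_mat Ei \<in> carrier_mat m m" using inv1 by simp
  have symEi: "transpose_mat Ei = Ei"
  proof -
    have "transpose_mat Ei * E = transpose_mat (E * Ei)"
      using transpose_mult[OF E inv1] by (simp add: symE)
    then have "transpose_mat Ei * E = 1\<^sub>m m" by (simp add: inv2)
    then have "transpose_mat Ei * E * Ei = Ei" using inv1 by simp
    moreover have "transpose_mat Ei * E * Ei = transpose_mat Ei * (E * Ei)"
      by (rule assoc_mult_mat[OF Eit E inv1])
    ultimately show ?thesis using Eit by (simp add: inv2)
  qed
  define S where "S = P * B + Ct * D"
  define St where "St = Dt * C + Bt * P"
  have PB: "P * B \<in> carrier_mat n m" and CD: "Ct * D \<in> carrier_mat n m" and DC: "Dt * C \<in> carrier_mat m n"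
    and BP: "Bt * P \<in> carrier_mat m n" using P B C D t by simp_all
  have S: "S \<in> carrier_mat n m" and St: "St \<in> carrier_mat m n"
    using PB CD DC BP by (simp_all add: S_def St_def)
  have StS: "transpose_mat S = St"
    unfolding S_def St_def transpose_add[OF PB CD] transpose_mult[OF P B] transpose_mult[OF t(3) D] symP tt
      Bt_def[symmetric] Dt_def[symmetric]
    by (rule comm_add_mat[OF BP DC])
  then have SSt: "transpose_mat St = S" by auto
  define L where "L = P * A + At * P + Ct * C"
  have PA: "P * A \<in> carrier_mat n n" and AP: "At * P \<in> carrier_mat n n" and CC: "Ct * C \<in> carrier_mat n n"
    using P A C t by simp_all
  have PAAP: "P * A + At * P \<in> carrier_mat n n" using AP by simp
  have L: "L \<in> carrier_mat n n" unfolding L_def using CC by simp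
  have SE: "S * Ei \<in> carrier_mat n m" using S inv1 by simp
  have SES: "S * Ei * St \<in> carrier_mat n n" using SE St by simp
  define M where "M = L - S * Ei * St"
  have M: "M \<in> carrier_mat n n" unfolding M_def by (rule minus_carrier_mat[OF SES])
  have symL: "transpose_mat L = L"
  proof -
    have "transpose_mat L = At * P + P * A + Ct * C"
      unfolding L_def transpose_add[OF PAAP CC] transpose_add[OF PA AP] transpose_mult[OF P A]
        transpose_mult[OF t(1) P] transpose_mult[OF t(3) C] symP tt At_def[symmetric] Ct_def[symmetric] ..
    then show ?thesis unfolding L_def using comm_add_mat[OF AP PA] by simp
  qed
  have symM: "transpose_mat M = M"
  proof -
    have "transpose_mat (S * Ei * St) = S * (Ei * St)"
      unfolding transpose_mult[OF SE St] transpose_mult[OF S inv1] symEi StS SSt ..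
    also have "\<dots> = S * Ei * St" by (rule assoc_mult_mat[OF S inv1 St, symmetric])
    finally show ?thesis unfolding M_def transpose_minus[OF L SES] symL by simp
  qed
  have "v \<bullet> (M *\<^sub>v v) < 0" if v: "v \<in> carrier_vec n" "v \<noteq> 0\<^sub>v n" for v
  proof -
    define w where "w = St *\<^sub>v v"
    have w: "w \<in> carrier_vec m" using St v by (simp add: w_def)
    \<comment> \<open>the worst input for the state \<open>v\<close>\<close>
    define u where "u = - (Ei *\<^sub>v w)"
    have Eiw: "Ei *\<^sub>v w \<in> carrier_vec m" using inv1 w by simp
    have u: "u \<in> carrier_vec m" using Eiw by (simp add: u_def)
    have Pv: "P *\<^sub>v v \<in> carrier_vec n" and Av: "A *\<^sub>v v \<in> carrier_vec n" and Cv: "C *\<^sub>v v \<in> carrier_vec p"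
      using P A C v by simp_all
    have Bu: "B *\<^sub>v u \<in> carrier_vec n" and Du: "D *\<^sub>v u \<in> carrier_vec p" using B D u by simp_all
    have wu: "w \<bullet> u = (P *\<^sub>v v) \<bullet> (B *\<^sub>v u) + (C *\<^sub>v v) \<bullet> (D *\<^sub>v u)"
    proof -
      have "w = Dt *\<^sub>v (C *\<^sub>v v) + Bt *\<^sub>v (P *\<^sub>v v)"
        unfolding w_def St_def add_mult_distrib_mat_vec[OF DC BP v(1)]
          assoc_mult_mat_vec[OF t(4) C v(1)] assoc_mult_mat_vec[OF t(2) P v(1)] ..
      moreover have "Dt *\<^sub>v (C *\<^sub>v v) \<in> carrier_vec m" "Bt *\<^sub>v (P *\<^sub>v v) \<in> carrier_vec m"
        using t Cv Pv by simp_all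
      ultimately have "w \<bullet> u = (Dt *\<^sub>v (C *\<^sub>v v)) \<bullet> u + (Bt *\<^sub>v (P *\<^sub>v v)) \<bullet> u"
        using u by (simp only: add_scalar_prod_distrib)
      then show ?thesis
        using swap[OF D u Cv] swap[OF B u Pv] by (simp add: Dt_def Bt_def)
    qed
    have Eu: "E *\<^sub>v u = - w"
    proof -
      have "E *\<^sub>v (Ei *\<^sub>v w) = w" using assoc_mult_mat_vec[OF E inv1 w] w by (simp add: inv2)
      moreover have "E *\<^sub>v u = - (E *\<^sub>v (Ei *\<^sub>v w))"
      proof -
        have "u = (- 1) \<cdot>\<^sub>v (Ei *\<^sub>v w)" unfolding u_def by (intro eq_vecI) auto
        then have "E *\<^sub>v u = (- 1) \<cdot>\<^sub>v (E *\<^sub>v (Ei *\<^sub>v w))" using mult_mat_vec[OF E Eiw] by simp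
        then show ?thesis by (intro eq_vecI) auto
      qed
      ultimately show ?thesis by simp
    qed
    have uEu': "u \<bullet> (E *\<^sub>v u) = - (w \<bullet> u)"
      unfolding Eu using u w comm_scalar_prod[OF u w] by simp
    have vLv: "v \<bullet> (L *\<^sub>v v) = 2 * ((P *\<^sub>v v) \<bullet> (A *\<^sub>v v)) + (C *\<^sub>v v) \<bullet> (C *\<^sub>v v)"
    proof -
      have PAv: "P *\<^sub>v (A *\<^sub>v v) \<in> carrier_vec n" and APv: "At *\<^sub>v (P *\<^sub>v v) \<in> carrier_vec n"
        and CCv: "Ct *\<^sub>v (C *\<^sub>v v) \<in> carrier_vec n" using P t Av Pv Cv by simp_all
      have "L *\<^sub>v v = P *\<^sub>v (A *\<^sub>v v) + At *\<^sub>v (P *\<^sub>v v) + Ct *\<^sub>v (C *\<^sub>v v)"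
        unfolding L_def add_mult_distrib_mat_vec[OF PAAP CC v(1)] add_mult_distrib_mat_vec[OF PA AP v(1)]
          assoc_mult_mat_vec[OF P A v(1)] assoc_mult_mat_vec[OF t(1) P v(1)] assoc_mult_mat_vec[OF t(3) C v(1)] ..
      then have "v \<bullet> (L *\<^sub>v v) = v \<bullet> (P *\<^sub>v (A *\<^sub>v v)) + v \<bullet> (At *\<^sub>v (P *\<^sub>v v)) + v \<bullet> (Ct *\<^sub>v (C *\<^sub>v v))"
        using scalar_prod_add_distrib[OF v(1) add_carrier_vec[OF PAv APv] CCv]
          scalar_prod_add_distrib[OF v(1) PAv APv] by simp
      then show ?thesis
        using swap[OF P Av v(1)] swap[OF t(1) Pv v(1)] swap[OF t(3) Cv v(1)] comm_scalar_prod[OF Av Pv]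
        by (simp add: symP tt)
    qed
    have "v \<bullet> (M *\<^sub>v v) = v \<bullet> (L *\<^sub>v v) - w \<bullet> (Ei *\<^sub>v w)"
    proof -
      have Lv: "L *\<^sub>v v \<in> carrier_vec n" using L v by simp
      have SEw: "S *\<^sub>v (Ei *\<^sub>v w) \<in> carrier_vec n" using S Eiw by simp
      have "M *\<^sub>v v = L *\<^sub>v v - S *\<^sub>v (Ei *\<^sub>v w)"
        unfolding M_def minus_mult_distrib_mat_vec[OF L SES v(1)] assoc_mult_mat_vec[OF SE St v(1)]
          w_def[symmetric] assoc_mult_mat_vec[OF S inv1 w] ..
      then show ?thesis
        using scalar_prod_minus_distrib[OF v(1) Lv SEw] swap[OF S Eiw v(1)] by (simp add: StS w_def)
    qed
    also have "w \<bullet> (Ei *\<^sub>v w) = - (w \<bullet> u)" unfolding u_def using w inv1 by simp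
    also have "v \<bullet> (L *\<^sub>v v) - - (w \<bullet> u) =
        2 * ((P *\<^sub>v v) \<bullet> (A *\<^sub>v v + B *\<^sub>v u)) + (C *\<^sub>v v + D *\<^sub>v u) \<bullet> (C *\<^sub>v v + D *\<^sub>v u) - \<delta>\<^sup>2 * (u \<bullet> u)"
    proof -
      have "(C *\<^sub>v v + D *\<^sub>v u) \<bullet> (C *\<^sub>v v + D *\<^sub>v u) =
          (C *\<^sub>v v) \<bullet> (C *\<^sub>v v) + 2 * ((C *\<^sub>v v) \<bullet> (D *\<^sub>v u)) + (D *\<^sub>v u) \<bullet> (D *\<^sub>v u)"
        using add_scalar_prod_distrib[OF Cv Du add_carrier_vec[OF Cv Du]]
          scalar_prod_add_distrib[OF Cv Cv Du] scalar_prod_add_distrib[OF Du Cv Du] comm_scalar_prod[OF Du Cv]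
        by simp
      then show ?thesis
        using scalar_prod_add_distrib[OF Pv Av Bu] uEu[OF u] uEu' wu vLv by (simp add: algebra_simps)
    qed
    also have "\<dots> \<le> - \<kappa> * (v \<bullet> v + u \<bullet> u)" by (rule dis[OF v(1) u])
    also have "\<dots> < 0"
    proof -
      have "0 \<le> u \<bullet> u" using vv[OF u] u by (cases "u = 0\<^sub>v m") auto
      then have "0 < v \<bullet> v + u \<bullet> u" using vv[OF v] by simp
      then show ?thesis using \<kappa> by simp
    qed
    finally show ?thesis .
  qed
  then have "negative_definite M"
    unfolding negative_definite_def using M symM by auto
  then show ?thesis
    unfolding M_def L_def S_def St_def Ei_def E_def At_def Bt_def Ct_def Dt_def .
qed

section \<open>Composition of the block storage functions\<close>

lemma smult_mat_mult_vec:
  fixes M :: "'a :: comm_ring_1 mat"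
  assumes M: "M \<in> carrier_mat a b" and v: "v \<in> carrier_vec b"
  shows "(q \<cdot>\<^sub>m M) *\<^sub>v v = q \<cdot>\<^sub>v (M *\<^sub>v v)"
proof (rule eq_vecI)
  fix i assume "i < dim_vec (q \<cdot>\<^sub>v (M *\<^sub>v v))"
  then have i: "i < a" using M by simp
  have qM: "q \<cdot>\<^sub>m M \<in> carrier_mat a b" using M by simp
  have "((q \<cdot>\<^sub>m M) *\<^sub>v v) $ i = q * (M *\<^sub>v v) $ i"
    unfolding mult_mat_vec_index[OF qM v i] mult_mat_vec_index[OF M v i]
    using M i by (simp add: sum_distrib_left mult.assoc)
  then show "((q \<cdot>\<^sub>m M) *\<^sub>v v) $ i = (q \<cdot>\<^sub>v (M *\<^sub>v v)) $ i"
    using M i by (simp del: index_mult_mat_vec)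
qed (use M in simp)

lemma positive_definite_smult:
  fixes P :: "real mat"
  assumes P: "P \<in> carrier_mat k k" and pd: "positive_definite P" and q: "0 < q"
  shows "positive_definite (q \<cdot>\<^sub>m P)"
  unfolding positive_definite_def
proof (intro conjI ballI impI)
  show "square_mat (q \<cdot>\<^sub>m P)" using P by simp
  have "transpose_mat (q \<cdot>\<^sub>m P) = q \<cdot>\<^sub>m transpose_mat P" by (intro eq_matI) auto
  then show "transpose_mat (q \<cdot>\<^sub>m P) = q \<cdot>\<^sub>m P" using pd by (simp add: positive_definite_def)
  fix v :: "real vec" assume v: "v \<in> carrier_vec (dim_row (q \<cdot>\<^sub>m P))" "v \<noteq> 0\<^sub>v (dim_row (q \<cdot>\<^sub>m P))"
  have "(q \<cdot>\<^sub>m P) *\<^sub>v v = q \<cdot>\<^sub>v (P *\<^sub>v v)" using smult_mat_mult_vec[OF P] P v by simp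
  moreover have "0 < v \<bullet> (P *\<^sub>v v)" using pd v by (simp add: positive_definite_def)
  ultimately show "0 < v \<bullet> ((q \<cdot>\<^sub>m P) *\<^sub>v v)" using P v q by simp
qed

lemma sum_Plus_case:
  assumes "finite A" "finite B"
  shows "(\<Sum>j\<in>A <+> B. f j) = (\<Sum>j\<in>A. f (Inl j)) + (\<Sum>l\<in>B. f (Inr l))"
  using assms by (simp add: sum.Plus)

text \<open>The output blocks are estimated through their gains, with the same test vector \<open>(\<xi>, v)\<close> that weights the
state and input blocks.\<close>

lemma output_gain:
  fixes C D :: "real mat"
  assumes C: "C \<in> carrier_mat (offset p n_out) (offset k n)" and D: "D \<in> carrier_mat (offset p n_out) (offset m n_in)"
    and k: "\<And>j. j < n \<Longrightarrow> k j > 0" and m: "\<And>l. l < n_in \<Longrightarrow> m l > 0"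
    and x: "x \<in> carrier_vec (offset k n)" and u: "u \<in> carrier_vec (offset m n_in)"
    and \<xi>: "\<And>j. j < n \<Longrightarrow> 0 < \<xi> j" and v: "\<And>l. l < n_in \<Longrightarrow> 0 < v l"
    and h: "\<And>q j. h q j = spectral_norm (complex_mat (block p k C q j))"
    and g: "\<And>q l. g q l = spectral_norm (complex_mat (block p m D q l))"
  shows "(C *\<^sub>v x + D *\<^sub>v u) \<bullet> (C *\<^sub>v x + D *\<^sub>v u) \<le>
    (\<Sum>q<n_out. ((\<Sum>j<n. h q j * \<xi> j) + (\<Sum>l<n_in. g q l * v l)) *
      ((\<Sum>j<n. h q j * (vec_block k x j \<bullet> vec_block k x j) / \<xi> j) +
       (\<Sum>l<n_in. g q l * (vec_block m u l \<bullet> vec_block m u l) / v l)))"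
proof -
  define Y where "Y = C *\<^sub>v x + D *\<^sub>v u"
  let ?c = "map_vec complex_of_real"
  have Y: "Y \<in> carrier_vec (offset p n_out)" unfolding Y_def using C D x u by simp
  have sq: "w \<bullet> w = norm_sq (?c w)" for w :: "real vec"
    by (simp add: norm_sq_of_real real_scalar_prod_sum[OF carrier_vecI[OF refl]] power2_eq_square)
  have blk: "norm_sq (?c (M *\<^sub>v w)) \<le> (spectral_norm (complex_mat M))\<^sup>2 * (w \<bullet> w)"
    if M: "M \<in> carrier_mat a b" and b: "b > 0" and w: "w \<in> carrier_vec b" for M a b w
  proof -
    have "complex_mat M \<in> carrier_mat a b" "?c w \<in> carrier_vec b" using M w by simp_all
    from norm_sq_mult_le_spectral_norm[OF this(1) b this(2)] show ?thesis
      by (simp add: sq complex_mat_mult_of_real[OF M w])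
  qed
  have "vec_block p Y q \<bullet> vec_block p Y q \<le> ((\<Sum>j<n. h q j * \<xi> j) + (\<Sum>l<n_in. g q l * v l)) *
      ((\<Sum>j<n. h q j * (vec_block k x j \<bullet> vec_block k x j) / \<xi> j) +
       (\<Sum>l<n_in. g q l * (vec_block m u l \<bullet> vec_block m u l) / v l))" if q: "q < n_out" for q
  proof -
    define S where "S = ({..<n} <+> {..<n_in} :: (nat + nat) set)"
    have S: "finite S" by (simp add: S_def)
    define z where "z = case_sum (\<lambda>j. ?c (block p k C q j *\<^sub>v vec_block k x j)) (\<lambda>l. ?c (block p m D q l *\<^sub>v vec_block m u l))"
    have Cb: "block p k C q j \<in> carrier_mat (p q) (k j)" if "j < n" for j by (rule block_carrier[OF C q that])
    have Db: "block p m D q l \<in> carrier_mat (p q) (m l)" if "l < n_in" for l by (rule block_carrier[OF D q that])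
    have "norm_sq (?c (vec_block p Y q)) \<le> (\<Sum>j\<in>S. case_sum (h q) (g q) j * case_sum \<xi> v j) *
        (\<Sum>j\<in>S. case_sum (h q) (g q) j * case_sum (\<lambda>j. vec_block k x j \<bullet> vec_block k x j) (\<lambda>l. vec_block m u l \<bullet> vec_block m u l) j / case_sum \<xi> v j)"
    proof (rule norm_sq_sum_le_weighted[OF S, where z = z and k = "p q"])
      fix j assume "j \<in> S"
      then consider a where "j = Inl a" "a < n" | l where "j = Inr l" "l < n_in" by (auto simp: S_def)
      note cases = this
      show "z j \<in> carrier_vec (p q)"
        using cases
      proof cases
        case (1 a)
        then show ?thesis using Cb[of a] by (simp add: z_def)
      next
        case (2 l)
        then show ?thesis using Db[of l] by (simp add: z_def)
      qed
      show "0 \<le> case_sum (h q) (g q) j"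
        using cases
      proof cases
        case (1 a)
        then show ?thesis using spectral_norm_nonneg[of "complex_mat (block p k C q a)"] Cb[of a] k[of a] by (simp add: h)
      next
        case (2 l)
        then show ?thesis using spectral_norm_nonneg[of "complex_mat (block p m D q l)"] Db[of l] m[of l] by (simp add: g)
      qed
      show "0 < case_sum \<xi> v j" using cases \<xi> v by cases simp_all
      show "norm_sq (z j) \<le> (case_sum (h q) (g q) j)\<^sup>2 *
          case_sum (\<lambda>j. vec_block k x j \<bullet> vec_block k x j) (\<lambda>l. vec_block m u l \<bullet> vec_block m u l) j"
        using cases
      proof cases
        case (1 a)
        then show ?thesis using blk[OF Cb[of a] k[of a] vec_block_carrier[of k x a]] by (simp add: z_def h)
      next
        case (2 l)
        then show ?thesis using blk[OF Db[of l] m[of l] vec_block_carrier[of m u l]] by (simp add: z_def g)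
      qed
    next
      show "?c (vec_block p Y q) \<in> carrier_vec (p q)" by simp
      fix r assume r: "r < p q"
      have a: "offset p q + r < offset p n_out" by (rule offset_add_less[where k = p, OF q r])
      have "Y $ (offset p q + r) = (C *\<^sub>v x) $ (offset p q + r) + (D *\<^sub>v u) $ (offset p q + r)"
        unfolding Y_def using D a by (simp del: index_mult_mat_vec)
      also have "\<dots> = (\<Sum>j<n. (block p k C q j *\<^sub>v vec_block k x j) $ r) + (\<Sum>l<n_in. (block p m D q l *\<^sub>v vec_block m u l) $ r)"
        by (simp only: mult_mat_vec_blocks[where k = p, OF C x q r] mult_mat_vec_blocks[where k = p, OF D u q r])
      finally have e: "Y $ (offset p q + r) = \<dots>" .
      have zl: "z (Inl j) $ r = complex_of_real ((block p k C q j *\<^sub>v vec_block k x j) $ r)" if "j < n" for j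
        using Cb[OF that] r by (simp add: z_def del: index_mult_mat_vec)
      have zr: "z (Inr l) $ r = complex_of_real ((block p m D q l *\<^sub>v vec_block m u l) $ r)" if "l < n_in" for l
        using Db[OF that] r by (simp add: z_def del: index_mult_mat_vec)
      have "(\<Sum>j\<in>S. z j $ r) = complex_of_real (Y $ (offset p q + r))"
        unfolding S_def e by (simp add: sum_Plus_case zl zr del: index_mult_mat_vec)
      then show "?c (vec_block p Y q) $ r = (\<Sum>j\<in>S. z j $ r)"
        using r by (simp add: vec_block_def)
    qed
    then show ?thesis unfolding S_def sq[symmetric] by (simp add: sum_Plus_case)
  qed
  then show ?thesis
    unfolding Y_def[symmetric] scalar_prod_blocks[OF Y] by (intro sum_mono) auto
qed

text \<open>The storage matrices of the blocks are added with the weights \<open>\<eta> i / \<xi> i\<close>. Up to multiples of \<open>\<kappa>\<close>, the coefficient of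
\<open>\<bar>x\<^sub>j\<bar>\<^sup>2\<close> in the sum is then \<open>(F\<^sup>T \<eta> + H\<^sup>T y)\<^sub>j / \<xi>\<^sub>j\<close>, where \<open>F\<^sub>j\<^sub>j = -1\<close> accounts for the
block's own decay, and that of \<open>\<bar>u\<^sub>l\<bar>\<^sup>2\<close> is \<open>(G\<^sup>T \<eta> + J\<^sup>T y)\<^sub>l / v\<^sub>l - \<delta>\<^sup>2\<close>. Both are negative by the choice
of the test vectors.\<close>

lemma block_diagonal_dissipation:
  fixes A B C D :: "real mat"
  assumes n: "n > 0" and n_in: "n_in > 0"
    and k: "\<And>i. i < n \<Longrightarrow> k i > 0" and m: "\<And>l. l < n_in \<Longrightarrow> m l > 0"
    and A: "A \<in> carrier_mat (offset k n) (offset k n)" and B: "B \<in> carrier_mat (offset k n) (offset m n_in)"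
    and C: "C \<in> carrier_mat (offset p n_out) (offset k n)" and D: "D \<in> carrier_mat (offset p n_out) (offset m n_in)"
    and stable: "\<And>i. i < n \<Longrightarrow> hurwitz (block k k A i i)"
    and F: "F = comparison_F n k A" and G: "G = comparison_G n n_in k m A B"
    and H: "H = comparison_H n_out n p k C" and J: "J = comparison_J n_out n_in p m D"
    and stableF: "hurwitz F" and gain: "hinf_norm (transfer_function F G H J) < \<delta>"
  obtains Ps \<kappa> where
    "\<And>i. i < n \<Longrightarrow> Ps i \<in> carrier_mat (k i) (k i)" "\<And>i. i < n \<Longrightarrow> positive_definite (Ps i)" "0 < \<kappa>"
    "strictly_dissipative (diag_block_mat (map Ps [0..<n])) A B C D \<delta> \<kappa>"
proof -
  have Ab: "block k k A i j \<in> carrier_mat (k i) (k j)" if "i < n" "j < n" for i j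
    by (rule block_carrier[OF A that])
  have Bb: "block k m B i l \<in> carrier_mat (k i) (m l)" if "i < n" "l < n_in" for i l
    by (rule block_carrier[OF B that])
  have Cb: "block p k C q j \<in> carrier_mat (p q) (k j)" if "q < n_out" "j < n" for q j
    by (rule block_carrier[OF C that])
  have Db: "block p m D q l \<in> carrier_mat (p q) (m l)" if "q < n_out" "l < n_in" for q l
    by (rule block_carrier[OF D that])
  have Fd: "F $$ (i, i) = - 1" if "i < n" for i using that by (simp add: F comparison_F_def)
  have Fo: "F $$ (i, j) = hinf_norm (\<lambda>s. resolvent (block k k A i i) s * complex_mat (block k k A i j))"
    if "i < n" "j < n" "i \<noteq> j" for i j using that by (simp add: F comparison_F_def)
  have Ge: "G $$ (i, l) = hinf_norm (\<lambda>s. resolvent (block k k A i i) s * complex_mat (block k m B i l))"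
    if "i < n" "l < n_in" for i l using that by (simp add: G comparison_G_def)
  have He: "H $$ (q, j) = spectral_norm (complex_mat (block p k C q j))" if "q < n_out" "j < n" for q j
    using that by (simp add: H comparison_H_def)
  have Je: "J $$ (q, l) = spectral_norm (complex_mat (block p m D q l))" if "q < n_out" "l < n_in" for q l
    using that by (simp add: J comparison_J_def)
  have carr: "F \<in> carrier_mat n n" "G \<in> carrier_mat n n_in" "H \<in> carrier_mat n_out n" "J \<in> carrier_mat n_out n_in"
    by (simp_all add: F G H J comparison_F_def comparison_G_def comparison_H_def comparison_J_def)
  have F0: "0 \<le> F $$ (i, j)" if "i < n" "j < n" "i \<noteq> j" for i j
    unfolding Fo[OF that] by (rule hinf_norm_resolvent(1)[OF Ab[OF that(1,1)] stable k Ab k]) (use that in auto)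
  have G0: "0 \<le> G $$ (i, l)" if "i < n" "l < n_in" for i l
    unfolding Ge[OF that] by (rule hinf_norm_resolvent(1)[OF Ab[OF that(1,1)] stable k Bb m]) (use that in auto)
  have H0: "0 \<le> H $$ (q, j)" if "q < n_out" "j < n" for q j
    unfolding He[OF that] using spectral_norm_nonneg[of "complex_mat (block p k C q j)"] Cb[OF that] k[OF that(2)] by simp
  have J0: "0 \<le> J $$ (q, l)" if "q < n_out" "l < n_in" for q l
    unfolding Je[OF that] using spectral_norm_nonneg[of "complex_mat (block p m D q l)"] Db[OF that] m[OF that(2)] by simp
  obtain \<xi> \<eta> v y where \<xi>: "\<And>i. i < n \<Longrightarrow> 0 < \<xi> i" and \<eta>: "\<And>i. i < n \<Longrightarrow> 0 < \<eta> i" and v: "\<And>l. l < n_in \<Longrightarrow> 0 < v l"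
    and y: "\<And>q. q < n_out \<Longrightarrow> y q = (\<Sum>j<n. H $$ (q, j) * \<xi> j) + (\<Sum>l<n_in. J $$ (q, l) * v l)"
    and s1: "\<And>i. i < n \<Longrightarrow> (\<Sum>j<n. F $$ (i, j) * \<xi> j) + (\<Sum>l<n_in. G $$ (i, l) * v l) < 0"
    and s2: "\<And>j. j < n \<Longrightarrow> (\<Sum>i<n. F $$ (i, j) * \<eta> i) + (\<Sum>q<n_out. H $$ (q, j) * y q) < 0"
    and s3: "\<And>l. l < n_in \<Longrightarrow> (\<Sum>i<n. G $$ (i, l) * \<eta> i) + (\<Sum>q<n_out. J $$ (q, l) * y q) < \<delta>\<^sup>2 * v l"
    by (rule comparison_vectors[OF carr n n_in stableF F0 G0 H0 J0 gain]) blast+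
  define w where "w i = \<eta> i / \<xi> i" for i
  have w: "0 < w i" if "i < n" for i using \<xi>[OF that] \<eta>[OF that] by (simp add: w_def)
  define W where "W = (\<Sum>i<n. w i)"
  have W: "0 \<le> W" unfolding W_def using w by (intro sum_nonneg) (auto intro: less_imp_le)
  define c where "c j = ((\<Sum>i<n. F $$ (i, j) * \<eta> i) + (\<Sum>q<n_out. H $$ (q, j) * y q)) / \<xi> j" for j
  define e where "e l = ((\<Sum>i<n. G $$ (i, l) * \<eta> i) + (\<Sum>q<n_out. J $$ (q, l) * y q)) / v l" for l
  have c: "c j < 0" if "j < n" for j unfolding c_def using s2[OF that] \<xi>[OF that] by (simp add: divide_neg_pos)
  have e: "e l < \<delta>\<^sup>2" if "l < n_in" for l unfolding e_def using s3[OF that] v[OF that] by (simp add: pos_divide_less_eq)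
  obtain \<kappa>1 where \<kappa>1: "\<kappa>1 > 0" "\<And>j. j < n \<Longrightarrow> c j + \<kappa>1 * (W + 1) < 0"
    using uniform_small_perturbation[of n c "\<lambda>_. 0" "\<lambda>_. W + 1"] c by blast
  obtain \<kappa>2 where \<kappa>2: "\<kappa>2 > 0" "\<And>l. l < n_in \<Longrightarrow> e l + \<kappa>2 * (W + 1) < \<delta>\<^sup>2"
    using uniform_small_perturbation[of n_in e "\<lambda>_. \<delta>\<^sup>2" "\<lambda>_. W + 1"] e by blast
  \<comment> \<open>of the slack \<open>\<kappa> * (W + 1)\<close>, the part \<open>\<kappa>\<close> remains as the margin of strict dissipation\<close>
  define \<kappa> where "\<kappa> = min \<kappa>1 \<kappa>2"
  have \<kappa>: "0 < \<kappa>" using \<kappa>1 \<kappa>2 by (simp add: \<kappa>_def)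
  have c\<kappa>: "c j + \<kappa> * W \<le> - \<kappa>" if "j < n" for j
  proof -
    have "\<kappa> * (W + 1) \<le> \<kappa>1 * (W + 1)" using W by (intro mult_right_mono) (simp_all add: \<kappa>_def)
    then show ?thesis using \<kappa>1(2)[OF that] by (simp add: algebra_simps)
  qed
  have e\<kappa>: "e l + \<kappa> * W - \<delta>\<^sup>2 \<le> - \<kappa>" if "l < n_in" for l
  proof -
    have "\<kappa> * (W + 1) \<le> \<kappa>2 * (W + 1)" using W by (intro mult_right_mono) (simp_all add: \<kappa>_def)
    then show ?thesis using \<kappa>2(2)[OF that] by (simp add: algebra_simps)
  qed
  \<comment> \<open>the inputs of block \<open>i\<close>: the other blocks (left summand) and the external inputs (right summand)\<close>
  define S where "S i = (({..<n} - {i}) <+> {..<n_in} :: (nat + nat) set)" for i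
  define Z where "Z i = case_sum (\<lambda>j. block k k A i j) (\<lambda>l. block k m B i l)" for i
  define \<phi> where "\<phi> i = case_sum (\<lambda>j. F $$ (i, j)) (\<lambda>l. G $$ (i, l))" for i
  have sumS: "(\<Sum>j\<in>S i. f j) = (\<Sum>j\<in>{..<n} - {i}. f (Inl j)) + (\<Sum>l<n_in. f (Inr l))" for i and f :: "nat + nat \<Rightarrow> real"
    unfolding S_def by (rule sum_Plus_case) simp_all
  define storage_for where "storage_for i P \<longleftrightarrow> P \<in> carrier_mat (k i) (k i) \<and> positive_definite P \<and>
      (\<forall>x z. x \<in> carrier_vec (k i) \<longrightarrow> (\<forall>j\<in>S i. z j \<in> carrier_vec (case_sum k m j)) \<longrightarrow>
        2 * ((P *\<^sub>v x) \<bullet> (block k k A i i *\<^sub>v x + vec (k i) (\<lambda>r. \<Sum>j\<in>S i. (Z i j *\<^sub>v z j) $ r))) + x \<bullet> x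
          \<le> (\<Sum>j\<in>S i. (\<phi> i j * \<xi> i / case_sum \<xi> v j + \<kappa>) * (z j \<bullet> z j)))" for i P
  have "\<exists>P. storage_for i P" if i: "i < n" for i
  proof -
    have fin: "finite (S i)" by (simp add: S_def)
    have d: "case_sum k m j > 0" if j: "j \<in> S i" for j
    proof (cases j)
      case (Inl a)
      then have "a < n" using j by (auto simp: S_def)
      then show ?thesis using k[of a] Inl by simp
    next
      case (Inr l)
      then have "l < n_in" using j by (auto simp: S_def)
      then show ?thesis using m[of l] Inr by simp
    qed
    have Zc: "Z i j \<in> carrier_mat (k i) (case_sum k m j)" if "j \<in> S i" for j
      using that Ab[OF i] Bb[OF i] by (auto simp: S_def Z_def)
    have \<phi>e: "\<phi> i j = hinf_norm (\<lambda>s. resolvent (block k k A i i) s * complex_mat (Z i j))" if "j \<in> S i" for j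
      using that by (auto simp: S_def Z_def \<phi>_def intro!: Fo[OF i] Ge[OF i])
    have \<chi>: "0 < case_sum \<xi> v j" if "j \<in> S i" for j using that \<xi> v by (auto simp: S_def)
    have "(\<Sum>j<n. F $$ (i, j) * \<xi> j) = - \<xi> i + (\<Sum>j\<in>{..<n} - {i}. F $$ (i, j) * \<xi> j)"
      using i by (subst sum.remove[of _ i]) (auto simp: Fd)
    then have le: "(\<Sum>j\<in>S i. \<phi> i j * case_sum \<xi> v j) \<le> \<xi> i"
      unfolding sumS using s1[OF i] by (simp add: \<phi>_def)
    obtain P where "P \<in> carrier_mat (k i) (k i)" "positive_definite P"
      "\<And>x z. x \<in> carrier_vec (k i) \<Longrightarrow> (\<And>j. j \<in> S i \<Longrightarrow> z j \<in> carrier_vec (case_sum k m j)) \<Longrightarrow>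
        2 * ((P *\<^sub>v x) \<bullet> (block k k A i i *\<^sub>v x + vec (k i) (\<lambda>r. \<Sum>j\<in>S i. (Z i j *\<^sub>v z j) $ r))) + x \<bullet> x
          \<le> (\<Sum>j\<in>S i. (\<phi> i j * \<xi> i / case_sum \<xi> v j + \<kappa>) * (z j \<bullet> z j))"
      by (rule subsystem_dissipation[where Z = "Z i" and \<phi> = "\<phi> i" and d = "case_sum k m" and \<chi> = "case_sum \<xi> v"
            and S = "S i" and \<xi> = "\<xi> i" and \<kappa> = \<kappa>, OF Ab[OF i i] stable[OF i] k[OF i] fin d Zc \<phi>e \<chi> le \<xi>[OF i] \<kappa>]) blast+
    then show ?thesis unfolding storage_for_def by blast
  qed
  then obtain P where "\<And>i. i < n \<Longrightarrow> storage_for i (P i)" by metis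
  then have P: "\<And>i. i < n \<Longrightarrow> P i \<in> carrier_mat (k i) (k i)" "\<And>i. i < n \<Longrightarrow> positive_definite (P i)"
    and sub: "\<And>i x z. i < n \<Longrightarrow> x \<in> carrier_vec (k i) \<Longrightarrow> (\<forall>j\<in>S i. z j \<in> carrier_vec (case_sum k m j)) \<Longrightarrow>
        2 * ((P i *\<^sub>v x) \<bullet> (block k k A i i *\<^sub>v x + vec (k i) (\<lambda>r. \<Sum>j\<in>S i. (Z i j *\<^sub>v z j) $ r))) + x \<bullet> x
          \<le> (\<Sum>j\<in>S i. (\<phi> i j * \<xi> i / case_sum \<xi> v j + \<kappa>) * (z j \<bullet> z j))"
    unfolding storage_for_def by blast+
  define Ps where "Ps i = w i \<cdot>\<^sub>m P i" for i
  have Ps: "Ps i \<in> carrier_mat (k i) (k i)" if "i < n" for i using P(1)[OF that] by (simp add: Ps_def)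
  show ?thesis
  proof (rule that[OF Ps _ \<kappa>])
    show "positive_definite (Ps i)" if "i < n" for i
      unfolding Ps_def by (rule positive_definite_smult[OF P(1)[OF that] P(2)[OF that] w[OF that]])
    show "strictly_dissipative (diag_block_mat (map Ps [0..<n])) A B C D \<delta> \<kappa>"
      unfolding strictly_dissipative_def
    proof (intro ballI)
      fix x u :: "real vec" assume "x \<in> carrier_vec (dim_row A)" "u \<in> carrier_vec (dim_col B)"
      then have x: "x \<in> carrier_vec (offset k n)" and u: "u \<in> carrier_vec (offset m n_in)" using A B by simp_all
      define X where "X j = vec_block k x j \<bullet> vec_block k x j" for j
      define U where "U l = vec_block m u l \<bullet> vec_block m u l" for l
      define V where "V = A *\<^sub>v x + B *\<^sub>v u"
      have V: "V \<in> carrier_vec (offset k n)" unfolding V_def using A B x u by simp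
      have X0: "0 \<le> X j" and U0: "0 \<le> U l" for j l
        unfolding X_def U_def real_scalar_prod_sum[OF vec_block_carrier] by (auto intro: sum_nonneg)
      define z where "z = case_sum (vec_block k x) (vec_block m u)"
      have Vb: "vec_block k V i = block k k A i i *\<^sub>v vec_block k x i + vec (k i) (\<lambda>r. \<Sum>j\<in>S i. (Z i j *\<^sub>v z j) $ r)"
        if i: "i < n" for i
      proof (rule eq_vecI)
        fix r assume "r < dim_vec (block k k A i i *\<^sub>v vec_block k x i + vec (k i) (\<lambda>r. \<Sum>j\<in>S i. (Z i j *\<^sub>v z j) $ r))"
        then have r: "r < k i" by simp
        have a: "offset k i + r < offset k n" by (rule offset_add_less[where k = k, OF i r])
        have "V $ (offset k i + r) = (A *\<^sub>v x) $ (offset k i + r) + (B *\<^sub>v u) $ (offset k i + r)"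
          unfolding V_def using B a by (simp del: index_mult_mat_vec)
        also have "\<dots> = (\<Sum>j<n. (block k k A i j *\<^sub>v vec_block k x j) $ r) + (\<Sum>l<n_in. (block k m B i l *\<^sub>v vec_block m u l) $ r)"
          by (simp only: mult_mat_vec_blocks[where k = k, OF A x i r] mult_mat_vec_blocks[where k = k, OF B u i r])
        also have "(\<Sum>j<n. (block k k A i j *\<^sub>v vec_block k x j) $ r) =
            (block k k A i i *\<^sub>v vec_block k x i) $ r + (\<Sum>j\<in>{..<n} - {i}. (block k k A i j *\<^sub>v vec_block k x j) $ r)"
          using i by (subst sum.remove[of _ i]) auto
        finally show "vec_block k V i $ r = (block k k A i i *\<^sub>v vec_block k x i + vec (k i) (\<lambda>r. \<Sum>j\<in>S i. (Z i j *\<^sub>v z j) $ r)) $ r"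
          using r by (simp add: sumS Z_def z_def del: index_mult_mat_vec)
      qed (simp add: vec_block_def)
      have sub': "2 * w i * ((P i *\<^sub>v vec_block k x i) \<bullet> vec_block k V i) \<le>
          (\<Sum>j<n. (F $$ (i, j) * \<eta> i / \<xi> j + w i * \<kappa>) * X j) + (\<Sum>l<n_in. (G $$ (i, l) * \<eta> i / v l + w i * \<kappa>) * U l)"
        if i: "i < n" for i
      proof -
        define t where "t = (P i *\<^sub>v vec_block k x i) \<bullet> vec_block k V i"
        have "\<forall>j\<in>S i. z j \<in> carrier_vec (case_sum k m j)" by (auto simp: S_def z_def)
        from sub[OF i vec_block_carrier[of k x i] this]
        have "2 * t + X i \<le> (\<Sum>j\<in>S i. (\<phi> i j * \<xi> i / case_sum \<xi> v j + \<kappa>) * (z j \<bullet> z j))"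
          unfolding Vb[OF i, symmetric] t_def X_def .
        also have "\<dots> = (\<Sum>j\<in>{..<n} - {i}. (F $$ (i, j) * \<xi> i / \<xi> j + \<kappa>) * X j) + (\<Sum>l<n_in. (G $$ (i, l) * \<xi> i / v l + \<kappa>) * U l)"
          unfolding sumS by (simp add: \<phi>_def z_def X_def U_def)
        finally have "w i * (2 * t + X i) \<le> w i * ((\<Sum>j\<in>{..<n} - {i}. (F $$ (i, j) * \<xi> i / \<xi> j + \<kappa>) * X j) + (\<Sum>l<n_in. (G $$ (i, l) * \<xi> i / v l + \<kappa>) * U l))"
          using w[OF i] by (intro mult_left_mono) auto
        also have "\<dots> = (\<Sum>j\<in>{..<n} - {i}. (F $$ (i, j) * \<eta> i / \<xi> j + w i * \<kappa>) * X j) + (\<Sum>l<n_in. (G $$ (i, l) * \<eta> i / v l + w i * \<kappa>) * U l)"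
        proof -
          have scale: "w i * ((f * \<xi> i / g + \<kappa>) * h) = (f * \<eta> i / g + w i * \<kappa>) * h" for f g h
            using \<xi>[OF i] by (simp add: w_def field_simps)
          show ?thesis unfolding distrib_left sum_distrib_left scale ..
        qed
        finally have a: "w i * (2 * t + X i) \<le> (\<Sum>j\<in>{..<n} - {i}. (F $$ (i, j) * \<eta> i / \<xi> j + w i * \<kappa>) * X j) + (\<Sum>l<n_in. (G $$ (i, l) * \<eta> i / v l + w i * \<kappa>) * U l)" .
        have b: "(\<Sum>j<n. (F $$ (i, j) * \<eta> i / \<xi> j + w i * \<kappa>) * X j) =
            (- w i + w i * \<kappa>) * X i + (\<Sum>j\<in>{..<n} - {i}. (F $$ (i, j) * \<eta> i / \<xi> j + w i * \<kappa>) * X j)"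
          using i by (subst sum.remove[of _ i]) (auto simp: Fd w_def)
        have "0 \<le> w i * \<kappa> * X i" using w[OF i] \<kappa> X0[of i] by simp
        then show ?thesis using a unfolding b t_def by (simp add: algebra_simps)
      qed
      have "(diag_block_mat (map Ps [0..<n]) *\<^sub>v x) \<bullet> V = (\<Sum>i<n. w i * ((P i *\<^sub>v vec_block k x i) \<bullet> vec_block k V i))"
        unfolding scalar_prod_blocks[OF V]
      proof (rule sum.cong[OF refl])
        fix i assume "i \<in> {..<n}"
        then have i: "i < n" by simp
        have Px: "P i *\<^sub>v vec_block k x i \<in> carrier_vec (k i)" using P(1)[OF i] by simp
        have "Ps i *\<^sub>v vec_block k x i = w i \<cdot>\<^sub>v (P i *\<^sub>v vec_block k x i)"
          unfolding Ps_def by (rule smult_mat_mult_vec[OF P(1)[OF i] vec_block_carrier[of k x i]])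
        then show "vec_block k (diag_block_mat (map Ps [0..<n]) *\<^sub>v x) i \<bullet> vec_block k V i = w i * ((P i *\<^sub>v vec_block k x i) \<bullet> vec_block k V i)"
          using diag_block_mat_mult_vec[OF Ps x i] smult_scalar_prod_distrib[OF Px vec_block_carrier[of k V i]] by simp
      qed
      then have "2 * ((diag_block_mat (map Ps [0..<n]) *\<^sub>v x) \<bullet> V) =
          (\<Sum>i<n. 2 * w i * ((P i *\<^sub>v vec_block k x i) \<bullet> vec_block k V i))"
        by (simp add: sum_distrib_left mult.assoc)
      also have "\<dots> \<le> (\<Sum>i<n. (\<Sum>j<n. (F $$ (i, j) * \<eta> i / \<xi> j + w i * \<kappa>) * X j) + (\<Sum>l<n_in. (G $$ (i, l) * \<eta> i / v l + w i * \<kappa>) * U l))"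
        by (intro sum_mono sub') simp
      also have "\<dots> = (\<Sum>j<n. ((\<Sum>i<n. F $$ (i, j) * \<eta> i) / \<xi> j + W * \<kappa>) * X j) +
          (\<Sum>l<n_in. ((\<Sum>i<n. G $$ (i, l) * \<eta> i) / v l + W * \<kappa>) * U l)"
      proof -
        have s: "(\<Sum>i<n. \<Sum>j<b. (f i j / g j + w i * \<kappa>) * h j) = (\<Sum>j<b. ((\<Sum>i<n. f i j) / g j + W * \<kappa>) * h j)"
          for b and f :: "nat \<Rightarrow> nat \<Rightarrow> real" and g h
          by (subst sum.swap) (simp add: sum_distrib_right sum_divide_distrib sum.distrib distrib_right W_def)
        show ?thesis unfolding sum.distrib s ..
      qed
      finally have storage: "2 * ((diag_block_mat (map Ps [0..<n]) *\<^sub>v x) \<bullet> V) \<le>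
          (\<Sum>j<n. ((\<Sum>i<n. F $$ (i, j) * \<eta> i) / \<xi> j + W * \<kappa>) * X j) +
          (\<Sum>l<n_in. ((\<Sum>i<n. G $$ (i, l) * \<eta> i) / v l + W * \<kappa>) * U l)" .
      have "(C *\<^sub>v x + D *\<^sub>v u) \<bullet> (C *\<^sub>v x + D *\<^sub>v u) \<le>
          (\<Sum>q<n_out. y q * ((\<Sum>j<n. H $$ (q, j) * X j / \<xi> j) + (\<Sum>l<n_in. J $$ (q, l) * U l / v l)))"
        using output_gain[OF C D k m x u \<xi> v refl refl] unfolding X_def U_def by (simp add: y He Je)
      also have "\<dots> = (\<Sum>j<n. (\<Sum>q<n_out. H $$ (q, j) * y q) / \<xi> j * X j) + (\<Sum>l<n_in. (\<Sum>q<n_out. J $$ (q, l) * y q) / v l * U l)"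
      proof -
        have s: "(\<Sum>q<n_out. \<Sum>j<b. y q * (f q j * h j / g j)) = (\<Sum>j<b. (\<Sum>q<n_out. f q j * y q) / g j * h j)"
          for b and f :: "nat \<Rightarrow> nat \<Rightarrow> real" and g h
          by (subst sum.swap) (simp add: sum_distrib_left sum_distrib_right sum_divide_distrib mult_ac)
        show ?thesis unfolding distrib_left sum_distrib_left sum.distrib s ..
      qed
      finally have supply_bound: "(C *\<^sub>v x + D *\<^sub>v u) \<bullet> (C *\<^sub>v x + D *\<^sub>v u) \<le> \<dots>" .
      have xx: "x \<bullet> x = (\<Sum>j<n. X j)" and uu: "u \<bullet> u = (\<Sum>l<n_in. U l)"
        unfolding X_def U_def scalar_prod_blocks[OF x] scalar_prod_blocks[OF u] by simp_all
      have "2 * ((diag_block_mat (map Ps [0..<n]) *\<^sub>v x) \<bullet> V) + (C *\<^sub>v x + D *\<^sub>v u) \<bullet> (C *\<^sub>v x + D *\<^sub>v u) - \<delta>\<^sup>2 * (u \<bullet> u) \<le>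
          (\<Sum>j<n. (c j + \<kappa> * W) * X j) + (\<Sum>l<n_in. (e l + \<kappa> * W - \<delta>\<^sup>2) * U l)"
      proof -
        have "(\<Sum>j<n. (c j + \<kappa> * W) * X j) = (\<Sum>j<n. ((\<Sum>i<n. F $$ (i, j) * \<eta> i) / \<xi> j + W * \<kappa>) * X j) +
            (\<Sum>j<n. (\<Sum>q<n_out. H $$ (q, j) * y q) / \<xi> j * X j)"
          unfolding sum.distrib[symmetric] by (intro sum.cong refl) (simp add: c_def add_divide_distrib algebra_simps)
        moreover have "(\<Sum>l<n_in. (e l + \<kappa> * W - \<delta>\<^sup>2) * U l) = (\<Sum>l<n_in. ((\<Sum>i<n. G $$ (i, l) * \<eta> i) / v l + W * \<kappa>) * U l) +
            (\<Sum>l<n_in. (\<Sum>q<n_out. J $$ (q, l) * y q) / v l * U l) - \<delta>\<^sup>2 * (\<Sum>l<n_in. U l)"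
          unfolding sum.distrib[symmetric] sum_distrib_left sum_subtractf[symmetric]
          by (intro sum.cong refl) (simp add: e_def add_divide_distrib algebra_simps)
        ultimately show ?thesis using storage supply_bound unfolding uu by linarith
      qed
      also have "\<dots> \<le> (\<Sum>j<n. - \<kappa> * X j) + (\<Sum>l<n_in. - \<kappa> * U l)"
        by (intro add_mono sum_mono mult_right_mono c\<kappa> e\<kappa> X0 U0) simp_all
      also have "\<dots> = - \<kappa> * (x \<bullet> x + u \<bullet> u)"
        unfolding xx uu sum_distrib_left[symmetric] by (simp add: algebra_simps)
      finally show "2 * ((diag_block_mat (map Ps [0..<n]) *\<^sub>v x) \<bullet> (A *\<^sub>v x + B *\<^sub>v u)) +
        (C *\<^sub>v x + D *\<^sub>v u) \<bullet> (C *\<^sub>v x + D *\<^sub>v u) - \<delta>\<^sup>2 * (u \<bullet> u) \<le> - \<kappa> * (x \<bullet> x + u \<bullet> u)"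
        unfolding V_def .
    qed
  qed
qed

theorem theorem1:
  fixes N N_in N_out n n_in n_out :: nat
    and k m p :: "nat \<Rightarrow> nat"
    and A B C D F G H J :: "real mat"
    and \<delta> :: real
  assumes "n > 0" and "n_in > 0" and "n_out > 0"
    and "\<And>i. i < n \<Longrightarrow> k i > 0"
    and "\<And>l. l < n_in \<Longrightarrow> m l > 0"
    and "\<And>q. q < n_out \<Longrightarrow> p q > 0"
    and "(\<Sum>i<n. k i) = N" and "(\<Sum>l<n_in. m l) = N_in" and "(\<Sum>q<n_out. p q) = N_out"
    and "A \<in> carrier_mat N N" and "B \<in> carrier_mat N N_in"
    and "C \<in> carrier_mat N_out N" and "D \<in> carrier_mat N_out N_in"
    and "\<And>i. i < n \<Longrightarrow> hurwitz (block k k A i i)"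
    and "F = comparison_F n k A"
    and "G = comparison_G n n_in k m A B"
    and "H = comparison_H n_out n p k C"
    and "J = comparison_J n_out n_in p m D"
    and "hurwitz F"
    and "hinf_norm (transfer_function F G H J) < \<delta>"
  shows "hurwitz A \<and> hinf_norm (transfer_function A B C D) < \<delta> \<and>
    (\<exists>Ps :: nat \<Rightarrow> real mat.
      (\<forall>i<n. Ps i \<in> carrier_mat (k i) (k i) \<and> positive_definite (Ps i)) \<and>
      (let P = diag_block_mat (map Ps [0..<n]) in
        negative_definite
          (P * A + transpose_mat A * P + transpose_mat C * C -
           (P * B + transpose_mat C * D) *
           mat_inv (transpose_mat D * D - \<delta>\<^sup>2 \<cdot>\<^sub>m 1\<^sub>m N_in) *
           (transpose_mat D * C + transpose_mat B * P))))"
proof -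
  have N: "offset k n = N" "offset m n_in = N_in" "offset p n_out = N_out"
    using assms by (simp_all add: offset_def)
  note carr = assms(10-13)[folded N]
  obtain Ps \<kappa> where Ps: "\<And>i. i < n \<Longrightarrow> Ps i \<in> carrier_mat (k i) (k i)" "\<And>i. i < n \<Longrightarrow> positive_definite (Ps i)"
    and \<kappa>: "0 < \<kappa>"
    and diss: "strictly_dissipative (diag_block_mat (map Ps [0..<n])) A B C D \<delta> \<kappa>"
    by (rule block_diagonal_dissipation[OF assms(1,2,4,5) carr assms(14-20)]) blast+
  define P where "P = diag_block_mat (map Ps [0..<n])"
  note diss = diss[folded P_def]
  note carr = carr[unfolded N]
  have P: "P \<in> carrier_mat N N" unfolding P_def N(1)[symmetric] by (rule diag_block_mat_carrier[OF Ps(1)])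
  have pd: "positive_definite P" unfolding P_def by (rule diag_block_mat_positive_definite[OF Ps])
  have N_in: "N_in > 0"
  proof -
    have "offset m 0 + m 0 \<le> offset m n_in" by (rule offset_add_le[OF assms(2)])
    then show ?thesis using assms(5)[OF assms(2)] by (simp add: N)
  qed
  have "F \<in> carrier_mat n n" "G \<in> carrier_mat n n_in" "H \<in> carrier_mat n_out n" "J \<in> carrier_mat n_out n_in"
    unfolding assms(15-18) by (simp_all add: comparison_F_def comparison_G_def comparison_H_def comparison_J_def)
  from hinf_norm_transfer_function(1)[OF this assms(19,1,2)] have \<delta>: "0 < \<delta>" using assms(20) by simp
  have sym: "transpose_mat P = P" using pd by (simp add: positive_definite_def)
  have "hurwitz A" "hinf_norm (transfer_function A B C D) < \<delta>"
    by (rule dissipation_stability_and_gain[OF P carr N_in pd \<kappa> \<delta> diss])+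
  moreover have "negative_definite
      (P * A + transpose_mat A * P + transpose_mat C * C -
       (P * B + transpose_mat C * D) * mat_inv (transpose_mat D * D - \<delta>\<^sup>2 \<cdot>\<^sub>m 1\<^sub>m N_in) *
       (transpose_mat D * C + transpose_mat B * P))"
    by (rule dissipation_riccati[OF P carr sym \<kappa> diss])
  ultimately show ?thesis
    unfolding Let_def P_def using Ps by (intro conjI exI[of _ Ps]) auto
qed

end
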